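(* Let $X$ be a compact, locally simply connected length space with no conjugate points and finite Hausdorff dimension $d$. Then every solvable subgroup of $\pi_1(X)$ is a Bieberbach group.
   Context: A locally simply connected length space $X$ with universal cover $\pi:\hat X\to X$ (equipped with the lifted length metric) is said to have no conjugate points if any two points of $\hat X$ are joined by a unique geodesic. A Bieberbach group is a torsion-free group isomorphic to a discrete, cocompact subgroup of the isometry group of some Euclidean space $\mathbb{R}^n$ (equivalently, the fundamental group of a compact flat Riemannian manifold); the trivial group counts. *)

theory Defs
  imports "HOL-Analysis.Analysis" "HOL-Algebra.Solvable_Groups"
begin

definition partitions01 :: "real list set" where
  "partitions01 = {ts. ts \<noteq> [] \<and> sorted ts \<and> hd ts = 0 \<and> last ts = 1}"

definition curve_length :: "(real \<Rightarrow> 'a::metric_space) \<Rightarrow> ereal" where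
  "curve_length g =
     (SUP ts \<in> partitions01. ereal (\<Sum>i < length ts - 1. dist (g (ts ! i)) (g (ts ! Suc i))))"

definition length_space :: "'a::metric_space itself \<Rightarrow> bool" where
  "length_space _ \<longleftrightarrow>
     (\<forall>x y::'a. ereal (dist x y) =
        (INF g \<in> {g. path g \<and> pathstart g = x \<and> pathfinish g = y}. curve_length g))"

definition lifted_length_metric :: "('b::metric_space \<Rightarrow> 'a::metric_space) \<Rightarrow> bool" where
  "lifted_length_metric p \<longleftrightarrow>
     (\<forall>u v::'b. ereal (dist u v) =
        (INF g \<in> {g. path g \<and> pathstart g = u \<and> pathfinish g = v}. curve_length (p \<circ> g)))"

definition geodesic_on :: "(real \<Rightarrow> 'b::metric_space) \<Rightarrow> real \<Rightarrow> bool" where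
  "geodesic_on c L \<longleftrightarrow> 0 \<le> L \<and>
     (\<forall>t\<in>{0..L}. \<exists>e>0. \<forall>s\<in>{0..L}. \<forall>s'\<in>{0..L}.
        \<bar>s - t\<bar> < e \<and> \<bar>s' - t\<bar> < e \<longrightarrow> dist (c s) (c s') = \<bar>s - s'\<bar>)"

definition unique_geodesics :: "'b::metric_space itself \<Rightarrow> bool" where
  "unique_geodesics _ \<longleftrightarrow>
     (\<forall>x y::'b.
        (\<exists>c L. geodesic_on c L \<and> c 0 = x \<and> c L = y) \<and>
        (\<forall>c1 L1 c2 L2. geodesic_on c1 L1 \<and> c1 0 = x \<and> c1 L1 = y \<and>
                       geodesic_on c2 L2 \<and> c2 0 = x \<and> c2 L2 = y
             \<longrightarrow> L1 = L2 \<and> (\<forall>t\<in>{0..L1}. c1 t = c2 t)))"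

text \<open>X (the whole type 'a) has no conjugate points: for the universal cover p : 'b -> 'a,
  equipped with the lifted length metric, geodesics are unique.\<close>
definition universal_cover_length :: "('b::metric_space \<Rightarrow> 'a::metric_space) \<Rightarrow> bool" where
  "universal_cover_length p \<longleftrightarrow>
     covering_space (UNIV::'b set) p (UNIV::'a set) \<and>
     path_connected (UNIV::'b set) \<and> simply_connected (UNIV::'b set) \<and>
     lifted_length_metric p"

definition hm_term :: "real \<Rightarrow> 'a::metric_space set \<Rightarrow> ennreal" where
  "hm_term s U = (if U = {} then 0 else if s = 0 then 1 else ennreal (diameter U powr s))"

definition hausdorff_delta :: "real \<Rightarrow> real \<Rightarrow> 'a::metric_space set \<Rightarrow> ennreal" where
  "hausdorff_delta s \<delta> A =
     (INF U \<in> {U::nat \<Rightarrow> 'a set. A \<subseteq> (\<Union>n. U n) \<and> (\<forall>n. bounded (U n) \<and> diameter (U n) \<le> \<delta>)}.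
        (\<Sum>n. hm_term s (U n)))"

definition hausdorff_measure :: "real \<Rightarrow> 'a::metric_space set \<Rightarrow> ennreal" where
  "hausdorff_measure s A = (SUP \<delta> \<in> {0<..}. hausdorff_delta s \<delta> A)"

definition hausdorff_dim :: "'a::metric_space set \<Rightarrow> ereal" where
  "hausdorff_dim A = Inf {ereal s | s. 0 \<le> s \<and> hausdorff_measure s A = 0}"

definition loops_at :: "'a::topological_space \<Rightarrow> (real \<Rightarrow> 'a) set" where
  "loops_at x0 = {g. path g \<and> pathstart g = x0 \<and> pathfinish g = x0}"

definition path_class :: "(real \<Rightarrow> 'a::topological_space) \<Rightarrow> (real \<Rightarrow> 'a) set" where
  "path_class g = {h. homotopic_paths UNIV g h}"

definition fundamental_group :: "'a::topological_space \<Rightarrow> (real \<Rightarrow> 'a) set monoid" where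
  "fundamental_group x0 =
     \<lparr>carrier = path_class ` loops_at x0,
      mult = (\<lambda>A B. path_class ((SOME a. a \<in> A) +++ (SOME b. b \<in> B))),
      one = path_class (\<lambda>_. x0)\<rparr>"

definition euc :: "nat \<Rightarrow> (nat \<Rightarrow> real) set" where
  "euc n = {x. \<forall>i\<ge>n. x i = 0}"

definition euc_dist :: "nat \<Rightarrow> (nat \<Rightarrow> real) \<Rightarrow> (nat \<Rightarrow> real) \<Rightarrow> real" where
  "euc_dist n x y = sqrt (\<Sum>i<n. (x i - y i)\<^sup>2)"

definition euc_isometries :: "nat \<Rightarrow> ((nat \<Rightarrow> real) \<Rightarrow> (nat \<Rightarrow> real)) set" where
  "euc_isometries n = {f. bij_betw f (euc n) (euc n) \<and>
      (\<forall>x\<in>euc n. \<forall>y\<in>euc n. euc_dist n (f x) (f y) = euc_dist n x y) \<and>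
      (\<forall>x. x \<notin> euc n \<longrightarrow> f x = x)}"

definition isom_group :: "nat \<Rightarrow> ((nat \<Rightarrow> real) \<Rightarrow> (nat \<Rightarrow> real)) monoid" where
  "isom_group n = \<lparr>carrier = euc_isometries n, mult = (\<circ>), one = id\<rparr>"

text \<open>Discreteness in the compact-open topology of Isom(R^n): some basic neighbourhood
  of the identity (maps moving every point of the ball of radius R by less than e)
  contains no other element of the subgroup.\<close>
definition discrete_isom_subgroup :: "nat \<Rightarrow> ((nat \<Rightarrow> real) \<Rightarrow> (nat \<Rightarrow> real)) set \<Rightarrow> bool" where
  "discrete_isom_subgroup n \<Gamma> \<longleftrightarrow>
     (\<exists>e>0. \<exists>R\<ge>0. \<forall>g\<in>\<Gamma>.
        (\<forall>x\<in>euc n. euc_dist n x (\<lambda>_. 0) \<le> R \<longrightarrow> euc_dist n (g x) x < e) \<longrightarrow> g = id)"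

text \<open>Cocompactness: R^n is covered by the translates of a bounded (hence relatively compact) set.\<close>
definition cocompact_isom_subgroup :: "nat \<Rightarrow> ((nat \<Rightarrow> real) \<Rightarrow> (nat \<Rightarrow> real)) set \<Rightarrow> bool" where
  "cocompact_isom_subgroup n \<Gamma> \<longleftrightarrow>
     (\<exists>R. \<forall>x\<in>euc n. \<exists>g\<in>\<Gamma>. \<exists>y\<in>euc n. euc_dist n y (\<lambda>_. 0) \<le> R \<and> g y = x)"

definition torsion_free :: "('a, 'b) monoid_scheme \<Rightarrow> bool" where
  "torsion_free G \<longleftrightarrow>
     (\<forall>x\<in>carrier G. x \<noteq> \<one>\<^bsub>G\<^esub> \<longrightarrow> (\<forall>k::nat. k > 0 \<longrightarrow> x [^]\<^bsub>G\<^esub> k \<noteq> \<one>\<^bsub>G\<^esub>))"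

definition bieberbach :: "('a, 'b) monoid_scheme \<Rightarrow> bool" where
  "bieberbach G \<longleftrightarrow> group G \<and> torsion_free G \<and>
     (\<exists>n \<Gamma>. subgroup \<Gamma> (isom_group n) \<and> discrete_isom_subgroup n \<Gamma> \<and>
            cocompact_isom_subgroup n \<Gamma> \<and> G \<cong> (isom_group n)\<lparr>carrier := \<Gamma>\<rparr>)"

end

theory Submission
  imports Defs
begin

text \<open>The group acts by deck transformations on the universal cover, which is a proper geodesic
  space. A point where an element \<open>g\<close> has minimal displacement lies on a \<open>g\<close>-invariant local
  geodesic; uniqueness of geodesics makes it minimizing, so the minimal displacement \<open>\<tau> g\<close> equals
  the stable length and \<open>\<tau> (g ^ n) = n \<tau> g\<close>. It is conjugation invariant, subadditive on commuting
  elements and bounded below off the identity.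

  On a free abelian subgroup \<open>\<tau>\<close> is therefore a norm that is discrete on the lattice, and linear
  functionals on the lattice extend to equivariant Lipschitz functions on the cover. Together these
  map the cover onto a Euclidean space of dimension the rank, so the rank is bounded by the Hausdorff
  dimension. A central commutator has trivial \<open>\<tau>\<close>, because the length of its powers grows at most
  like a square root; hence in a solvable group a maximal abelian normal subgroup is its own
  centralizer. Since only finitely many of its elements have bounded \<open>\<tau>\<close>, it has finite index.
  Averaging a cocycle over the finite quotient turns the extension into a discrete cocompact group of
  isometries.\<close>

section \<open>Translation lengths\<close>

text \<open>Positivity of \<tau> on the nonzero elements of a lattice does not by itself give a norm
  on the real span: the function |x + y sqrt 2| is positive on nonzero integer vectors and has a
  kernel. What excludes this is the uniform lower bound, which comes from the separation of the
  fibres, combined with simultaneous approximation. Another obstacle is that abelian subgroups are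
  not known in advance to be finitely generated. They are therefore described by a maximal
  independent family, in whose span every element has some positive power, so that coordinates are
  rational; finiteness of the set of elements with bounded \<tau> then replaces finite generation.
  The group theory sees the geometry only through two functions, the displacement of a base point
  and its growth rate along powers. In the dimension estimate it suffices to hit a unit cube from
  one compact ball: along a continuous image of real k-space the extended functionals stay at
  bounded distance from the identity, and finitely many balls that project isometrically compare the
  measure of the ball with that of the base.\<close>

lemma le_of_linear_bound:
  fixes a b c :: real
  assumes "\<And>n::nat. real n * a \<le> real n * b + c"
  shows "a \<le> b"
proof (rule ccontr)
  assume "\<not> a \<le> b"
  then have ab: "a - b > 0" by simp
  obtain n :: nat where "real n > c / (a - b)" using reals_Archimedean2 by blast
  then have "real n * (a - b) > c" using ab by (simp add: field_simps)
  with assms[of n] show False by (simp add: algebra_simps)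
qed

text \<open>Dirichlet's simultaneous approximation: if \<open>n\<close> were short compared with its entries, some
  multiple of \<open>n / S\<close> would be close to a nonzero integer vector, which would then be too short.\<close>

lemma lattice_seminorm_lower_bound:
  fixes t :: "(nat \<Rightarrow> int) \<Rightarrow> real" and k :: nat and r C :: real
  assumes add: "\<And>n m. t (\<lambda>i. n i + m i) \<le> t n + t m"
    and scale: "\<And>c n. t (\<lambda>i. c * n i) = \<bar>of_int c\<bar> * t n"
    and lower: "\<And>n. \<exists>i<k. n i \<noteq> 0 \<Longrightarrow> r \<le> t n"
    and upper: "\<And>n B. (\<And>i. i < k \<Longrightarrow> \<bar>of_int (n i)\<bar> \<le> B) \<Longrightarrow> t n \<le> C * B"
    and r: "0 < r"
  shows "\<exists>c>0. \<forall>n. \<forall>i<k. c * \<bar>of_int (n i)\<bar> \<le> t n"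
proof -
  have nonneg: "0 \<le> t n" for n
  proof -
    have "t (\<lambda>i. n i + (-1) * n i) \<le> t n + t (\<lambda>i. (-1) * n i)" by (rule add)
    moreover have "t (\<lambda>i. (-1) * n i) = t n" using scale[of "-1" n] by simp
    moreover have "t (\<lambda>i. n i + (-1) * n i) = 0" using scale[of 0 n] by simp
    ultimately show ?thesis by simp
  qed
  \<comment> \<open>The mesh \<open>1 / P\<close> is chosen so that an error vector with entries
    below \<open>S / P\<close> has length at most half of \<open>r * S\<close>; the other half
    survives as the lower bound.\<close>
  obtain P0 :: nat where P0: "real P0 > 2 * C / r" using reals_Archimedean2 by blast
  define P where "P = P0 + 2"
  have P2: "P \<ge> 2" by (simp add: P_def)
  have PC: "C / real P \<le> r / 2"
  proof -
    have "real P > 2 * C / r" using P0 by (simp add: P_def)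
    then show ?thesis using r P2 by (simp add: field_simps)
  qed
  define N where "N = P ^ k"
  have N0: "N > 0" using P2 by (simp add: N_def)
  define c where "c = r / (2 * real N)"
  have "c > 0" using r N0 by (simp add: c_def)
  moreover have "c * \<bar>of_int (n i)\<bar> \<le> t n" if ik: "i < k" for n i
  proof (cases "n i = 0")
    case True then show ?thesis by (simp add: nonneg)
  next
    case False
    define S where "S = Max ((\<lambda>i. \<bar>n i\<bar>) ` {..<k})"
    have fin: "finite ((\<lambda>i. \<bar>n i\<bar>) ` {..<k})" by simp
    have le: "\<bar>n j\<bar> \<le> S" if "j < k" for j unfolding S_def using that fin by (intro Max_ge) auto
    have Spos: "S > 0" using le[OF ik] False by linarith
    have "S \<in> (\<lambda>i. \<bar>n i\<bar>) ` {..<k}" unfolding S_def using ik fin by (intro Max_in) auto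
    then obtain i0 where i0: "i0 < k" "\<bar>n i0\<bar> = S" by auto
    define rem where "rem = (\<lambda>(q::nat) j. (int q * n j) mod S)"
    define z where "z = (\<lambda>(q::nat) j. (int q * n j) div S)"
    \<comment> \<open>\<open>rem q j / S\<close> is the fractional part of
      \<open>q * n j / S\<close>, and \<open>box q\<close> records in which of the
      \<open>N = P ^ k\<close> subcubes of side \<open>1 / P\<close> the vector of fractional parts
      lies. Hence two of the \<open>N + 1\<close> multiples share a subcube.\<close>
    define box where "box = (\<lambda>q. restrict (\<lambda>j. (rem q j * int P) div S) {..<k})"
    have rem: "0 \<le> rem q j" "rem q j < S" for q j using Spos by (auto simp: rem_def)
    have zr: "int q * n j = S * z q j + rem q j" for q j by (simp add: z_def rem_def)
    have bx: "box q \<in> {..<k} \<rightarrow>\<^sub>E {0..<int P}" for q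
    proof -
      have "(rem q j * int P) div S < int P" for j
      proof -
        have "rem q j * int P < int P * S" using rem[of q j] P2 by (simp add: mult.commute)
        moreover have "(rem q j * int P) div S * S \<le> rem q j * int P"
          using div_mult_mod_eq[of "rem q j * int P" S] pos_mod_sign[of S "rem q j * int P"] Spos by linarith
        ultimately have "(rem q j * int P) div S * S < int P * S" by linarith
        then show ?thesis using Spos by simp
      qed
      moreover have "0 \<le> (rem q j * int P) div S" for j
        using rem[of q j] Spos by (simp add: pos_imp_zdiv_nonneg_iff)
      ultimately show ?thesis by (auto simp: box_def)
    qed
    have "\<not> inj_on box {..N}"
    proof
      assume inj: "inj_on box {..N}"
      have "card {..N} \<le> card ({..<k} \<rightarrow>\<^sub>E {0..<int P})"
        by (rule card_inj_on_le[OF inj]) (use bx in \<open>auto intro!: finite_PiE\<close>)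
      then show False by (simp add: card_PiE N_def)
    qed
    then obtain q q' where qq: "q \<le> N" "q' \<le> N" "box q = box q'" "q < q'"
      unfolding inj_on_def by (metis atMost_iff linorder_neqE_nat)
    define d where "d = (\<lambda>j. rem q' j - rem q j)"
    define m where "m = (\<lambda>j. z q' j - z q j)"
    \<comment> \<open>The integer vector \<open>m\<close> approximates
      \<open>(q' - q) * n / S\<close>, with error \<open>d / S\<close> below \<open>1 / P\<close> in
      each coordinate.\<close>
    have Sm: "S * m j = (int q' - int q) * n j + (-1) * d j" for j
      using zr[of q j] zr[of q' j] by (simp add: m_def d_def algebra_simps)
    have dP: "\<bar>d j\<bar> * int P < S" if "j < k" for j
    proof -
      have e: "(rem q j * int P) div S = (rem q' j * int P) div S"
        using fun_cong[OF qq(3), of j] that by (simp add: box_def)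
      have h1: "rem q j * int P = S * ((rem q j * int P) div S) + (rem q j * int P) mod S" by simp
      have h2: "rem q' j * int P = S * ((rem q' j * int P) div S) + (rem q' j * int P) mod S" by simp
      have "d j * int P = rem q' j * int P - rem q j * int P" by (simp add: d_def left_diff_distrib)
      then have "d j * int P = (rem q' j * int P) mod S - (rem q j * int P) mod S"
        using h1[unfolded e] h2 by linarith
      moreover have "0 \<le> (rem q' j * int P) mod S" "(rem q' j * int P) mod S < S"
          "0 \<le> (rem q j * int P) mod S" "(rem q j * int P) mod S < S" using Spos by auto
      ultimately have "\<bar>d j * int P\<bar> < S" by linarith
      then show ?thesis by (simp add: abs_mult)
    qed
    \<comment> \<open>In the coordinate \<open>i0\<close> the multiple of \<open>n / S\<close> has
      absolute value at least 1, too far from zero for \<open>m i0\<close> to vanish.\<close>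
    have "m i0 \<noteq> 0"
    proof
      assume "m i0 = 0"
      then have "d i0 = (int q' - int q) * n i0" using Sm[of i0] by simp
      then have "\<bar>d i0\<bar> = (int q' - int q) * \<bar>n i0\<bar>" using qq(4) by (simp add: abs_mult)
      then have "\<bar>d i0\<bar> = (int q' - int q) * S" by (simp only: i0(2))
      moreover have "(int q' - int q) * S \<ge> 1 * S" using qq(4) Spos by (intro mult_right_mono) auto
      moreover have "\<bar>d i0\<bar> * int P \<ge> \<bar>d i0\<bar> * 1" using P2 by (intro mult_left_mono) auto
      ultimately show False using dP[OF i0(1)] by linarith
    qed
    then have rm: "r \<le> t m" using i0 by (intro lower) auto
    have td: "t (\<lambda>j. (-1) * d j) \<le> C * (of_int S / real P)"
    proof (rule upper)
      fix j assume "j < k"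
      then have "of_int (\<bar>d j\<bar> * int P) < (of_int S :: real)" using dP of_int_less_iff by blast
      then show "\<bar>of_int ((-1) * d j)\<bar> \<le> (of_int S :: real) / real P" using P2 by (simp add: field_simps)
    qed
    have "of_int S * t m = t (\<lambda>j. S * m j)" using scale[of S m] Spos by simp
    also have "\<dots> = t (\<lambda>j. (int q' - int q) * n j + (-1) * d j)" by (simp only: Sm)
    also have "\<dots> \<le> t (\<lambda>j. (int q' - int q) * n j) + t (\<lambda>j. (-1) * d j)" by (rule add)
    also have "t (\<lambda>j. (int q' - int q) * n j) = \<bar>of_int (int q' - int q)\<bar> * t n" by (rule scale)
    also have "\<dots> \<le> real N * t n" using qq nonneg by (intro mult_right_mono) auto
    finally have "of_int S * t m \<le> real N * t n + C * (of_int S / real P)" using td by linarith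
    moreover have "of_int S * r \<le> of_int S * t m" using rm Spos by simp
    moreover have "C * (of_int S / real P) \<le> of_int S * (r / 2)"
      using mult_right_mono[OF PC, of "of_int S"] Spos by (simp add: field_simps)
    moreover have "of_int S * r = of_int S * (r / 2) + of_int S * (r / 2)" by simp
    ultimately have "of_int S * (r / 2) \<le> real N * t n" by linarith
    then have "c * of_int S \<le> t n" using N0 by (simp add: c_def field_simps)
    moreover have "c * \<bar>of_int (n i)\<bar> \<le> c * of_int S"
      using le[OF ik] \<open>c > 0\<close> by (intro mult_left_mono) (simp_all flip: of_int_abs)
    ultimately show ?thesis by linarith
  qed
  ultimately show ?thesis by blast
qed

section \<open>Products of integer powers of commuting elements\<close>

primrec mprod :: "('a, 'b) monoid_scheme \<Rightarrow> (nat \<Rightarrow> 'a) \<Rightarrow> (nat \<Rightarrow> int) \<Rightarrow> nat \<Rightarrow> 'a" where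
  "mprod G a n 0 = \<one>\<^bsub>G\<^esub>"
| "mprod G a n (Suc k) = mprod G a n k \<otimes>\<^bsub>G\<^esub> (a k [^]\<^bsub>G\<^esub> n k)"

definition commuting_family :: "('a, 'b) monoid_scheme \<Rightarrow> (nat \<Rightarrow> 'a) \<Rightarrow> nat \<Rightarrow> bool" where
  "commuting_family G a k \<longleftrightarrow> (\<forall>i<k. a i \<in> carrier G) \<and>
     (\<forall>i<k. \<forall>j<k. a i \<otimes>\<^bsub>G\<^esub> a j = a j \<otimes>\<^bsub>G\<^esub> a i)"

text \<open>For a commuting family, \<open>mprod\<close> evaluates the homomorphism from integer
  vectors of length \<open>k\<close> that sends the unit vectors to the family; independence is its
  injectivity, stated as a trivial kernel.\<close>

definition independent_family :: "('a, 'b) monoid_scheme \<Rightarrow> (nat \<Rightarrow> 'a) \<Rightarrow> nat \<Rightarrow> bool" where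
  "independent_family G a k \<longleftrightarrow> (\<forall>n. mprod G a n k = \<one>\<^bsub>G\<^esub> \<longrightarrow> (\<forall>i<k. n i = 0))"

context group
begin

text \<open>This settles the commutation questions below at once: powers and ordered products of
  elements commuting with \<open>b\<close> stay in the centralizer.\<close>

lemma centralizer_subgroup:
  assumes "b \<in> carrier G"
  shows "subgroup {x \<in> carrier G. b \<otimes> x = x \<otimes> b} G"
proof (rule subgroupI)
  show "{x \<in> carrier G. b \<otimes> x = x \<otimes> b} \<noteq> {}" using assms by auto
next
  fix x assume "x \<in> {x \<in> carrier G. b \<otimes> x = x \<otimes> b}"
  then have x: "x \<in> carrier G" "b \<otimes> x = x \<otimes> b" by auto
  have "b \<otimes> inv x = inv x \<otimes> b"
    using x assms by (metis inv_closed inv_solve_left' inv_solve_right m_assoc m_closed)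
  then show "inv x \<in> {x \<in> carrier G. b \<otimes> x = x \<otimes> b}" using x by simp
next
  fix x y assume "x \<in> {x \<in> carrier G. b \<otimes> x = x \<otimes> b}" "y \<in> {x \<in> carrier G. b \<otimes> x = x \<otimes> b}"
  then have x: "x \<in> carrier G" "b \<otimes> x = x \<otimes> b" and y: "y \<in> carrier G" "b \<otimes> y = y \<otimes> b" by auto
  have "b \<otimes> (x \<otimes> y) = (b \<otimes> x) \<otimes> y" using x(1) y(1) assms by (simp add: m_assoc)
  also have "\<dots> = x \<otimes> (b \<otimes> y)" unfolding x(2) using x(1) y(1) assms by (simp add: m_assoc)
  also have "\<dots> = (x \<otimes> y) \<otimes> b" unfolding y(2) using x(1) y(1) assms by (simp add: m_assoc)
  finally show "x \<otimes> y \<in> {x \<in> carrier G. b \<otimes> x = x \<otimes> b}" using x y by simp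
qed auto

lemma commute_int_pow:
  fixes n :: int
  assumes "b \<in> carrier G" "x \<in> carrier G" "b \<otimes> x = x \<otimes> b"
  shows "b \<otimes> (x [^] n) = (x [^] n) \<otimes> b"
  using subgroup_int_pow_closed[OF centralizer_subgroup[OF assms(1)], of x n] assms by auto

lemma mprod_in_subgroup:
  assumes "subgroup H G" "\<And>i. i < k \<Longrightarrow> a i \<in> H"
  shows "mprod G a n k \<in> H"
  using assms(2)
proof (induction k)
  case 0 then show ?case using assms(1) by (simp add: subgroup.one_closed)
next
  case (Suc k)
  then show ?case using assms(1) by (simp add: subgroup.m_closed subgroup_int_pow_closed)
qed

lemma mprod_closed:
  assumes "commuting_family G a k"
  shows "mprod G a n k \<in> carrier G"
  using assms by (intro mprod_in_subgroup subgroup_self) (auto simp: commuting_family_def)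

lemma mprod_commute:
  assumes "b \<in> carrier G" "\<And>i. i < k \<Longrightarrow> a i \<in> carrier G \<and> b \<otimes> a i = a i \<otimes> b"
  shows "b \<otimes> mprod G a n k = mprod G a n k \<otimes> b"
  using mprod_in_subgroup[OF centralizer_subgroup[OF assms(1)], of k a n] assms by auto

lemma commuting_family_le:
  "commuting_family G a k \<Longrightarrow> j \<le> k \<Longrightarrow> commuting_family G a j"
  by (auto simp: commuting_family_def)

lemma mprod_add:
  assumes "commuting_family G a k"
  shows "mprod G a (\<lambda>i. n i + m i) k = mprod G a n k \<otimes> mprod G a m k"
  using assms
proof (induction k)
  case (Suc k)
  have cf: "commuting_family G a k" using Suc.prems by (rule commuting_family_le) simp
  have ak: "a k \<in> carrier G" using Suc.prems by (auto simp: commuting_family_def)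
  have com: "a k [^] n k \<otimes> mprod G a m k = mprod G a m k \<otimes> a k [^] n k"
    using mprod_commute[of "a k [^] n k" k a m] Suc.prems ak
    by (metis commute_int_pow commuting_family_def int_pow_closed less_SucI lessI)
  show ?case
  proof -
    have "mprod G a (\<lambda>i. n i + m i) (Suc k) = mprod G a n k \<otimes> (mprod G a m k \<otimes> a k [^] n k) \<otimes> a k [^] m k"
      using Suc.IH[OF cf] mprod_closed[OF cf] ak by (simp add: int_pow_mult m_assoc)
    also have "\<dots> = mprod G a n k \<otimes> (a k [^] n k \<otimes> mprod G a m k) \<otimes> a k [^] m k" by (simp only: com)
    also have "\<dots> = mprod G a n (Suc k) \<otimes> mprod G a m (Suc k)"
      using mprod_closed[OF cf] ak by (simp add: m_assoc)
    finally show ?thesis .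
  qed
qed simp

lemma mprod_scale:
  assumes "commuting_family G a k"
  shows "mprod G a (\<lambda>i. c * n i) k = mprod G a n k [^] (c::int)"
  using assms
proof (induction k)
  case (Suc k)
  have cf: "commuting_family G a k" using Suc.prems by (rule commuting_family_le) simp
  have ak: "a k \<in> carrier G" using Suc.prems by (auto simp: commuting_family_def)
  have com: "a k [^] n k \<otimes> mprod G a n k = mprod G a n k \<otimes> a k [^] n k"
    using mprod_commute[of "a k [^] n k" k a n] Suc.prems ak
    by (metis commute_int_pow commuting_family_def int_pow_closed less_SucI lessI)
  show ?case
    using Suc.IH[OF cf] mprod_closed[OF cf] ak com
    by (simp add: int_pow_mult_distrib int_pow_pow mult.commute)
qed simp

lemma mprod_cong:
  "(\<And>i. i < k \<Longrightarrow> a i = b i) \<Longrightarrow> (\<And>i. i < k \<Longrightarrow> n i = m i) \<Longrightarrow> mprod G a n k = mprod G b m k"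
  by (induction k) auto

lemma mprod_zero: "commuting_family G a k \<Longrightarrow> mprod G a (\<lambda>_. 0) k = \<one>"
  by (induction k) (auto simp: commuting_family_le)

lemma mprod_unit:
  assumes "commuting_family G a k" "j < k"
  shows "mprod G a (\<lambda>i. if i = j then 1 else 0) k = a j"
  using assms
proof (induction k)
  case (Suc k)
  have cf: "commuting_family G a k" using Suc.prems(1) by (rule commuting_family_le) simp
  have ak: "a k \<in> carrier G" using Suc.prems by (auto simp: commuting_family_def)
  show ?case
  proof (cases "j = k")
    case True
    have "mprod G a (\<lambda>i. if i = j then 1 else 0) k = mprod G a (\<lambda>_. 0) k"
      using True by (intro mprod_cong) auto
    then show ?thesis using True ak by (simp add: mprod_zero[OF cf] int_pow_1)
  next
    case False
    then show ?thesis using Suc cf ak by (simp add: commuting_family_def)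
  qed
qed simp

end

text \<open>\<open>len\<close> models the displacement of a base point and \<open>tl\<close> its
  growth rate along powers. The error in \<open>len_pow\<close> is bounded for each element, so
  facts about \<open>tl\<close> follow by comparing linear growth, and additive constants may be
  discarded.\<close>

locale translation_length = group G for G (structure) +
  fixes len tl :: "'a \<Rightarrow> real" and r :: real
  assumes len_mult: "\<lbrakk>x \<in> carrier G; y \<in> carrier G\<rbrakk> \<Longrightarrow> len (x \<otimes> y) \<le> len x + len y"
    and len_inv: "x \<in> carrier G \<Longrightarrow> len (inv x) = len x"
    and len_pow: "x \<in> carrier G \<Longrightarrow> \<exists>c. \<forall>n::nat. \<bar>len (x [^] n) - real n * tl x\<bar> \<le> c"
    and r_pos: "0 < r"
    and tl_ge: "\<lbrakk>x \<in> carrier G; x \<noteq> \<one>\<rbrakk> \<Longrightarrow> r \<le> tl x"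
begin

lemma tl_leI:
  assumes x: "x \<in> carrier G" and le: "\<And>n::nat. len (x [^] n) \<le> real n * b + c"
  shows "tl x \<le> b"
proof -
  obtain c' where c': "\<And>n::nat. \<bar>len (x [^] n) - real n * tl x\<bar> \<le> c'" using len_pow[OF x] by blast
  have "real n * tl x \<le> real n * b + (c + c')" for n :: nat
    using le[of n] c'[of n] by linarith
  then show ?thesis by (rule le_of_linear_bound)
qed

lemma len_nat_pow: "x \<in> carrier G \<Longrightarrow> len (x [^] (n::nat)) \<le> real n * len x + len \<one>"
proof (induction n)
  case (Suc n)
  have "len (x [^] n \<otimes> x) \<le> len (x [^] n) + len x" using Suc.prems by (intro len_mult) auto
  then show ?case using Suc by (simp add: algebra_simps)
qed simp

lemma tl_le_len: "x \<in> carrier G \<Longrightarrow> tl x \<le> len x"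
  using len_nat_pow by (intro tl_leI[where c = "len \<one>"]) auto

lemma tl_pow:
  assumes x: "x \<in> carrier G"
  shows "tl (x [^] (n::nat)) = real n * tl x"
proof (rule antisym)
  obtain c where c: "\<And>n::nat. \<bar>len (x [^] n) - real n * tl x\<bar> \<le> c" using len_pow[OF x] by blast
  obtain c' where c': "\<And>m::nat. \<bar>len ((x [^] n) [^] m) - real m * tl (x [^] n)\<bar> \<le> c'"
    using len_pow[of "x [^] n"] x by auto
  have eq: "(x [^] n) [^] m = x [^] (n * m)" for m :: nat using x by (simp add: nat_pow_pow)
  have *: "\<bar>real m * tl (x [^] n) - real m * (real n * tl x)\<bar> \<le> c + c'" for m :: nat
    using c[of "n * m"] c'[of m] unfolding eq by (simp add: algebra_simps)
  show "tl (x [^] n) \<le> real n * tl x"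
  proof (rule le_of_linear_bound)
    show "real m * tl (x [^] n) \<le> real m * (real n * tl x) + (c + c')" for m :: nat
      using *[of m] by linarith
  qed
  show "real n * tl x \<le> tl (x [^] n)"
  proof (rule le_of_linear_bound)
    show "real m * (real n * tl x) \<le> real m * tl (x [^] n) + (c + c')" for m :: nat
      using *[of m] by linarith
  qed
qed

lemma tl_one: "tl \<one> = 0"
  using tl_pow[of \<one> 2] by simp

lemma tl_nonneg: "x \<in> carrier G \<Longrightarrow> 0 \<le> tl x"
  using tl_ge[of x] r_pos tl_one by (cases "x = \<one>") auto

lemma tl_eq_0: "x \<in> carrier G \<Longrightarrow> tl x < r \<Longrightarrow> x = \<one>"
  using tl_ge by force

lemma tl_inv: "x \<in> carrier G \<Longrightarrow> tl (inv x) = tl x"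
proof -
  have *: "tl (inv x) \<le> tl x" if x: "x \<in> carrier G" for x
  proof -
    obtain c where c: "\<And>n::nat. \<bar>len (x [^] n) - real n * tl x\<bar> \<le> c" using len_pow[OF x] by blast
    have "len (inv x [^] n) \<le> real n * tl x + c" for n :: nat
      using c[of n] x len_inv[of "x [^] n"] by (simp add: nat_pow_inv)
    then show ?thesis using x by (intro tl_leI) auto
  qed
  assume x: "x \<in> carrier G"
  show ?thesis using *[OF x] *[of "inv x"] x by simp
qed

lemma tl_int_pow:
  assumes x: "x \<in> carrier G"
  shows "tl (x [^] (n::int)) = \<bar>of_int n\<bar> * tl x"
proof (cases "0 \<le> n")
  case True
  then obtain m where "n = int m" using nonneg_int_cases by blast
  then show ?thesis using tl_pow[OF x] by (simp add: int_pow_int)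
next
  case False
  then obtain m where "n = - int m" by (metis int_cases2 of_nat_0_le_iff)
  then show ?thesis using tl_pow[OF x, of m] x by (simp add: int_pow_neg int_pow_int tl_inv)
qed

lemma tl_mult:
  assumes x: "x \<in> carrier G" and y: "y \<in> carrier G" and xy: "x \<otimes> y = y \<otimes> x"
  shows "tl (x \<otimes> y) \<le> tl x + tl y"
proof -
  obtain c where c: "\<And>n::nat. \<bar>len (x [^] n) - real n * tl x\<bar> \<le> c" using len_pow[OF x] by blast
  obtain c' where c': "\<And>n::nat. \<bar>len (y [^] n) - real n * tl y\<bar> \<le> c'" using len_pow[OF y] by blast
  have "len ((x \<otimes> y) [^] n) \<le> real n * (tl x + tl y) + (c + c')" for n :: nat
  proof -
    have "len ((x \<otimes> y) [^] n) \<le> len (x [^] n) + len (y [^] n)"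
      using x y by (simp add: pow_mult_distrib[OF xy] len_mult)
    then show ?thesis using c[of n] c'[of n] by (simp add: algebra_simps)
  qed
  then show ?thesis using x y by (intro tl_leI) auto
qed

lemma nat_pow_conj:
  "x \<in> carrier G \<Longrightarrow> h \<in> carrier G \<Longrightarrow> (h \<otimes> x \<otimes> inv h) [^] (n::nat) = h \<otimes> x [^] n \<otimes> inv h"
proof (induction n)
  case (Suc n)
  have "(h \<otimes> x [^] n \<otimes> inv h) \<otimes> (h \<otimes> x \<otimes> inv h) = h \<otimes> x [^] n \<otimes> (inv h \<otimes> h) \<otimes> x \<otimes> inv h"
    using Suc.prems by (simp only: m_assoc m_closed inv_closed nat_pow_closed)
  then show ?case using Suc by (simp add: m_assoc)
qed simp

text \<open>Conjugation by \<open>h\<close> changes the length of each power by at most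
  \<open>2 * len h\<close>, a constant that the growth rate does not see.\<close>

lemma tl_conj:
  assumes "x \<in> carrier G" "h \<in> carrier G"
  shows "tl (h \<otimes> x \<otimes> inv h) = tl x"
proof -
  have *: "tl (h \<otimes> x \<otimes> inv h) \<le> tl x" if x: "x \<in> carrier G" and h: "h \<in> carrier G" for x h
  proof -
    obtain c where c: "\<And>n::nat. \<bar>len (x [^] n) - real n * tl x\<bar> \<le> c" using len_pow[OF x] by blast
    have "len ((h \<otimes> x \<otimes> inv h) [^] n) \<le> real n * tl x + (c + 2 * len h)" for n :: nat
    proof -
      have "len ((h \<otimes> x [^] n) \<otimes> inv h) \<le> len (h \<otimes> x [^] n) + len (inv h)"
        using x h by (intro len_mult) auto
      also have "len (h \<otimes> x [^] n) \<le> len h + len (x [^] n)" using x h by (intro len_mult) auto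
      finally show ?thesis using c[of n] len_inv[OF h] by (simp add: nat_pow_conj[OF x h])
    qed
    then show ?thesis using x h by (intro tl_leI) auto
  qed
  have "inv h \<otimes> (h \<otimes> x \<otimes> inv h) \<otimes> inv (inv h) = x"
    using assms by (metis inv_closed inv_inv inv_solve_left' inv_solve_right m_assoc m_closed)
  then show ?thesis using *[of x h] *[of "h \<otimes> x \<otimes> inv h" "inv h"] assms by simp
qed

lemma nat_pow_eq_one:
  assumes "x \<in> carrier G" "x [^] (n::nat) = \<one>" "n > 0"
  shows "x = \<one>"
proof -
  have "real n * tl x = 0" using tl_pow[OF assms(1), of n] assms(2) tl_one by simp
  then have "tl x = 0" using assms(3) by simp
  then show ?thesis using tl_eq_0[OF assms(1)] r_pos by simp
qed

text \<open>For commuting elements the quotient has trivial \<open>n\<close>-th power, and positive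
  growth rates exclude torsion.\<close>

lemma nat_pow_cancel:
  assumes "x \<in> carrier G" "y \<in> carrier G" "x \<otimes> y = y \<otimes> x" "x [^] (n::nat) = y [^] n" "n > 0"
  shows "x = y"
proof -
  have "x \<otimes> inv y = inv y \<otimes> x"
    using commute_int_pow[of x y "-1"] assms by (simp add: int_pow_neg int_pow_1)
  then have "(x \<otimes> inv y) [^] n = x [^] n \<otimes> inv y [^] n" using assms by (intro pow_mult_distrib) auto
  also have "\<dots> = \<one>" unfolding assms(4) using assms(2) by (simp add: nat_pow_inv)
  finally have "x \<otimes> inv y = \<one>" using nat_pow_eq_one[of "x \<otimes> inv y" n] assms(1,2,5) by simp
  then show ?thesis using assms(1,2) by (metis inv_closed inv_equality inv_inv)
qed

text \<open>A commutator that commutes with both entries is bilinear, as in the Heisenberg group: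
  moving each \<open>x\<close> past each \<open>y\<close> costs one factor \<open>c\<close>.\<close>

lemma commutator_pow:
  assumes x: "x \<in> carrier G" and y: "y \<in> carrier G" and c: "c \<in> carrier G"
    and xy: "x \<otimes> y = c \<otimes> (y \<otimes> x)" and cx: "c \<otimes> x = x \<otimes> c" and cy: "c \<otimes> y = y \<otimes> c"
  shows "x [^] (n::nat) \<otimes> y [^] (m::nat) = c [^] (n * m) \<otimes> (y [^] m \<otimes> x [^] n)"
proof -
  have 1: "x [^] n \<otimes> y = c [^] n \<otimes> (y \<otimes> x [^] n)" for n :: nat
  proof (induction n)
    case (Suc n)
    have cnx: "c [^] n \<otimes> x = x \<otimes> c [^] n" using commute_int_pow[of x c "int n"] x c cx by (simp add: int_pow_int)
    have "x [^] Suc n \<otimes> y = x [^] n \<otimes> (x \<otimes> y)" using x y by (simp add: m_assoc)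
    also have "\<dots> = (x [^] n \<otimes> c) \<otimes> (y \<otimes> x)" using x y c by (simp add: xy m_assoc)
    also have "x [^] n \<otimes> c = c \<otimes> x [^] n" using commute_int_pow[of c x "int n"] x c cx by (simp add: int_pow_int)
    also have "(c \<otimes> x [^] n) \<otimes> (y \<otimes> x) = c \<otimes> (x [^] n \<otimes> y) \<otimes> x" using x y c by (simp add: m_assoc)
    also have "\<dots> = (c \<otimes> c [^] n) \<otimes> (y \<otimes> (x [^] n \<otimes> x))" using x y c Suc by (simp add: m_assoc)
    also have "c \<otimes> c [^] n = c [^] Suc n" using c by (metis nat_pow_Suc2)
    finally show ?case by simp
  qed (use x y in simp)
  show ?thesis
  proof (induction m)
    case (Suc m)
    have cc: "y [^] m \<otimes> c [^] n = c [^] n \<otimes> y [^] m"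
    proof -
      have "y \<otimes> c [^] n = c [^] n \<otimes> y" using commute_int_pow[of y c "int n"] y c cy by (simp add: int_pow_int)
      then show ?thesis using commute_int_pow[of "c [^] n" y "int m"] y c by (simp add: int_pow_int)
    qed
    have "x [^] n \<otimes> y [^] Suc m = (x [^] n \<otimes> y [^] m) \<otimes> y" using x y by (simp add: m_assoc)
    also have "\<dots> = c [^] (n * m) \<otimes> (y [^] m \<otimes> (x [^] n \<otimes> y))" using x y c Suc by (simp add: m_assoc)
    also have "\<dots> = c [^] (n * m) \<otimes> ((y [^] m \<otimes> c [^] n) \<otimes> (y \<otimes> x [^] n))" using x y c by (simp add: 1 m_assoc)
    also have "\<dots> = (c [^] (n * m) \<otimes> c [^] n) \<otimes> ((y [^] m \<otimes> y) \<otimes> x [^] n)" using x y c by (simp add: cc m_assoc)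
    also have "c [^] (n * m) \<otimes> c [^] n = c [^] (n * Suc m)" using c by (simp add: nat_pow_mult add.commute)
    finally show ?case by simp
  qed (use x y c in simp)
qed

text \<open>The power \<open>c ^ n\<^sup>2\<close> is the commutator of \<open>x ^ n\<close> and \<open>y ^ n\<close>, so its length grows
  only linearly in \<open>n\<close>.\<close>

lemma central_commutator_trivial:
  assumes x: "x \<in> carrier G" and y: "y \<in> carrier G" and c: "c \<in> carrier G"
    and xy: "x \<otimes> y = c \<otimes> (y \<otimes> x)" and cx: "c \<otimes> x = x \<otimes> c" and cy: "c \<otimes> y = y \<otimes> c"
  shows "c = \<one>"
proof -
  \<comment> \<open>\<open>len \<one>\<close> is not assumed to vanish and enters once for each of
    the four powers in the commutator; for positive \<open>n\<close> it is absorbed into the linear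
    term.\<close>
  define M where "M = 2 * len x + 2 * len y + 4 * len \<one>"
  have o: "len \<one> \<ge> 0" using len_mult[of \<one> \<one>] by simp
  have "real n * tl c \<le> real n * 0 + M" for n :: nat
  proof (cases "n = 0")
    case True
    have "0 \<le> len x" "0 \<le> len y"
      using tl_le_len tl_nonneg x y by (meson order_trans)+
    then show ?thesis using True o by (simp add: M_def)
  next
    case False
    have X: "x [^] n \<in> carrier G" and Y: "y [^] n \<in> carrier G" and C: "c [^] (n * n) \<in> carrier G"
      using x y c by auto
    have "c [^] (n * n) = (x [^] n \<otimes> y [^] n) \<otimes> inv (y [^] n \<otimes> x [^] n)"
      using commutator_pow[OF assms, of n n] X Y C by (metis inv_solve_right m_closed)
    then have "len (c [^] (n * n)) \<le> len (x [^] n \<otimes> y [^] n) + len (inv (y [^] n \<otimes> x [^] n))"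
      using X Y by (metis inv_closed len_mult m_closed)
    also have "\<dots> \<le> 2 * (len (x [^] n) + len (y [^] n))"
      using len_mult[OF X Y] len_mult[OF Y X] len_inv[of "y [^] n \<otimes> x [^] n"] X Y by simp
    also have "\<dots> \<le> 2 * (real n * len x + real n * len y + 2 * len \<one>)"
      using len_nat_pow[OF x, of n] len_nat_pow[OF y, of n] by simp
    also have "\<dots> \<le> real n * M"
    proof -
      have "len \<one> \<le> real n * len \<one>" using False o by (simp add: mult_le_cancel_right1)
      then show ?thesis by (simp add: M_def algebra_simps)
    qed
    finally have "real (n * n) * tl c \<le> real n * M"
      using tl_le_len[OF C] tl_pow[OF c, of "n * n"] by linarith
    then show ?thesis using False by (simp add: mult.assoc)
  qed
  then have "tl c \<le> 0" by (rule le_of_linear_bound)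
  then show ?thesis using tl_eq_0[OF c] r_pos by simp
qed

lemma tl_mprod_le:
  assumes "commuting_family G a k"
  shows "tl (mprod G a n k) \<le> (\<Sum>i<k. \<bar>of_int (n i)\<bar> * tl (a i))"
  using assms
proof (induction k)
  case 0 then show ?case by (simp add: tl_one)
next
  case (Suc k)
  have cf: "commuting_family G a k" using Suc.prems by (rule commuting_family_le) simp
  have ak: "a k \<in> carrier G" using Suc.prems by (auto simp: commuting_family_def)
  have com: "a k [^] n k \<otimes> mprod G a n k = mprod G a n k \<otimes> a k [^] n k"
    using mprod_commute[of "a k [^] n k" k a n] Suc.prems ak
    by (metis commute_int_pow commuting_family_def int_pow_closed less_SucI lessI)
  have "tl (mprod G a n k \<otimes> a k [^] n k) \<le> tl (mprod G a n k) + tl (a k [^] n k)"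
    using com mprod_closed[OF cf] ak by (intro tl_mult) auto
  then show ?case using Suc.IH[OF cf] ak by (simp add: tl_int_pow)
qed

text \<open>On exponent vectors \<open>tl\<close> is subadditive and homogeneous, and independence
  turns \<open>tl_ge\<close> into the uniform bound \<open>r\<close> off zero that the lattice
  estimate requires.\<close>

lemma tl_mprod_ge:
  assumes cf: "commuting_family G a k" and ind: "independent_family G a k"
  shows "\<exists>c>0. \<forall>n. \<forall>i<k. c * \<bar>of_int (n i)\<bar> \<le> tl (mprod G a n k)"
proof (rule lattice_seminorm_lower_bound)
  show "tl (mprod G a (\<lambda>i. n i + m i) k) \<le> tl (mprod G a n k) + tl (mprod G a m k)" for n m
  proof -
    have "mprod G a n k \<otimes> mprod G a m k = mprod G a m k \<otimes> mprod G a n k"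
      unfolding mprod_add[OF cf, symmetric] by (simp add: add.commute)
    then show ?thesis unfolding mprod_add[OF cf] by (intro tl_mult mprod_closed[OF cf])
  qed
  show "tl (mprod G a (\<lambda>i. c * n i) k) = \<bar>of_int c\<bar> * tl (mprod G a n k)" for c n
    by (simp add: mprod_scale[OF cf] tl_int_pow mprod_closed[OF cf])
  show "r \<le> tl (mprod G a n k)" if "\<exists>i<k. n i \<noteq> 0" for n
    using that ind mprod_closed[OF cf] by (intro tl_ge) (auto simp: independent_family_def)
  show "tl (mprod G a n k) \<le> (\<Sum>i<k. tl (a i)) * B"
    if "\<And>i. i < k \<Longrightarrow> \<bar>of_int (n i)\<bar> \<le> B" for n B
  proof -
    have "(\<Sum>i<k. \<bar>of_int (n i)\<bar> * tl (a i)) \<le> (\<Sum>i<k. B * tl (a i))"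
      using that cf by (intro sum_mono mult_right_mono tl_nonneg) (auto simp: commuting_family_def)
    then show ?thesis using tl_mprod_le[OF cf, of n] by (simp add: sum_distrib_left mult.commute)
  qed
qed (rule r_pos)

end

section \<open>Abelian subgroups and solvable groups\<close>

text \<open>The family spans \<open>A\<close> only up to powers, since finite generation is not yet
  available: \<open>A\<close> lies between a free abelian group of rank \<open>k\<close> and its
  rational span.\<close>

locale rational_basis = translation_length +
  fixes A :: "'a set" and a :: "nat \<Rightarrow> 'a" and k :: nat
  assumes A_subgroup: "subgroup A G"
    and A_comm: "\<lbrakk>x \<in> A; y \<in> A\<rbrakk> \<Longrightarrow> x \<otimes> y = y \<otimes> x"
    and a_in: "i < k \<Longrightarrow> a i \<in> A"
    and a_indep: "independent_family G a k"
    and a_span: "b \<in> A \<Longrightarrow> \<exists>m>0. \<exists>n. b [^] (m::nat) = mprod G a n k"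
begin

lemma A_carrier: "x \<in> A \<Longrightarrow> x \<in> carrier G"
  using A_subgroup by (rule subgroup.mem_carrier)

lemma a_commuting: "commuting_family G a k"
  using a_in A_comm A_carrier by (auto simp: commuting_family_def)

definition coord :: "'a \<Rightarrow> nat \<Rightarrow> real" where
  "coord b = (SOME v. \<exists>m>0. \<exists>n. b [^] (m::nat) = mprod G a n k \<and>
     v = (\<lambda>i. if i < k then of_int (n i) / of_nat m else 0))"

lemma mprod_inject:
  assumes "mprod G a n k = mprod G a n' k" "i < k"
  shows "n i = n' i"
proof -
  have "mprod G a (\<lambda>i. n i + (-1) * n' i) k = mprod G a n k \<otimes> mprod G a n' k [^] (-1::int)"
    unfolding mprod_add[OF a_commuting] mprod_scale[OF a_commuting] ..
  also have "\<dots> = \<one>" using assms(1) mprod_closed[OF a_commuting] by (simp add: int_pow_neg int_pow_1)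
  finally show ?thesis using a_indep assms(2) unfolding independent_family_def by fastforce
qed

lemma mprod_nat_scale: "mprod G a n k [^] (m::nat) = mprod G a (\<lambda>i. int m * n i) k"
  by (simp add: mprod_scale[OF a_commuting] int_pow_int)

text \<open>Writing \<open>b [^] (m * m')\<close> in two ways gives proportional exponent vectors by
  independence, so the quotients do not depend on the chosen power. The value zero beyond
  \<open>k\<close> places coordinate vectors in \<open>euc k\<close>.\<close>

lemma coord_eqI:
  assumes "b \<in> A" "(m::nat) > 0" "b [^] m = mprod G a n k"
  shows "coord b = (\<lambda>i. if i < k then of_int (n i) / of_nat m else 0)"
proof -
  have "\<exists>m>0. \<exists>n. b [^] (m::nat) = mprod G a n k \<and>
     coord b = (\<lambda>i. if i < k then of_int (n i) / of_nat m else 0)"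
    (is "?P (coord b)")
  proof -
    have "?P (\<lambda>i. if i < k then of_int (n i) / of_nat m else 0)" using assms by blast
    then show ?thesis unfolding coord_def by (rule someI[where P = ?P])
  qed
  then obtain m' :: nat and n' where *: "m' > 0" "b [^] m' = mprod G a n' k"
      "coord b = (\<lambda>i. if i < k then of_int (n' i) / of_nat m' else 0)" by blast
  have "mprod G a (\<lambda>i. int m' * n i) k = b [^] (m * m')"
    unfolding mprod_nat_scale[symmetric] assms(3)[symmetric] using assms(1) by (simp add: A_carrier nat_pow_pow)
  also have "\<dots> = (b [^] m') [^] m" using assms(1) by (simp add: A_carrier nat_pow_pow mult.commute)
  also have "\<dots> = mprod G a (\<lambda>i. int m * n' i) k" by (simp add: *(2) mprod_nat_scale)
  finally have "int m' * n i = int m * n' i" if "i < k" for i by (rule mprod_inject) (rule that)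
  then have eq: "real m' * of_int (n i) = real m * of_int (n' i)" if "i < k" for i
    using that by (metis of_int_mult of_int_of_nat_eq)
  show ?thesis unfolding *(3)
  proof (rule ext)
    fix i
    show "(if i < k then real_of_int (n' i) / real m' else 0) = (if i < k then real_of_int (n i) / real m else 0)"
      using eq[of i] *(1) assms(2) by (auto simp: field_simps)
  qed
qed

lemma coord_outside: "b \<in> A \<Longrightarrow> i \<ge> k \<Longrightarrow> coord b i = 0"
  using a_span[of b] coord_eqI[of b] by fastforce

lemma coord_mprod: "coord (mprod G a n k) = (\<lambda>i. if i < k then of_int (n i) else 0)"
proof -
  have "mprod G a n k \<in> A" using A_subgroup a_in by (rule mprod_in_subgroup)
  then have "coord (mprod G a n k) = (\<lambda>i. if i < k then of_int (n i) / of_nat 1 else 0)"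
    by (intro coord_eqI) (simp_all add: A_carrier)
  then show ?thesis by (simp cong: if_cong)
qed

lemma coord_a: "j < k \<Longrightarrow> coord (a j) = (\<lambda>i. if i = j then 1 else 0)"
  using coord_mprod[of "\<lambda>i. if i = j then 1 else 0"] by (auto simp: mprod_unit[OF a_commuting])

lemma coord_mult:
  assumes x: "x \<in> A" and y: "y \<in> A"
  shows "coord (x \<otimes> y) i = coord x i + coord y i"
proof -
  obtain m n where m: "(m::nat) > 0" "x [^] m = mprod G a n k" using a_span[OF x] by blast
  obtain m' n' where m': "(m'::nat) > 0" "y [^] m' = mprod G a n' k" using a_span[OF y] by blast
  have "(x \<otimes> y) [^] (m * m') = (x [^] m) [^] m' \<otimes> (y [^] m') [^] m"
    using x y by (simp add: pow_mult_distrib[OF A_comm[OF x y]] A_carrier nat_pow_pow mult.commute[of m' m])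
  also have "\<dots> = mprod G a (\<lambda>i. int m' * n i + int m * n' i) k"
    by (simp add: m m' mprod_nat_scale mprod_add[OF a_commuting])
  finally have "coord (x \<otimes> y) = (\<lambda>i. if i < k then of_int (int m' * n i + int m * n' i) / of_nat (m * m') else 0)"
    using m m' x y A_subgroup by (intro coord_eqI) (auto intro: subgroup.m_closed)
  moreover have "coord x = (\<lambda>i. if i < k then of_int (n i) / of_nat m else 0)"
    using m x by (intro coord_eqI) auto
  moreover have "coord y = (\<lambda>i. if i < k then of_int (n' i) / of_nat m' else 0)"
    using m' y by (intro coord_eqI) auto
  ultimately show ?thesis using m m' by (simp add: field_simps)
qed

lemma coord_one: "coord \<one> i = 0"
  using coord_mult[of \<one> \<one> i] A_subgroup by (simp add: subgroup.one_closed)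

lemma coord_inv: "x \<in> A \<Longrightarrow> coord (inv x) i = - coord x i"
  using coord_mult[of x "inv x" i] A_subgroup
  by (simp add: subgroup.m_inv_closed A_carrier coord_one)

lemma tl_le_coord:
  assumes x: "x \<in> A"
  shows "tl x \<le> (\<Sum>i<k. \<bar>coord x i\<bar> * tl (a i))"
proof -
  obtain m n where m: "(m::nat) > 0" "x [^] m = mprod G a n k" using a_span[OF x] by blast
  have "real m * tl x \<le> (\<Sum>i<k. \<bar>of_int (n i)\<bar> * tl (a i))"
    using tl_mprod_le[OF a_commuting, of n] m tl_pow[of x m] x by (simp add: A_carrier)
  also have "\<dots> = real m * (\<Sum>i<k. \<bar>coord x i\<bar> * tl (a i))"
    unfolding sum_distrib_left using m by (intro sum.cong) (auto simp: coord_eqI[OF x m])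
  finally show ?thesis using m by simp
qed

lemma tl_ge_coord: "\<exists>c>0. \<forall>x\<in>A. \<forall>i. c * \<bar>coord x i\<bar> \<le> tl x"
proof -
  obtain c where c: "c > 0" "\<And>n i. i < k \<Longrightarrow> c * \<bar>of_int (n i)\<bar> \<le> tl (mprod G a n k)"
    using tl_mprod_ge[OF a_commuting a_indep] by blast
  have "c * \<bar>coord x i\<bar> \<le> tl x" if x: "x \<in> A" for x i
  proof (cases "i < k")
    case True
    obtain m n where m: "(m::nat) > 0" "x [^] m = mprod G a n k" using a_span[OF x] by blast
    have "c * \<bar>of_int (n i)\<bar> \<le> real m * tl x"
      using c(2)[OF True, of n] m tl_pow[of x m] x by (simp add: A_carrier)
    then show ?thesis using m True by (simp add: coord_eqI[OF x m] field_simps)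
  qed (use x in \<open>simp add: coord_outside tl_nonneg A_carrier\<close>)
  with c(1) show ?thesis by blast
qed

lemma coord_discrete: "\<exists>e>0. \<forall>x\<in>A. (\<forall>i<k. \<bar>coord x i\<bar> < e) \<longrightarrow> x = \<one>"
proof -
  \<comment> \<open>The additional 1 keeps the denominator positive when \<open>k = 0\<close> and
    makes the final bound strictly less than \<open>r\<close>.\<close>
  define T where "T = (\<Sum>i<k. tl (a i)) + 1"
  have T0: "T > 0" unfolding T_def using a_in A_carrier tl_nonneg
    by (intro add_nonneg_pos sum_nonneg) auto
  have "x = \<one>" if x: "x \<in> A" and small: "\<forall>i<k. \<bar>coord x i\<bar> < r / T" for x
  proof -
    have "tl x \<le> (\<Sum>i<k. \<bar>coord x i\<bar> * tl (a i))" by (rule tl_le_coord[OF x])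
    also have "\<dots> \<le> (\<Sum>i<k. r / T * tl (a i))"
      using small a_in A_carrier tl_nonneg by (intro sum_mono mult_right_mono) (auto intro: less_imp_le)
    also have "\<dots> = r / T * (T - 1)" by (simp add: T_def sum_distrib_left)
    also have "\<dots> < r" using T0 r_pos by (simp add: field_simps)
    finally show ?thesis using tl_eq_0 x A_carrier by blast
  qed
  moreover have "r / T > 0" using T0 r_pos by simp
  ultimately show ?thesis by blast
qed

text \<open>Bounded \<open>tl\<close> bounds all coordinates. Two elements in the same cell of mesh
  \<open>e\<close> differ by an element of \<open>A\<close> with coordinates below \<open>e\<close>,
  which is trivial; so an element is determined by its cell, one of finitely many.\<close>

lemma finite_tl_le: "finite {x \<in> A. tl x \<le> T}"
proof -
  obtain e where e: "e > 0" "\<forall>x\<in>A. (\<forall>i<k. \<bar>coord x i\<bar> < e) \<longrightarrow> x = \<one>" using coord_discrete by blast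
  obtain c where c: "c > 0" "\<And>x i. x \<in> A \<Longrightarrow> c * \<bar>coord x i\<bar> \<le> tl x" using tl_ge_coord by blast
  define F where "F = (\<lambda>x. restrict (\<lambda>i. \<lfloor>coord x i / e\<rfloor>) {..<k})"
  define Z where "Z = {\<lfloor>- (T / c / e)\<rfloor>..\<lfloor>T / c / e\<rfloor>}"
  have "F ` {x \<in> A. tl x \<le> T} \<subseteq> {..<k} \<rightarrow>\<^sub>E Z"
  proof (rule image_subsetI)
    fix x assume "x \<in> {x \<in> A. tl x \<le> T}"
    then have x: "x \<in> A" "tl x \<le> T" by auto
    have "\<bar>coord x i / e\<bar> \<le> T / c / e" for i
    proof -
      have "c * \<bar>coord x i\<bar> \<le> T" using c(2)[OF x(1), of i] x(2) by linarith
      then have "\<bar>coord x i\<bar> \<le> T / c" using c(1) by (simp add: field_simps)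
      then have "\<bar>coord x i\<bar> / e \<le> T / c / e" using e(1) by (intro divide_right_mono) auto
      then show ?thesis using e(1) by (simp add: abs_divide)
    qed
    then have "- (T / c / e) \<le> coord x i / e" "coord x i / e \<le> T / c / e" for i
      using abs_le_iff[of "coord x i / e" "T / c / e"] by (auto simp: minus_le_iff)
    then show "F x \<in> {..<k} \<rightarrow>\<^sub>E Z" by (auto simp: F_def Z_def intro!: floor_mono)
  qed
  moreover have "finite ({..<k} \<rightarrow>\<^sub>E Z)" by (intro finite_PiE) (auto simp: Z_def)
  moreover have "inj_on F {x \<in> A. tl x \<le> T}"
  proof (rule inj_onI)
    fix x y assume xy: "x \<in> {x \<in> A. tl x \<le> T}" "y \<in> {x \<in> A. tl x \<le> T}" "F x = F y"
    then have x: "x \<in> A" and y: "y \<in> A" by auto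
    have inA: "inv y \<in> A" "x \<otimes> inv y \<in> A" using x y A_subgroup
      by (auto intro: subgroup.m_inv_closed subgroup.m_closed)
    have "\<bar>coord (x \<otimes> inv y) i\<bar> < e" if "i < k" for i
    proof -
      have "\<lfloor>coord x i / e\<rfloor> = \<lfloor>coord y i / e\<rfloor>" using fun_cong[OF xy(3), of i] that by (simp add: F_def)
      then have "\<bar>coord x i / e - coord y i / e\<bar> < 1" by linarith
      then have "\<bar>coord x i - coord y i\<bar> / e < 1" using e(1) by (simp add: abs_divide flip: diff_divide_distrib)
      then show ?thesis using e(1) x y inA by (simp add: coord_mult coord_inv)
    qed
    then have "x \<otimes> inv y = \<one>" using e inA by blast
    then show "x = y" using x y A_carrier by (metis inv_closed inv_equality inv_inv)
  qed
  ultimately show ?thesis using finite_imageD finite_subset by blast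
qed

end

locale translation_length_finite_rank = translation_length +
  fixes K :: nat
  assumes finite_rank: "\<lbrakk>commuting_family G a k; independent_family G a k\<rbrakk> \<Longrightarrow> k < K"
begin

text \<open>An independent family of maximal length in \<open>A\<close> becomes dependent when
  \<open>b\<close> is appended, and the relation expresses a nonzero power of \<open>b\<close>
  through the family.\<close>

lemma exists_rational_basis:
  assumes sub: "subgroup A G" and comm: "\<And>x y. \<lbrakk>x \<in> A; y \<in> A\<rbrakk> \<Longrightarrow> x \<otimes> y = y \<otimes> x"
  obtains a k where "rational_basis G len tl r A a k"
proof -
  have carr: "x \<in> A \<Longrightarrow> x \<in> carrier G" for x using sub by (rule subgroup.mem_carrier)
  define Q where "Q = (\<lambda>k. \<exists>a. (\<forall>i<k. a i \<in> A) \<and> independent_family G a k)"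
  have "Q 0" by (auto simp: Q_def independent_family_def)
  moreover have "k \<le> K" if "Q k" for k
    using that finite_rank comm carr unfolding Q_def commuting_family_def by (meson less_imp_le)
  ultimately have "Q (Greatest Q)" and greatest: "\<And>k. Q k \<Longrightarrow> k \<le> Greatest Q"
    by (auto intro: GreatestI_nat Greatest_le_nat)
  then obtain k a where k: "k = Greatest Q" and a: "\<And>i. i < k \<Longrightarrow> a i \<in> A" "independent_family G a k"
    by (auto simp: Q_def)
  have "\<exists>m>0. \<exists>n. b [^] (m::nat) = mprod G a n k" if b: "b \<in> A" for b
  proof -
    define a' where "a' = a(k := b)"
    have a'A: "\<forall>i<Suc k. a' i \<in> A" using a b by (auto simp: a'_def less_Suc_eq)
    have "\<not> Q (Suc k)" using greatest[of "Suc k"] k by auto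
    then have "\<not> independent_family G a' (Suc k)" using a'A by (auto simp: Q_def)
    then obtain n i where n: "mprod G a' n (Suc k) = \<one>" "i < Suc k" "n i \<noteq> 0"
      by (auto simp: independent_family_def)
    have cf: "commuting_family G a k" using a comm carr by (auto simp: commuting_family_def)
    have "mprod G a' n k = mprod G a n k" by (rule mprod_cong) (auto simp: a'_def)
    then have eq: "mprod G a n k \<otimes> b [^] n k = \<one>" using n(1) by (simp add: a'_def)
    \<comment> \<open>A relation that omits \<open>b\<close> would contradict independence of the
      old family.\<close>
    have nk: "n k \<noteq> 0"
    proof
      assume 0: "n k = 0"
      then have "mprod G a n k = \<one>" using eq mprod_closed[OF cf] by simp
      then show False using a(2) n(2,3) 0 by (auto simp: independent_family_def less_Suc_eq)
    qed
    have 1: "b [^] (- n k) = mprod G a n k"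
      using eq b carr mprod_closed[OF cf] by (simp add: int_pow_neg inv_equality)
    then have 2: "b [^] (n k) = mprod G a (\<lambda>i. (-1) * n i) k"
      unfolding mprod_scale[OF cf] 1[symmetric] using b carr by (simp add: int_pow_pow)
    show ?thesis
    proof (cases "n k > 0")
      case True
      then show ?thesis using 2 by (metis int_pow_int pos_int_cases)
    next
      case False
      then have "- n k > 0" using nk by simp
      then show ?thesis using 1 by (metis int_pow_int pos_int_cases)
    qed
  qed
  then have "rational_basis G len tl r A a k"
    using sub comm a by (intro rational_basis.intro[OF translation_length_axioms] rational_basis_axioms.intro)
  then show thesis by (rule that)
qed

lemma maximal_abelian_normal_subgroup:
  obtains A where "A \<lhd> G" "\<And>x y. \<lbrakk>x \<in> A; y \<in> A\<rbrakk> \<Longrightarrow> x \<otimes> y = y \<otimes> x"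
    "\<And>B. \<lbrakk>B \<lhd> G; \<And>x y. \<lbrakk>x \<in> B; y \<in> B\<rbrakk> \<Longrightarrow> x \<otimes> y = y \<otimes> x; A \<subseteq> B\<rbrakk> \<Longrightarrow> B \<subseteq> A"
proof -
  define \<A> where "\<A> = {A. A \<lhd> G \<and> (\<forall>x\<in>A. \<forall>y\<in>A. x \<otimes> y = y \<otimes> x)}"
  have "\<exists>M\<in>\<A>. \<forall>X\<in>\<A>. M \<subseteq> X \<longrightarrow> X = M"
  proof (rule subset_Zorn_nonempty)
    have "{\<one>} \<in> \<A>" by (simp add: \<A>_def one_is_normal)
    then show "\<A> \<noteq> {}" by blast
  next
    fix \<C> assume ne: "\<C> \<noteq> {}" and ch: "subset.chain \<A> \<C>"
    have chA: "X \<in> \<A>" if "X \<in> \<C>" for X using ch that by (auto simp: subset.chain_def)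
    then have sub: "subgroup X G" if "X \<in> \<C>" for X using that by (auto simp: \<A>_def normal_imp_subgroup)
    have two: "\<exists>X\<in>\<C>. x \<in> X \<and> y \<in> X" if "x \<in> \<Union>\<C>" "y \<in> \<Union>\<C>" for x y
      using that ch unfolding subset_chain_def by (metis UnionE subsetD)
    have "subgroup (\<Union>\<C>) G"
    proof (rule subgroupI)
      show "\<Union>\<C> \<subseteq> carrier G" using sub subgroup.subset by blast
      show "\<Union>\<C> \<noteq> {}" using ne sub subgroup.one_closed by blast
      show "inv x \<in> \<Union>\<C>" if "x \<in> \<Union>\<C>" for x using that sub subgroup.m_inv_closed by fast
      show "x \<otimes> y \<in> \<Union>\<C>" if "x \<in> \<Union>\<C>" "y \<in> \<Union>\<C>" for x y
        using two[OF that] sub subgroup.m_closed by fast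
    qed
    moreover have "x \<otimes> h \<otimes> inv x \<in> \<Union>\<C>" if "x \<in> carrier G" "h \<in> \<Union>\<C>" for x h
      using that chA unfolding \<A>_def by (auto simp: normal_inv_iff)
    moreover have "x \<otimes> y = y \<otimes> x" if "x \<in> \<Union>\<C>" "y \<in> \<Union>\<C>" for x y
      using two[OF that] chA by (auto simp: \<A>_def)
    ultimately show "\<Union>\<C> \<in> \<A>" by (simp add: \<A>_def normal_inv_iff)
  qed
  then obtain M where M: "M \<in> \<A>" "\<And>X. X \<in> \<A> \<Longrightarrow> M \<subseteq> X \<Longrightarrow> X = M" by blast
  show ?thesis
  proof (rule that[of M])
    show "M \<lhd> G" using M(1) by (simp add: \<A>_def)
    show "x \<otimes> y = y \<otimes> x" if "x \<in> M" "y \<in> M" for x y using M(1) that by (simp add: \<A>_def)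
    show "B \<subseteq> M" if "B \<lhd> G" "\<And>x y. \<lbrakk>x \<in> B; y \<in> B\<rbrakk> \<Longrightarrow> x \<otimes> y = y \<otimes> x" "M \<subseteq> B" for B
      using M(2)[of B] that by (simp add: \<A>_def)
  qed
qed

text \<open>By solvability the derived series of the centralizer \<open>C\<close> of
  \<open>A\<close> becomes trivial. If \<open>C\<close> were not inside \<open>A\<close>, let
  \<open>E\<close> be the term preceding the first one contained in \<open>A\<close>: its
  commutators lie in \<open>A\<close>, hence commute with \<open>E\<close>, and so vanish. Then the
  product of \<open>A\<close> and \<open>E\<close> is abelian and normal, and maximality forces
  \<open>E\<close> into \<open>A\<close>.\<close>

lemma solvable_self_centralizing:
  assumes solv: "solvable G" and norm: "A \<lhd> G"
    and comm: "\<And>x y. \<lbrakk>x \<in> A; y \<in> A\<rbrakk> \<Longrightarrow> x \<otimes> y = y \<otimes> x"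
    and max: "\<And>B. \<lbrakk>B \<lhd> G; \<And>x y. \<lbrakk>x \<in> B; y \<in> B\<rbrakk> \<Longrightarrow> x \<otimes> y = y \<otimes> x; A \<subseteq> B\<rbrakk> \<Longrightarrow> B \<subseteq> A"
    and x: "x \<in> carrier G" "\<And>y. y \<in> A \<Longrightarrow> x \<otimes> y = y \<otimes> x"
  shows "x \<in> A"
proof -
  have sub: "subgroup A G" using norm by (rule normal_imp_subgroup)
  have carr: "x \<in> A \<Longrightarrow> x \<in> carrier G" for x using sub by (rule subgroup.mem_carrier)
  have conj: "g \<otimes> h \<otimes> inv g \<in> A" if "g \<in> carrier G" "h \<in> A" for g h
    using norm that by (simp add: normal_inv_iff)
  define C where "C = {x \<in> carrier G. \<forall>y\<in>A. y \<otimes> x = x \<otimes> y}"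
  have Csub: "subgroup C G"
  proof -
    have "C = carrier G \<inter> (\<Inter>y\<in>A. {x \<in> carrier G. y \<otimes> x = x \<otimes> y})" by (auto simp: C_def)
    also have "subgroup \<dots> G"
    proof -
      have "subgroup (\<Inter>((\<lambda>y. {x \<in> carrier G. y \<otimes> x = x \<otimes> y}) ` A)) G"
        using subgroup.one_closed[OF sub] carr by (intro subgroups_Inter) (auto intro: centralizer_subgroup)
      then show ?thesis by (intro subgroups_Inter_pair subgroup_self)
    qed
    finally show ?thesis .
  qed
  have Cnorm: "C \<lhd> G"
  proof -
    have "g \<otimes> h \<otimes> inv g \<in> C" if g: "g \<in> carrier G" and h: "h \<in> C" for g h
    proof -
      have hc: "h \<in> carrier G" using h by (simp add: C_def)
      have "y \<otimes> (g \<otimes> h \<otimes> inv g) = (g \<otimes> h \<otimes> inv g) \<otimes> y" if y: "y \<in> A" for y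
      proof -
        define y' where "y' = inv g \<otimes> y \<otimes> g"
        have y': "y' \<in> A" using conj[of "inv g" y] g y by (simp add: y'_def)
        have yc: "y \<in> carrier G" "y' \<in> carrier G" using y y' carr by auto
        have y_eq: "y = g \<otimes> y' \<otimes> inv g" using g yc(1) unfolding y'_def
          by (metis inv_closed inv_solve_left' inv_solve_right m_assoc m_closed)
        have "y \<otimes> (g \<otimes> h \<otimes> inv g) = g \<otimes> (y' \<otimes> h) \<otimes> inv g"
        proof -
          have "y \<otimes> (g \<otimes> h \<otimes> inv g) = g \<otimes> y' \<otimes> (inv g \<otimes> g) \<otimes> h \<otimes> inv g"
            unfolding y_eq using g hc yc(2) by (simp only: m_assoc m_closed inv_closed)
          then show ?thesis using g hc yc(2) by (simp add: m_assoc)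
        qed
        also have "y' \<otimes> h = h \<otimes> y'" using h y' by (simp add: C_def)
        also have "g \<otimes> (h \<otimes> y') \<otimes> inv g = (g \<otimes> h \<otimes> inv g) \<otimes> y"
        proof -
          have "(g \<otimes> h \<otimes> inv g) \<otimes> y = g \<otimes> h \<otimes> (inv g \<otimes> g) \<otimes> y' \<otimes> inv g"
            unfolding y_eq using g hc yc(2) by (simp only: m_assoc m_closed inv_closed)
          then show ?thesis using g hc yc(2) by (simp add: m_assoc)
        qed
        finally show ?thesis .
      qed
      then show ?thesis using g hc by (simp add: C_def)
    qed
    then show ?thesis using Csub by (simp add: normal_inv_iff)
  qed
  define D where "D = (\<lambda>n. (derived G ^^ n) C)"
  have Dnorm: "D n \<lhd> G" for n by (induction n) (auto simp: D_def Cnorm derived_is_normal)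
  have DC: "D n \<subseteq> C" for n
    by (induction n) (auto simp: D_def intro: derived_incl[OF _ Csub, THEN subsetD])
  obtain N where "(derived G ^^ N) (carrier G) = {\<one>}" using solv solvable_iff_trivial_derived_seq by blast
  then have "D N \<subseteq> A"
    using mono_exp_of_derived[OF subgroup.subset[OF Csub], of N] subgroup.one_closed[OF sub] by (auto simp: D_def)
  define m where "m = (LEAST m. D m \<subseteq> A)"
  have Dm: "D m \<subseteq> A" unfolding m_def by (rule LeastI) fact
  have "m = 0"
  proof (rule ccontr)
    assume "m \<noteq> 0"
    then obtain j where j: "m = Suc j" using not0_implies_Suc by blast
    define E where "E = D j"
    have notE: "\<not> E \<subseteq> A" unfolding E_def using j m_def not_less_Least[of j "\<lambda>m. D m \<subseteq> A"] by simp
    have En: "E \<lhd> G" and EC: "E \<subseteq> C" using Dnorm DC by (auto simp: E_def)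
    have Es: "subgroup E G" using En by (rule normal_imp_subgroup)
    have Ec: "x \<in> E \<Longrightarrow> x \<in> carrier G" for x using Es by (rule subgroup.mem_carrier)
    have dE: "derived G E \<subseteq> A" using Dm by (simp add: j D_def E_def)
    have Ecomm: "x \<otimes> y = y \<otimes> x" if x: "x \<in> E" and y: "y \<in> E" for x y
    proof -
      define c where "c = x \<otimes> y \<otimes> inv x \<otimes> inv y"
      have "c \<in> derived_set G E" using x y by (auto simp: c_def)
      then have cA: "c \<in> A" using dE unfolding derived_def by (meson generate.incl subsetD)
      have xc: "x \<in> carrier G" and yc: "y \<in> carrier G" using x y Ec by auto
      have xy: "x \<otimes> y = c \<otimes> (y \<otimes> x)"
      proof -
        have "c \<otimes> (y \<otimes> x) = x \<otimes> y \<otimes> inv x \<otimes> (inv y \<otimes> y) \<otimes> x"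
          unfolding c_def using xc yc by (simp only: m_assoc m_closed inv_closed)
        then show ?thesis using xc yc by (simp add: m_assoc)
      qed
      \<comment> \<open>\<open>E\<close> centralizes \<open>A\<close>, so a commutator that lies in
        \<open>A\<close> is central in \<open>E\<close>; this is where the growth argument
        enters.\<close>
      have "c \<otimes> x = x \<otimes> c" "c \<otimes> y = y \<otimes> c" using x y EC cA by (auto simp: C_def)
      then have "c = \<one>" using central_commutator_trivial xc yc cA carr xy by blast
      then show ?thesis using xy xc yc by simp
    qed
    define B where "B = {u \<otimes> e | u e. u \<in> A \<and> e \<in> E}"
    have ue: "u \<otimes> e = e \<otimes> u" if "u \<in> A" "e \<in> E" for u e using that EC by (auto simp: C_def)
    have swap: "(u \<otimes> e) \<otimes> (u' \<otimes> e') = (u \<otimes> u') \<otimes> (e \<otimes> e')"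
      if "u \<in> A" "u' \<in> A" "e \<in> E" "e' \<in> E" for u u' e e'
    proof -
      have c: "u \<in> carrier G" "u' \<in> carrier G" "e \<in> carrier G" "e' \<in> carrier G" using that carr Ec by auto
      have "(u \<otimes> e) \<otimes> (u' \<otimes> e') = u \<otimes> (e \<otimes> u') \<otimes> e'" using c by (simp only: m_assoc m_closed)
      also have "e \<otimes> u' = u' \<otimes> e" using ue that by simp
      also have "u \<otimes> (u' \<otimes> e) \<otimes> e' = (u \<otimes> u') \<otimes> (e \<otimes> e')" using c by (simp only: m_assoc m_closed)
      finally show ?thesis .
    qed
    have Bsub: "subgroup B G"
    proof (rule subgroupI)
      show "B \<subseteq> carrier G" using carr Ec by (auto simp: B_def)
      show "B \<noteq> {}" using subgroup.one_closed[OF sub] subgroup.one_closed[OF Es] by (auto simp: B_def)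
      show "inv b \<in> B" if "b \<in> B" for b
      proof -
        obtain u e where b: "b = u \<otimes> e" "u \<in> A" "e \<in> E" using \<open>b \<in> B\<close> by (auto simp: B_def)
        then have "inv b = inv e \<otimes> inv u" using carr Ec by (simp add: inv_mult_group)
        also have "\<dots> = inv u \<otimes> inv e"
          using ue[of "inv u" "inv e"] b sub Es by (simp add: subgroup.m_inv_closed)
        finally show ?thesis using b sub Es unfolding B_def by (blast intro: subgroup.m_inv_closed)
      qed
      show "b \<otimes> b' \<in> B" if bb: "b \<in> B" "b' \<in> B" for b b'
      proof -
        obtain u e u' e' where b: "b = u \<otimes> e" "u \<in> A" "e \<in> E" "b' = u' \<otimes> e'" "u' \<in> A" "e' \<in> E"
          using bb unfolding B_def by blast
        have "b \<otimes> b' = (u \<otimes> u') \<otimes> (e \<otimes> e')" using b swap by simp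
        then show ?thesis using b sub Es unfolding B_def by (blast intro: subgroup.m_closed)
      qed
    qed
    have Bn: "B \<lhd> G"
    proof -
      have "g \<otimes> b \<otimes> inv g \<in> B" if g: "g \<in> carrier G" and "b \<in> B" for g b
      proof -
        obtain u e where b: "b = u \<otimes> e" "u \<in> A" "e \<in> E" using \<open>b \<in> B\<close> by (auto simp: B_def)
        have c: "u \<in> carrier G" "e \<in> carrier G" using b carr Ec by auto
        have "(g \<otimes> u \<otimes> inv g) \<otimes> (g \<otimes> e \<otimes> inv g) = g \<otimes> u \<otimes> (inv g \<otimes> g) \<otimes> e \<otimes> inv g"
          using c g by (simp only: m_assoc m_closed inv_closed)
        also have "\<dots> = g \<otimes> b \<otimes> inv g" using c g by (simp add: b m_assoc)
        finally have "g \<otimes> b \<otimes> inv g = (g \<otimes> u \<otimes> inv g) \<otimes> (g \<otimes> e \<otimes> inv g)" by simp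
        moreover have "g \<otimes> e \<otimes> inv g \<in> E" using En g b by (simp add: normal_inv_iff)
        ultimately show ?thesis using conj[OF g b(2)] unfolding B_def by blast
      qed
      then show ?thesis using Bsub by (simp add: normal_inv_iff)
    qed
    have Bc: "b \<otimes> b' = b' \<otimes> b" if bb: "b \<in> B" "b' \<in> B" for b b'
    proof -
      obtain u e u' e' where b: "b = u \<otimes> e" "u \<in> A" "e \<in> E" "b' = u' \<otimes> e'" "u' \<in> A" "e' \<in> E"
        using bb unfolding B_def by blast
      have "b \<otimes> b' = (u \<otimes> u') \<otimes> (e \<otimes> e')" using b swap by simp
      also have "\<dots> = (u' \<otimes> u) \<otimes> (e' \<otimes> e)" using b comm[of u u'] Ecomm[of e e'] by simp
      also have "\<dots> = b' \<otimes> b" unfolding b(1,4) using b by (intro swap[symmetric])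
      finally show ?thesis .
    qed
    have "A \<subseteq> B"
    proof
      fix u assume "u \<in> A"
      moreover have "u = u \<otimes> \<one>" using \<open>u \<in> A\<close> carr by simp
      ultimately show "u \<in> B" unfolding B_def using subgroup.one_closed[OF Es] by blast
    qed
    then have "B \<subseteq> A" using max[OF Bn Bc] by blast
    moreover have "E \<subseteq> B"
    proof
      fix e assume "e \<in> E"
      moreover have "e = \<one> \<otimes> e" using \<open>e \<in> E\<close> Ec by simp
      ultimately show "e \<in> B" unfolding B_def using subgroup.one_closed[OF sub] by blast
    qed
    ultimately show False using notE by blast
  qed
  then have "C \<subseteq> A" using Dm by (simp add: D_def)
  then show ?thesis using x by (auto simp: C_def)
qed

text \<open>Conjugation preserves \<open>tl\<close>, so it sends each \<open>a i\<close> into a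
  finite subset of \<open>A\<close>, which leaves finitely many images of the basis. Two elements
  with the same images differ by an element that centralizes the basis, hence all of
  \<open>A\<close>, and that therefore lies in \<open>A\<close>.\<close>

lemma solvable_virtually_abelian:
  assumes "solvable G"
  obtains A a k where "A \<lhd> G" "rational_basis G len tl r A a k"
    "finite ((\<lambda>g. g <# A) ` carrier G)"
proof -
  obtain A where norm: "A \<lhd> G" and comm: "\<And>x y. \<lbrakk>x \<in> A; y \<in> A\<rbrakk> \<Longrightarrow> x \<otimes> y = y \<otimes> x"
    and max: "\<And>B. \<lbrakk>B \<lhd> G; \<And>x y. \<lbrakk>x \<in> B; y \<in> B\<rbrakk> \<Longrightarrow> x \<otimes> y = y \<otimes> x; A \<subseteq> B\<rbrakk> \<Longrightarrow> B \<subseteq> A"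
    using maximal_abelian_normal_subgroup by blast
  have sub: "subgroup A G" using norm by (rule normal_imp_subgroup)
  obtain a k where rb: "rational_basis G len tl r A a k"
    using exists_rational_basis[OF sub comm] by blast
  interpret rb: rational_basis G len tl r A a k by (rule rb)
  define F where "F = (\<lambda>g. restrict (\<lambda>i. g \<otimes> a i \<otimes> inv g) {..<k})"
  have conj: "g \<otimes> h \<otimes> inv g \<in> A" if "g \<in> carrier G" "h \<in> A" for g h
    using norm that by (simp add: normal_inv_iff)
  have "F ` carrier G \<subseteq> (\<Pi>\<^sub>E i\<in>{..<k}. {x \<in> A. tl x \<le> tl (a i)})"
    unfolding F_def image_subset_iff restrict_PiE_iff using conj rb.a_in rb.A_carrier tl_conj by simp
  moreover have "finite (\<Pi>\<^sub>E i\<in>{..<k}. {x \<in> A. tl x \<le> tl (a i)})"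
    by (intro finite_PiE rb.finite_tl_le) auto
  ultimately have finF: "finite (F ` carrier G)" by (rule finite_subset)
  have same: "g <# A = h <# A" if g: "g \<in> carrier G" and h: "h \<in> carrier G" and F: "F g = F h" for g h
  proof -
    define u where "u = inv h \<otimes> g"
    have u: "u \<in> carrier G" using g h by (simp add: u_def)
    have ua: "u \<otimes> a i = a i \<otimes> u" if i: "i < k" for i
    proof -
      have ai: "a i \<in> carrier G" using rb.a_in[OF i] rb.A_carrier by blast
      have eq: "g \<otimes> a i \<otimes> inv g = h \<otimes> a i \<otimes> inv h" using fun_cong[OF F, of i] i by (simp add: F_def)
      have "u \<otimes> a i = inv h \<otimes> (g \<otimes> a i \<otimes> inv g) \<otimes> g"
      proof -
        have "inv h \<otimes> (g \<otimes> a i \<otimes> inv g) \<otimes> g = inv h \<otimes> g \<otimes> a i \<otimes> (inv g \<otimes> g)"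
          using g h ai by (simp only: m_assoc m_closed inv_closed)
        then show ?thesis using g h ai by (simp add: u_def)
      qed
      also have "\<dots> = (inv h \<otimes> h) \<otimes> a i \<otimes> inv h \<otimes> g"
        unfolding eq using g h ai by (simp only: m_assoc m_closed inv_closed)
      also have "\<dots> = a i \<otimes> u" using g h ai by (simp add: u_def m_assoc)
      finally show ?thesis .
    qed
    have "u \<otimes> y = y \<otimes> u" if y: "y \<in> A" for y
    proof -
      obtain m n where m: "(m::nat) > 0" "y [^] m = mprod G a n k" using rb.a_span[OF y] by blast
      have yc: "y \<in> carrier G" using y rb.A_carrier by blast
      have "u \<otimes> mprod G a n k = mprod G a n k \<otimes> u"
        using ua rb.a_in rb.A_carrier u by (intro mprod_commute) auto
      then have "u \<otimes> y [^] m = y [^] m \<otimes> u" by (simp only: m(2))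
      then have "u \<otimes> y [^] m \<otimes> inv u = y [^] m" using u yc by (simp add: m_assoc)
      \<comment> \<open>Some power of \<open>y\<close> lies in the span of the basis, so
        \<open>y\<close> and its conjugate have a common power; they commute with each other, and
        roots are unique among commuting elements.\<close>
      then have "(u \<otimes> y \<otimes> inv u) [^] m = y [^] m" using nat_pow_conj[OF yc u] by simp
      moreover have "(u \<otimes> y \<otimes> inv u) \<otimes> y = y \<otimes> (u \<otimes> y \<otimes> inv u)" using comm conj u y by blast
      ultimately have "u \<otimes> y \<otimes> inv u = y" using nat_pow_cancel[of "u \<otimes> y \<otimes> inv u" y m] u yc m by simp
      then show ?thesis using u yc by (metis inv_solve_right' m_closed)
    qed
    then have "u \<in> A" using solvable_self_centralizing[OF assms norm comm max u] by blast
    moreover have "g = h \<otimes> u" using g h by (simp add: u_def flip: m_assoc)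
    ultimately have "g \<in> h <# A" by (auto simp: l_coset_def)
    then show ?thesis using l_repr_independence h sub by blast
  qed
  have "(\<lambda>g. g <# A) ` carrier G \<subseteq> (\<lambda>v. inv_into (carrier G) F v <# A) ` (F ` carrier G)"
  proof safe
    fix g assume g: "g \<in> carrier G"
    have "g <# A = inv_into (carrier G) F (F g) <# A"
      using g by (intro same) (auto simp: inv_into_into f_inv_into_f)
    then show "g <# A \<in> (\<lambda>v. inv_into (carrier G) F v <# A) ` F ` carrier G" using g by blast
  qed
  then have "finite ((\<lambda>g. g <# A) ` carrier G)" using finF finite_surj by blast
  then show thesis using that norm rb by blast
qed

end

section \<open>Lifting in metric spaces\<close>

text \<open>The lifting theorems of the library are stated for subsets of normed spaces; the Kuratowski
  embedding makes them available in arbitrary metric spaces.\<close>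

definition kur :: "'a::metric_space \<Rightarrow> ('a \<Rightarrow>\<^sub>C real)" where
  "kur x = Bcontfun (\<lambda>z. dist x z - dist undefined z)"

text \<open>Subtracting the distance to a fixed point makes the function bounded, by
  \<open>dist x undefined\<close>, even when the space is unbounded.\<close>

lemma apply_kur: "apply_bcontfun (kur x) z = dist x z - dist undefined z"
proof -
  have "(\<lambda>z. dist x z - dist undefined z) \<in> bcontfun"
  proof (rule bcontfun_normI)
    show "continuous_on UNIV (\<lambda>z. dist x z - dist undefined z)" by (intro continuous_intros)
    show "norm (dist x z - dist undefined z) \<le> dist x undefined" for z
      using dist_triangle[of x z undefined] dist_triangle[of undefined z x] by (simp add: dist_commute abs_le_iff)
  qed
  then show ?thesis by (simp add: kur_def Bcontfun_inverse)
qed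

text \<open>The supremum of the differences is attained at \<open>z = y\<close>.\<close>

lemma dist_kur [simp]: "dist (kur x) (kur y) = dist x y"
proof (rule antisym)
  show "dist (kur x) (kur y) \<le> dist x y"
  proof (rule dist_bound)
    show "dist (apply_bcontfun (kur x) z) (apply_bcontfun (kur y) z) \<le> dist x y" for z
      using dist_triangle[of x z y] dist_triangle[of y z x] by (simp add: apply_kur dist_real_def dist_commute abs_le_iff)
  qed
  show "dist x y \<le> dist (kur x) (kur y)"
    using dist_bounded[of "kur x" y "kur y"] by (simp add: apply_kur dist_real_def)
qed

lemma inj_kur: "inj kur"
  by (metis dist_eq_0_iff dist_kur injI)

lemma kur_eq_iff [simp]: "kur x = kur y \<longleftrightarrow> x = y"
  by (metis dist_eq_0_iff dist_kur)

definition unkur :: "('a::metric_space \<Rightarrow>\<^sub>C real) \<Rightarrow> 'a" where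
  "unkur = inv_into UNIV kur"

lemma unkur_kur [simp]: "unkur (kur x) = x"
  by (simp add: inj_kur unkur_def)

lemma continuous_on_kur: "continuous_on S kur"
  by (auto simp: continuous_on_iff)

lemma continuous_on_unkur: "continuous_on (range kur) (unkur)"
proof -
  have "dist (unkur y) (unkur x) = dist y x" if "x \<in> range kur" "y \<in> range kur" for x y :: "'a \<Rightarrow>\<^sub>C real"
    using that by auto
  then show ?thesis unfolding continuous_on_iff by (metis)
qed

lemma homeomorphism_kur: "homeomorphism UNIV (range kur) kur (unkur)"
  by (auto simp: homeomorphism_def continuous_on_kur continuous_on_unkur image_image)

lemma openin_image_kur:
  fixes U :: "'a::metric_space set"
  assumes "open U"
  shows "openin (top_of_set (range kur)) (kur ` U)"
proof -
  have "kur ` U = range kur \<inter> unkur -` U" by (force simp: image_iff)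
  then show ?thesis using continuous_openin_preimage_gen[OF continuous_on_unkur assms] by simp
qed

text \<open>The range of \<open>kur\<close> is an isometric copy of the space, so evenly covered
  neighbourhoods and their sheets are carried over as images under \<open>kur\<close>.\<close>

lemma covering_space_kur:
  fixes p :: "'b::metric_space \<Rightarrow> 'a::metric_space"
  assumes cov: "covering_space UNIV p UNIV"
  shows "covering_space (range kur) (kur \<circ> p \<circ> unkur) (range kur)"
proof
  have cp: "continuous_on UNIV p" and sp: "range p = UNIV"
    using cov covering_space_imp_continuous covering_space_imp_surjective by blast+
  show "continuous_on (range kur) (kur \<circ> p \<circ> unkur)"
    by (intro continuous_on_compose continuous_on_unkur continuous_on_kur continuous_on_subset[OF cp]) auto
  show "(kur \<circ> p \<circ> unkur) ` range kur = range kur"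
    using sp by (force simp: image_image)
  fix y :: "'a \<Rightarrow>\<^sub>C real" assume "y \<in> range kur"
  then obtain x where y: "y = kur x" by blast
  obtain T \<V> where T: "x \<in> T" "open T" and V: "\<Union>\<V> = p -` T" "\<And>u. u \<in> \<V> \<Longrightarrow> open u" "pairwise disjnt \<V>"
      "\<And>u. u \<in> \<V> \<Longrightarrow> \<exists>q. homeomorphism u T p q"
    using cov unfolding covering_space_def by (simp) metis
  show "\<exists>T. y \<in> T \<and> openin (top_of_set (range kur)) T \<and>
        (\<exists>v. \<Union>v = range kur \<inter> (kur \<circ> p \<circ> unkur) -` T \<and>
        (\<forall>u\<in>v. openin (top_of_set (range kur)) u) \<and> pairwise disjnt v \<and>
        (\<forall>u\<in>v. \<exists>q. homeomorphism u T (kur \<circ> p \<circ> unkur) q))"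
  proof (intro exI[of _ "kur ` T"] exI[of _ "(`) kur ` \<V>"] conjI ballI)
    show "y \<in> kur ` T" using T y by blast
    show "openin (top_of_set (range kur)) (kur ` T)" by (rule openin_image_kur[OF T(2)])
    show "\<Union>((`) kur ` \<V>) = range kur \<inter> (kur \<circ> p \<circ> unkur) -` kur ` T"
    proof -
      have "\<Union>((`) kur ` \<V>) = kur ` (p -` T)" unfolding V(1)[symmetric] by blast
      also have "\<dots> = range kur \<inter> (kur \<circ> p \<circ> unkur) -` kur ` T"
        by auto
      finally show ?thesis .
    qed
    show "openin (top_of_set (range kur)) u" if "u \<in> (`) kur ` \<V>" for u using that V(2) openin_image_kur by auto
    show "pairwise disjnt ((`) kur ` \<V>)"
    proof (rule pairwiseI)
      fix u v assume uv: "u \<in> (`) kur ` \<V>" "v \<in> (`) kur ` \<V>" "u \<noteq> v"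
      then obtain u' v' where u': "u = kur ` u'" "u' \<in> \<V>" "v = kur ` v'" "v' \<in> \<V>" by blast
      then have "disjnt u' v'" using V(3) uv(3) by (auto simp: pairwise_def)
      then show "disjnt u v" using u' by (auto simp: disjnt_def)
    qed
    fix u assume "u \<in> (`) kur ` \<V>"
    then obtain u' q where u': "u = kur ` u'" "homeomorphism u' T p q" using V(4) by blast
    have h1: "homeomorphism (kur ` u') u' (unkur) kur"
      unfolding homeomorphism_def
      by (auto simp: image_image continuous_on_kur intro: continuous_on_subset[OF continuous_on_unkur])
    have h2: "homeomorphism T (kur ` T) kur (unkur)"
      unfolding homeomorphism_def
      by (auto simp: image_image continuous_on_kur intro: continuous_on_subset[OF continuous_on_unkur])
    have "homeomorphism (kur ` u') (kur ` T) (kur \<circ> (p \<circ> unkur)) ((kur \<circ> q) \<circ> unkur)"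
      by (rule homeomorphism_compose[OF homeomorphism_compose[OF h1 u'(2)] h2])
    then show "\<exists>q. homeomorphism u (kur ` T) (kur \<circ> p \<circ> unkur) q" using u'(1) by (auto simp: o_assoc)
  qed
qed

lemma path_kur: "path g \<Longrightarrow> path (kur \<circ> g)"
  by (simp add: path_continuous_image continuous_on_kur)

lemma path_unkur: "path g \<Longrightarrow> path_image g \<subseteq> range kur \<Longrightarrow> path (unkur \<circ> g)"
  by (rule path_continuous_image) (auto intro: continuous_on_subset[OF continuous_on_unkur])

lemma simply_connected_range_kur:
  assumes sc: "simply_connected (UNIV :: 'a::metric_space set)"
  shows "simply_connected (range (kur :: 'a \<Rightarrow> _))"
  unfolding simply_connected_def
proof (intro allI impI, elim conjE)
  fix g h :: "real \<Rightarrow> 'a \<Rightarrow>\<^sub>C real"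
  assume g: "path g" "pathfinish g = pathstart g" "path_image g \<subseteq> range kur"
    and h: "path h" "pathfinish h = pathstart h" "path_image h \<subseteq> range kur"
  have loop: "homotopic_loops (range kur) f (kur \<circ> (unkur \<circ> f))"
    if f: "path f" "pathfinish f = pathstart f" "path_image f \<subseteq> range kur" for f :: "real \<Rightarrow> 'a \<Rightarrow>\<^sub>C real"
  proof (rule homotopic_loops_eq)
    fix t :: real assume "t \<in> {0..1}"
    then have "f t \<in> range kur" using f(3) by (auto simp: path_image_def)
    then show "f t = (kur \<circ> (unkur \<circ> f)) t" by auto
  qed (use f in auto)
  have "homotopic_loops UNIV (unkur \<circ> g) (unkur \<circ> h)"
    using sc g h by (simp add: simply_connected_def path_unkur pathfinish_compose pathstart_compose)
  then have "homotopic_loops (range kur) (kur \<circ> (unkur \<circ> g)) (kur \<circ> (unkur \<circ> h))"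
    by (rule homotopic_loops_continuous_image) (auto simp: continuous_on_kur)
  then show "homotopic_loops (range kur) g h"
    using loop[OF g] loop[OF h] homotopic_loops_trans homotopic_loops_sym by blast
qed

lemma simply_connected_homotopic_paths:
  fixes g h :: "real \<Rightarrow> 'a::metric_space"
  assumes sc: "simply_connected (UNIV :: 'a set)" and g: "path g" and h: "path h"
    and ends: "pathstart g = pathstart h" "pathfinish g = pathfinish h"
  shows "homotopic_paths UNIV g h"
proof -
  have "homotopic_paths (range kur) (kur \<circ> g) (kur \<circ> h)"
    using simply_connected_range_kur[OF sc, unfolded simply_connected_eq_homotopic_paths] g h ends
      path_kur[OF g] path_kur[OF h]
    by (simp add: pathfinish_compose pathstart_compose path_image_compose image_mono)
  then have "homotopic_paths UNIV (unkur \<circ> (kur \<circ> g)) (unkur \<circ> (kur \<circ> h))"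
    by (rule homotopic_paths_continuous_image) (auto simp: continuous_on_unkur)
  then show ?thesis by (simp add: o_def)
qed

lemma metric_covering_lift_path:
  fixes p :: "'b::metric_space \<Rightarrow> 'a::metric_space"
  assumes cov: "covering_space UNIV p UNIV" and g: "path g" "pathstart g = p a"
  obtains h where "path h" "pathstart h = a" "\<And>t. t \<in> {0..1} \<Longrightarrow> p (h t) = g t"
proof -
  obtain h where h: "path h" "path_image h \<subseteq> range kur" "pathstart h = kur a"
      "\<And>t. t \<in> {0..1} \<Longrightarrow> (kur \<circ> p \<circ> unkur) (h t) = (kur \<circ> g) t"
  proof (rule covering_space_lift_path_strong[OF covering_space_kur[OF cov], of "kur a" "kur \<circ> g"])
    show "path (kur \<circ> g)" using g(1) by (rule path_kur)
    show "path_image (kur \<circ> g) \<subseteq> range kur" by (auto simp: path_image_compose)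
    show "pathstart (kur \<circ> g) = (kur \<circ> p \<circ> unkur) (kur a)" using g(2) by (simp add: pathstart_compose)
  qed auto
  show thesis
  proof
    show "path (unkur \<circ> h)" using h by (intro path_unkur)
    show "pathstart (unkur \<circ> h) = a" using h by (simp add: pathstart_compose)
    show "p ((unkur \<circ> h) t) = g t" if "t \<in> {0..1}" for t
      using h(4)[OF that] by simp
  qed
qed

lemma metric_covering_monodromy:
  fixes p :: "'b::metric_space \<Rightarrow> 'a::metric_space"
  assumes cov: "covering_space UNIV p UNIV" and hom: "homotopic_paths UNIV g1 g2"
    and h1: "path h1" "\<And>t. t \<in> {0..1} \<Longrightarrow> p (h1 t) = g1 t"
    and h2: "path h2" "\<And>t. t \<in> {0..1} \<Longrightarrow> p (h2 t) = g2 t"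
    and eq: "pathstart h1 = pathstart h2"
  shows "pathfinish h1 = pathfinish h2"
proof -
  have "pathfinish (kur \<circ> h1) = pathfinish (kur \<circ> h2)"
  proof (rule covering_space_monodromy[OF covering_space_kur[OF cov], of "kur \<circ> g1" "kur \<circ> g2"])
    show "homotopic_paths (range kur) (kur \<circ> g1) (kur \<circ> g2)"
      using hom by (rule homotopic_paths_continuous_image) (auto simp: continuous_on_kur)
  qed (use homotopic_paths_imp_path[OF hom] h1 h2 eq in
      \<open>auto simp: path_kur path_image_compose pathstart_compose\<close>)
  then show ?thesis by (simp add: pathfinish_compose)
qed

lemma metric_covering_lift_unique:
  fixes p :: "'b::metric_space \<Rightarrow> 'a::metric_space" and g1 g2 :: "'c::topological_space \<Rightarrow> 'b"
  assumes cov: "covering_space UNIV p UNIV"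
    and g: "continuous_on T g1" "continuous_on T g2" "\<And>x. x \<in> T \<Longrightarrow> p (g1 x) = p (g2 x)"
    and T: "connected T" "a \<in> T" "x \<in> T" and eq: "g1 a = g2 a"
  shows "g1 x = g2 x"
proof -
  have cp: "continuous_on UNIV p" using cov covering_space_imp_continuous by blast
  have "(kur \<circ> g1) x = (kur \<circ> g2) x"
  proof (rule covering_space_lift_unique[OF covering_space_kur[OF cov], where T = T and a = a and f = "kur \<circ> (p \<circ> g1)"])
    show "continuous_on T (kur \<circ> (p \<circ> g1))"
      by (intro continuous_on_compose g continuous_on_kur continuous_on_subset[OF cp]) auto
    show "continuous_on T (kur \<circ> g1)" "continuous_on T (kur \<circ> g2)"
      by (intro continuous_on_compose g continuous_on_kur)+
  qed (use g T eq in auto)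
  then show ?thesis by simp
qed

lemma metric_covering_lift:
  fixes p :: "'b::metric_space \<Rightarrow> 'a::metric_space" and f :: "'c::metric_space \<Rightarrow> 'a"
  assumes cov: "covering_space UNIV p UNIV"
    and sc: "simply_connected (UNIV :: 'c set)" and lpc: "locally path_connected (UNIV :: 'c set)"
    and f: "continuous_on UNIV f" "f z = p a"
  obtains g where "continuous_on UNIV g" "g z = a" "\<And>y. p (g y) = f y"
proof -
  have lpc': "locally path_connected (range (kur :: 'c \<Rightarrow> _))"
  proof (rule homeomorphism_locally_imp[OF lpc homeomorphism_kur])
    show "path_connected V" if "path_connected U" "homeomorphism U V kur unkur" for U :: "'c set" and V
      using that path_connected_continuous_image[of U kur] by (auto simp: homeomorphism_def)
  qed
  obtain g where g: "continuous_on (range kur) g" "g \<in> range kur \<rightarrow> range kur" "g (kur z) = kur a"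
      "\<And>y. y \<in> range (kur :: 'c \<Rightarrow> _) \<Longrightarrow> (kur \<circ> p \<circ> unkur) (g y) = (kur \<circ> f \<circ> unkur) y"
  proof (rule covering_space_lift_strong[OF covering_space_kur[OF cov] _ _ simply_connected_range_kur[OF sc] lpc',
        of "kur a" "kur z" "kur \<circ> f \<circ> unkur"])
    show "continuous_on (range kur) (kur \<circ> f \<circ> unkur)"
      by (intro continuous_on_compose continuous_on_unkur continuous_on_kur continuous_on_subset[OF f(1)]) auto
  qed (use f in auto)
  show thesis
  proof
    show "continuous_on UNIV (unkur \<circ> (g \<circ> kur))"
      by (intro continuous_on_compose continuous_on_kur g(1) continuous_on_subset[OF continuous_on_unkur])
         (use g(2) in auto)
    show "(unkur \<circ> (g \<circ> kur)) z = a" using g(3) by simp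
    show "p ((unkur \<circ> (g \<circ> kur)) y) = f y" for y
      using g(4)[of "kur y"] by simp
  qed
qed

section \<open>Geodesics in the covering space\<close>

text \<open>Recursive form of the polygonal sum in \<open>curve_length\<close>; concatenation and
  reparametrization of partitions become inductions on lists.\<close>

fun plen :: "(real \<Rightarrow> 'a::metric_space) \<Rightarrow> real list \<Rightarrow> real" where
  "plen g [] = 0"
| "plen g [x] = 0"
| "plen g (x # y # ts) = dist (g x) (g y) + plen g (y # ts)"

lemma plen_eq_sum: "plen g ts = (\<Sum>i < length ts - 1. dist (g (ts ! i)) (g (ts ! Suc i)))"
  by (induction g ts rule: plen.induct) (simp_all add: sum.lessThan_Suc_shift del: sum.lessThan_Suc)

lemma curve_length_plen: "curve_length g = (SUP ts \<in> partitions01. ereal (plen g ts))"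
  by (simp add: curve_length_def plen_eq_sum)

lemma plen_append: "plen g xs + plen g ys \<le> plen g (xs @ ys)"
proof (induction g xs rule: plen.induct)
  case (2 g x)
  show ?case by (cases ys) auto
qed auto

lemma plen_map: "plen g (map h ts) = plen (g \<circ> h) ts"
  by (induction "g \<circ> h" ts rule: plen.induct) auto

lemma partitions01_bounds: "ts \<in> partitions01 \<Longrightarrow> t \<in> set ts \<Longrightarrow> 0 \<le> t \<and> t \<le> 1"
proof -
  assume ts: "ts \<in> partitions01" and t: "t \<in> set ts"
  then have *: "ts \<noteq> []" "sorted ts" "hd ts = 0" "last ts = 1" by (auto simp: partitions01_def)
  obtain x xs where x: "ts = x # xs" using *(1) by (cases ts) auto
  obtain ys y where y: "ts = ys @ [y]" using *(1) by (cases ts rule: rev_cases) auto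
  have "0 \<le> t" using x * t by auto
  moreover have "t \<le> 1" using y * t by (auto simp: sorted_append)
  ultimately show ?thesis by simp
qed

lemma plen_cong: "(\<And>t. t \<in> set ts \<Longrightarrow> g t = h t) \<Longrightarrow> plen g ts = plen h ts"
  by (induction g ts rule: plen.induct) auto

lemma curve_length_cong: "(\<And>t. t \<in> {0..1} \<Longrightarrow> g t = h t) \<Longrightarrow> curve_length g = curve_length h"
  unfolding curve_length_plen by (intro SUP_cong refl arg_cong[of _ _ ereal] plen_cong) (use partitions01_bounds in auto)

lemma curve_length_ge_dist: "0 \<le> t \<Longrightarrow> t \<le> 1 \<Longrightarrow> ereal (dist (g 0) (g t)) \<le> curve_length g"
proof -
  assume t: "0 \<le> t" "t \<le> 1"
  have "ereal (dist (g 0) (g t)) \<le> ereal (plen g [0, t, 1])" by simp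
  also have "\<dots> \<le> curve_length g" unfolding curve_length_plen
    using t by (intro SUP_upper) (auto simp: partitions01_def)
  finally show ?thesis .
qed

lemma path_affine:
  assumes "path g" "0 \<le> s" "s \<le> t" "t \<le> 1"
  shows "path (\<lambda>x. g ((t - s) * x + s))"
proof -
  have im: "(\<lambda>x. (t - s) * x + s) ` {0..1} \<subseteq> {0..1}"
  proof (rule image_subsetI)
    fix x :: real assume "x \<in> {0..1}"
    then have "0 \<le> (t - s) * x" "(t - s) * x \<le> (t - s) * 1" using assms
      by (intro mult_nonneg_nonneg mult_left_mono; simp)+
    then show "(t - s) * x + s \<in> {0..1}" using assms by simp
  qed
  have "continuous_on {0..1} (g \<circ> (\<lambda>x. (t - s) * x + s))"
    using assms(1) im by (intro continuous_on_compose continuous_intros) (auto simp: path_def intro: continuous_on_subset)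
  then show ?thesis by (simp add: path_def o_def)
qed

section \<open>The cover as a proper geodesic space\<close>

locale length_covering =
  fixes p :: "'b::metric_space \<Rightarrow> 'a::metric_space"
  assumes cov: "covering_space UNIV p UNIV"
    and comp: "compact (UNIV :: 'a set)"
    and len_base: "length_space TYPE('a)"
    and len_lift: "lifted_length_metric p"
    and sc: "simply_connected (UNIV :: 'b set)"
begin

lemma dist_le_curve_length: "path g \<Longrightarrow> ereal (dist (g 0) (g 1)) \<le> curve_length (p \<circ> g)"
  using len_lift unfolding lifted_length_metric_def
  by (auto simp: pathstart_def pathfinish_def intro: INF_lower)

lemma dist_less_path:
  assumes "dist u (v::'b) < e"
  obtains g where "path g" "g 0 = u" "g 1 = v" "curve_length (p \<circ> g) < ereal e"
proof -
  have "(INF g \<in> {g. path g \<and> pathstart g = u \<and> pathfinish g = v}. curve_length (p \<circ> g)) < ereal e"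
    using len_lift assms unfolding lifted_length_metric_def by (metis ereal_less(2) less_ereal.simps(1))
  then show thesis using that by (auto simp: INF_less_iff pathstart_def pathfinish_def)
qed

lemma base_dist_less_path:
  assumes "dist x y < e"
  obtains g where "path g" "g 0 = x" "g 1 = (y::'a)" "curve_length g < ereal e"
proof -
  have "(INF g \<in> {g. path g \<and> pathstart g = x \<and> pathfinish g = y}. curve_length g) < ereal e"
    using len_base assms unfolding length_space_def by (metis less_ereal.simps(1))
  then show thesis using that by (auto simp: INF_less_iff pathstart_def pathfinish_def)
qed

text \<open>Near-optimal partitions of the three pieces are rescaled and concatenated to one
  partition of the unit interval. Lengths are measured after projection and distances in the cover;
  the definition of the lifted metric compares the two on each piece.\<close>

lemma dist3_le_curve_length:
  assumes g: "path g" and st: "0 \<le> s" "s \<le> t" "t \<le> 1"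
  shows "ereal (dist (g 0) (g s) + dist (g s) (g t) + dist (g t) (g 1)) \<le> curve_length (p \<circ> g)"
proof -
  have near: "\<exists>ts\<in>partitions01. dist (g a) (g b) - e < plen (p \<circ> g) (map (\<lambda>x. (b - a) * x + a) ts)"
    if ab: "0 \<le> a" "a \<le> b" "b \<le> 1" and "e > 0" for a b e
  proof -
    have "ereal (dist (g a) (g b) - e) < ereal (dist (g a) (g b))" using \<open>e > 0\<close> by simp
    also have "\<dots> \<le> curve_length (p \<circ> (\<lambda>x. g ((b - a) * x + a)))"
      using dist_le_curve_length[OF path_affine[OF g ab]] by simp
    finally show ?thesis unfolding curve_length_plen less_SUP_iff by (auto simp: plen_map o_def)
  qed
  have bound: "ereal (dist (g 0) (g s) + dist (g s) (g t) + dist (g t) (g 1) - 3 * e) \<le> curve_length (p \<circ> g)"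
    if "e > 0" for e
  proof -
    let ?m = "\<lambda>a b. map (\<lambda>x. (b - a) * x + a)"
    obtain ts1 where t1: "ts1 \<in> partitions01" "dist (g 0) (g s) - e < plen (p \<circ> g) (?m 0 s ts1)"
      using near[of 0 s e] st \<open>e > 0\<close> by auto
    obtain ts2 where t2: "ts2 \<in> partitions01" "dist (g s) (g t) - e < plen (p \<circ> g) (?m s t ts2)"
      using near[of s t e] st \<open>e > 0\<close> by auto
    obtain ts3 where t3: "ts3 \<in> partitions01" "dist (g t) (g 1) - e < plen (p \<circ> g) (?m t 1 ts3)"
      using near[of t 1 e] st \<open>e > 0\<close> by auto
    have srt: "sorted (?m a b ts)" if "ts \<in> partitions01" "a \<le> b" for a b :: real and ts
    proof -
      have "sorted_wrt (\<lambda>x y. (b - a) * x + a \<le> (b - a) * y + a) ts"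
        using that by (rule_tac sorted_wrt_mono_rel[of ts "(\<le>)"]) (simp_all add: partitions01_def mult_left_mono)
      then show ?thesis by (simp add: sorted_wrt_map)
    qed
    have bnd: "a \<le> x \<and> x \<le> b" if "ts \<in> partitions01" "a \<le> b" "x \<in> set (?m a b ts)" for a b x :: real and ts
    proof -
      obtain z where z: "z \<in> set ts" "x = (b - a) * z + a" using \<open>x \<in> set (?m a b ts)\<close> by auto
      have "0 \<le> z" "z \<le> 1" using partitions01_bounds[OF that(1) z(1)] by auto
      then have "0 \<le> (b - a) * z" "(b - a) * z \<le> (b - a) * 1"
        using that(2) by (intro mult_nonneg_nonneg mult_left_mono; simp)+
      then show ?thesis using z(2) by simp
    qed
    let ?L = "?m 0 s ts1 @ ?m s t ts2 @ ?m t 1 ts3"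
    have ne: "ts1 \<noteq> []" "ts2 \<noteq> []" "ts3 \<noteq> []" "hd ts1 = 0" "last ts3 = 1"
      using t1 t2 t3 by (auto simp: partitions01_def)
    have "sorted ?L"
      unfolding sorted_append
    proof (intro conjI ballI)
      show "sorted (?m 0 s ts1)" "sorted (?m s t ts2)" "sorted (?m t 1 ts3)"
        by (rule srt[OF t1(1) st(1)] srt[OF t2(1) st(2)] srt[OF t3(1) st(3)])+
      show "x \<le> y" if "x \<in> set (?m s t ts2)" "y \<in> set (?m t 1 ts3)" for x y
        using bnd[OF t2(1) st(2) that(1)] bnd[OF t3(1) st(3) that(2)] by simp
      show "x \<le> y" if x: "x \<in> set (?m 0 s ts1)" and y: "y \<in> set (?m s t ts2 @ ?m t 1 ts3)" for x y
      proof -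
        have "x \<le> s" using bnd[OF t1(1) st(1) x] by simp
        moreover have "s \<le> y" using y bnd[OF t2(1) st(2), of y] bnd[OF t3(1) st(3), of y] st by (auto simp del: set_map)
        ultimately show ?thesis by simp
      qed
    qed
    then have "?L \<in> partitions01" using ne by (auto simp: partitions01_def hd_append hd_map last_append last_map)
    then have "ereal (plen (p \<circ> g) ?L) \<le> curve_length (p \<circ> g)" unfolding curve_length_plen by (rule SUP_upper)
    moreover have "dist (g 0) (g s) + dist (g s) (g t) + dist (g t) (g 1) - 3 * e \<le> plen (p \<circ> g) ?L"
      using t1(2) t2(2) t3(2) plen_append[of "p \<circ> g" "?m 0 s ts1" "?m s t ts2 @ ?m t 1 ts3"]
        plen_append[of "p \<circ> g" "?m s t ts2" "?m t 1 ts3"] by linarith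
    ultimately show ?thesis using order_trans ereal_less_eq(3) by blast
  qed
  show ?thesis
  proof (cases "curve_length (p \<circ> g)")
    case (real c)
    have "dist (g 0) (g s) + dist (g s) (g t) + dist (g t) (g 1) \<le> c + e" if "e > 0" for e
      using bound[of "e / 3"] that real by simp
    then show ?thesis using real by (simp add: field_le_epsilon)
  next
    case MInf
    then show ?thesis using bound[of 1] by simp
  qed simp
qed

lemma p_lipschitz: "dist (p u) (p v) \<le> dist u v"
proof -
  have "ereal (dist (p u) (p v)) \<le> (INF g \<in> {g. path g \<and> pathstart g = u \<and> pathfinish g = v}. curve_length (p \<circ> g))"
    using curve_length_ge_dist[of 1 "p \<circ> _"] by (intro INF_greatest) (force simp: pathstart_def pathfinish_def)
  also have "\<dots> = ereal (dist u v)" using len_lift by (simp add: lifted_length_metric_def)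
  finally show ?thesis by simp
qed

lemma continuous_p: "continuous_on S p"
  using cov covering_space_imp_continuous continuous_on_subset by blast

text \<open>A nearly shortest path of the base is lifted from \<open>u\<close>; the end of the lift
  is the required point, since lifting keeps the projected length.\<close>

lemma lift_near:
  assumes "e > 0"
  obtains v where "p v = y" "dist u v < dist (p u) y + e"
proof -
  have "dist (p u) y < dist (p u) y + e" using assms by simp
  then obtain g where g: "path g" "g 0 = p u" "g 1 = y" "curve_length g < ereal (dist (p u) y + e)"
    using base_dist_less_path by blast
  have "pathstart g = p u" using g(2) by (simp add: pathstart_def)
  then obtain h where h: "path h" "h 0 = u" "\<And>t. t \<in> {0..1} \<Longrightarrow> p (h t) = g t"
    using metric_covering_lift_path[OF cov g(1)] unfolding pathstart_def by blast
  have "curve_length (p \<circ> h) = curve_length g" using h(3) by (intro curve_length_cong) auto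
  then have "dist (h 0) (h 1) < dist (p u) y + e"
    using dist_le_curve_length[OF h(1)] g(4) by (metis less_ereal.simps(1) order_le_less_trans)
  then show thesis using that[of "h 1"] h g by auto
qed

text \<open>Let \<open>r\<close> be a Lebesgue number for the evenly covered open sets of the
  compact base. A path shorter than \<open>r\<close> between two points of a fibre projects into one
  such set; by connectedness it stays in a single sheet, on which \<open>p\<close> is
  injective.\<close>

lemma fibre_separated: "\<exists>r>0. \<forall>u v. p u = p v \<longrightarrow> dist u v < r \<longrightarrow> u = v"
proof -
  define \<G> where "\<G> = {T. open T \<and> (\<exists>\<V>. \<Union>\<V> = p -` T \<and> (\<forall>u\<in>\<V>. open u) \<and> pairwise disjnt \<V> \<and>
     (\<forall>u\<in>\<V>. \<exists>q. homeomorphism u T p q))}"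
  have "UNIV \<subseteq> \<Union>\<G>" using cov unfolding covering_space_def \<G>_def by simp blast
  moreover have "\<And>G. G \<in> \<G> \<Longrightarrow> open G" by (simp add: \<G>_def)
  ultimately obtain r where r: "r > 0" "\<And>x. \<exists>G\<in>\<G>. ball x r \<subseteq> G"
    using Heine_Borel_lemma[OF comp, of \<G>] by (metis UNIV_I)
  have "u = v" if uv: "p u = p v" "dist u v < r" for u v
  proof -
    obtain g where g: "path g" "g 0 = u" "g 1 = v" "curve_length (p \<circ> g) < ereal r"
      using dist_less_path[OF uv(2)] by blast
    obtain T where T: "T \<in> \<G>" "ball (p u) r \<subseteq> T" using r(2) by blast
    have "\<exists>\<V>. \<Union>\<V> = p -` T \<and> (\<forall>u\<in>\<V>. open u) \<and> pairwise disjnt \<V> \<and> (\<forall>u\<in>\<V>. \<exists>q. homeomorphism u T p q)"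
      using T(1) by (simp add: \<G>_def)
    then obtain \<V> where V: "\<Union>\<V> = p -` T" "\<And>u. u \<in> \<V> \<Longrightarrow> open u" "pairwise disjnt \<V>"
      "\<And>u. u \<in> \<V> \<Longrightarrow> \<exists>q. homeomorphism u T p q" by metis
    have im: "path_image g \<subseteq> \<Union>\<V>"
    proof
      fix z assume "z \<in> path_image g"
      then obtain t where t: "0 \<le> t" "t \<le> 1" "z = g t" by (auto simp: path_image_def)
      have "ereal (dist (p u) (p z)) < ereal r"
        using order_le_less_trans[OF curve_length_ge_dist[OF t(1,2), of "p \<circ> g"] g(4)] t g(2) by simp
      then show "z \<in> \<Union>\<V>" unfolding V(1) using T(2) by auto
    qed
    have uv_im: "u \<in> path_image g" "v \<in> path_image g" using g by (auto simp: path_image_def)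
    then obtain U where U: "U \<in> \<V>" "u \<in> U" using im by blast
    have "v \<in> U"
    proof (rule ccontr)
      assume "v \<notin> U"
      have "connected (path_image g)" using g(1) by (rule connected_path_image)
      moreover have "open U" "open (\<Union>(\<V> - {U}))" using U V(2) by auto
      moreover have "U \<inter> \<Union>(\<V> - {U}) \<inter> path_image g = {}" using V(3) U by (auto simp: pairwise_def disjnt_def)
      moreover have "path_image g \<subseteq> U \<union> \<Union>(\<V> - {U})" using im by blast
      ultimately have "U \<inter> path_image g = {} \<or> \<Union>(\<V> - {U}) \<inter> path_image g = {}" by (rule connectedD)
      then show False using U uv_im im \<open>v \<notin> U\<close> by blast
    qed
    moreover obtain q where "homeomorphism U T p q" using V(4) U by blast
    ultimately show ?thesis using U uv(1) unfolding homeomorphism_def by metis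
  qed
  with r(1) show ?thesis by blast
qed

lemma dist_less_path_in_ball:
  assumes "dist u (v::'b) < e"
  obtains g where "path g" "g 0 = u" "g 1 = v" "path_image g \<subseteq> ball u e"
proof -
  obtain g where g: "path g" "g 0 = u" "g 1 = v" "curve_length (p \<circ> g) < ereal e"
    using dist_less_path[OF assms] by blast
  have "path_image g \<subseteq> ball u e"
  proof
    fix z assume "z \<in> path_image g"
    then obtain t where t: "0 \<le> t" "t \<le> 1" "z = g t" by (auto simp: path_image_def)
    have "ereal (dist (g 0) (g t) + dist (g t) (g t) + dist (g t) (g 1)) < ereal e"
      using dist3_le_curve_length[OF g(1) t(1) order_refl t(2)] g(4) by (rule order_le_less_trans)
    then have "dist (g 0) (g t) < e" using zero_le_dist[of "g t" "g 1"] by (simp del: zero_le_dist)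
    then show "z \<in> ball u e" using t g by simp
  qed
  then show thesis using that g by blast
qed

lemma path_connected_ball: "path_connected (ball (u::'b) e)"
  unfolding path_connected_component
proof (intro ballI)
  fix x y assume xy: "x \<in> ball u e" "y \<in> ball u e"
  have *: "path_component (ball u e) u z" if "z \<in> ball u e" for z
  proof -
    have "dist u z < e" using \<open>z \<in> ball u e\<close> by simp
    then obtain g where "path g" "g 0 = u" "g 1 = z" "path_image g \<subseteq> ball u e"
      using dist_less_path_in_ball by blast
    then show ?thesis unfolding path_component_def pathstart_def pathfinish_def by blast
  qed
  show "path_component (ball u e) x y" using *[OF xy(1)] *[OF xy(2)] path_component_sym path_component_trans by blast
qed

lemma locally_path_connected_cover: "locally path_connected (UNIV :: 'b set)"
proof (rule locallyI)
  fix w and x :: 'b assume "openin (top_of_set UNIV) w" "x \<in> w"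
  then have "open w" "x \<in> w" by auto
  then obtain e where "e > 0" "ball x e \<subseteq> w" using open_contains_ball by blast
  then show "\<exists>u v. openin (top_of_set UNIV) u \<and> path_connected v \<and> x \<in> u \<and> u \<subseteq> v \<and> v \<subseteq> w"
    using path_connected_ball[of x e] by (intro exI[of _ "ball x e"]) auto
qed

lemma path_connected_cover: "path_connected (UNIV :: 'b set)"
proof -
  have "path_component UNIV x y" for x y :: 'b
    using dist_less_path_in_ball[of x y "dist x y + 1"]
    unfolding path_component_def pathstart_def pathfinish_def by (metis less_add_one subset_UNIV)
  then show ?thesis by (simp add: path_connected_component)
qed

text \<open>Nearly optimal lifts of \<open>y\<close> around \<open>u\<close> lie in one fibre and
  are less than \<open>r\<close> apart, so they are a single point, which therefore realizes the
  infimum.\<close>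

lemma lift_exact:
  assumes r: "\<And>u v. p u = p v \<Longrightarrow> dist u v < r \<Longrightarrow> u = v" and y: "dist (p u) y < r / 2"
  obtains v where "p v = y" "dist u v = dist (p u) y"
proof -
  have pos: "r / 2 - dist (p u) y > 0" using y by simp
  obtain v where v: "p v = y" "dist u v < dist (p u) y + (r / 2 - dist (p u) y)" using lift_near[OF pos] by blast
  have "dist u v \<le> dist (p u) y + e" if "e > 0" for e
  proof -
    have "min e (r / 2 - dist (p u) y) > 0" using pos that by simp
    then obtain w where w: "p w = y" "dist u w < dist (p u) y + min e (r / 2 - dist (p u) y)"
      using lift_near by blast
    have "dist u w < r / 2" using w(2) by simp
    then have "dist v w < r" using v(2) dist_triangle[of v w u] by (simp add: dist_commute)
    then have "v = w" using r[of v w] v(1) w(1) by simp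
    then show ?thesis using w(2) by simp
  qed
  then have "dist u v \<le> dist (p u) y" by (rule field_le_epsilon)
  then show thesis using that v(1) p_lipschitz[of u v] by fastforce
qed

text \<open>A subsequence converges after projection, to \<open>y\<close> say. The lifts of
  \<open>y\<close> at exact distance from its late terms are less than \<open>r\<close> apart, so
  they are one point, and the subsequence converges to it.\<close>

lemma compact_small_cball:
  assumes r: "r > 0" "\<And>u v. p u = p v \<Longrightarrow> dist u v < r \<Longrightarrow> u = v"
  shows "compact (cball (u::'b) (r / 8))"
  unfolding compact_eq_seq_compact_metric seq_compact_def
proof (intro allI impI)
  fix f :: "nat \<Rightarrow> 'b" assume f: "\<forall>n. f n \<in> cball u (r / 8)"
  have "seq_compact (UNIV :: 'a set)" using comp compact_eq_seq_compact_metric by blast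
  then obtain y s where s: "strict_mono s" "((p \<circ> f) \<circ> s) \<longlonglongrightarrow> y"
    unfolding seq_compact_def by (metis UNIV_I)
  have ev: "\<forall>\<^sub>F n in sequentially. dist (p (f (s n))) y < r / 8"
    using tendstoD[OF s(2), of "r / 8"] r(1) by (simp only: o_apply)
  have lift: "\<exists>w. p w = y \<and> dist (f (s n)) w = dist (p (f (s n))) y" if "dist (p (f (s n))) y < r / 8" for n
  proof -
    have "dist (p (f (s n))) y < r / 2" using that r(1) by simp
    from lift_exact[OF r(2) this] show ?thesis by blast
  qed
  obtain n0 where n0: "dist (p (f (s n0))) y < r / 8" using ev eventually_happens' sequentially_bot by blast
  obtain w where w: "p w = y" "dist (f (s n0)) w < r / 8" using lift[OF n0] n0 by auto
  have eq: "dist (f (s n)) w = dist (p (f (s n))) y" if n: "dist (p (f (s n))) y < r / 8" for n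
  proof -
    obtain w' where w': "p w' = y" "dist (f (s n)) w' = dist (p (f (s n))) y" using lift[OF n] by auto
    have fn: "dist u (f (s n)) \<le> r / 8" "dist u (f (s n0)) \<le> r / 8" using f by auto
    have "dist w w' \<le> dist w (f (s n0)) + dist (f (s n0)) u + dist u (f (s n)) + dist (f (s n)) w'"
      using dist_triangle[of w w' u] dist_triangle[of w u "f (s n0)"] dist_triangle[of u w' "f (s n)"] by linarith
    also have "\<dots> < r" using w(2) w'(2) n fn r(1) by (simp add: dist_commute)
    finally have "w = w'" using r(2)[of w w'] w(1) w'(1) by simp
    then show ?thesis using w' by simp
  qed
  have "(f \<circ> s) \<longlonglongrightarrow> w"
    unfolding tendsto_iff
  proof (intro allI impI)
    fix e :: real assume "e > 0"
    then have "\<forall>\<^sub>F n in sequentially. dist (p (f (s n))) y < e" using s(2) unfolding tendsto_iff by (simp add: o_def)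
    then show "\<forall>\<^sub>F n in sequentially. dist ((f \<circ> s) n) w < e"
      using ev by eventually_elim (simp add: eq)
  qed
  moreover have "w \<in> cball u (r / 8)"
  proof -
    have "closed (cball u (r / 8))" by simp
    then show ?thesis using \<open>(f \<circ> s) \<longlonglongrightarrow> w\<close> f unfolding closed_sequential_limits by (metis o_apply)
  qed
  ultimately show "\<exists>l\<in>cball u (r / 8). \<exists>r. strict_mono r \<and> (f \<circ> r) \<longlonglongrightarrow> l" using s(1) by blast
qed

text \<open>A path whose projection exceeds the distance by less than \<open>e\<close> is
  reparametrized by the first time \<open>\<sigma> t\<close> at which the distance from
  \<open>u\<close> reaches \<open>t\<close>. The result may be discontinuous, but the excess length
  bounds all its defects by \<open>e\<close>.\<close>

lemma approx_geodesic:
  assumes e: "e > 0"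
  obtains f where "f 0 = (u::'b)" "\<And>t. t \<in> {0..dist u v} \<Longrightarrow> dist u (f t) = t"
    "\<And>s t. \<lbrakk>0 \<le> s; s \<le> t; t \<le> dist u v\<rbrakk> \<Longrightarrow> dist (f s) (f t) \<le> t - s + e"
    "\<And>t. t \<in> {0..dist u v} \<Longrightarrow> dist (f t) v \<le> dist u v - t + e"
proof -
  define L where "L = dist u v"
  have "dist u v < L + e" using e by (simp add: L_def)
  then obtain g where g: "path g" "g 0 = u" "g 1 = v" "curve_length (p \<circ> g) < ereal (L + e)"
    using dist_less_path by blast
  have cont: "continuous_on {0..1} (\<lambda>x. dist u (g x))"
    using g(1) unfolding path_def by (intro continuous_intros)
  have three: "dist u (g a) + dist (g a) (g b) + dist (g b) v < L + e" if ab: "0 \<le> a" "a \<le> b" "b \<le> 1" for a b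
    using order_le_less_trans[OF dist3_le_curve_length[OF g(1) ab] g(4)] g(2,3) by simp
  define S where "S = (\<lambda>t. {x\<in>{0..1}. dist u (g x) \<ge> t})"
  define \<sigma> where "\<sigma> = (\<lambda>t. Inf (S t))"
  have bdd: "bdd_below (S t)" for t by (rule bdd_belowI[of _ 0]) (auto simp: S_def)
  have one: "1 \<in> S t" if "t \<le> L" for t using that g by (auto simp: S_def L_def)
  have \<sigma>S: "\<sigma> t \<in> S t" if "t \<le> L" for t
    unfolding \<sigma>_def
  proof (rule closed_contains_Inf)
    show "S t \<noteq> {}" using one[OF that] by blast
    have "S t = {0..1} \<inter> (\<lambda>x. dist u (g x)) -` {t..}" by (auto simp: S_def)
    then show "closed (S t)" using continuous_closed_preimage[OF cont] by simp
  qed (rule bdd)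
  have \<sigma>eq: "dist u (g (\<sigma> t)) = t" if t: "0 \<le> t" "t \<le> L" for t
  proof (rule ccontr)
    assume "dist u (g (\<sigma> t)) \<noteq> t"
    then have gt: "dist u (g (\<sigma> t)) > t" using \<sigma>S[OF t(2)] by (auto simp: S_def)
    have s01: "0 \<le> \<sigma> t" "\<sigma> t \<le> 1" using \<sigma>S[OF t(2)] by (auto simp: S_def)
    have "\<exists>x\<ge>0. x \<le> \<sigma> t \<and> dist u (g x) = t"
      using t gt s01 g(2) by (intro IVT' continuous_on_subset[OF cont]) auto
    then obtain x where x: "0 \<le> x" "x \<le> \<sigma> t" "dist u (g x) = t" by blast
    then have "x \<in> S t" using s01 by (auto simp: S_def)
    then have "\<sigma> t \<le> x" unfolding \<sigma>_def by (intro cInf_lower bdd)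
    then show False using x gt by simp
  qed
  have mono: "\<sigma> s \<le> \<sigma> t" if "s \<le> t" "t \<le> L" for s t
    unfolding \<sigma>_def using that one[of t] by (intro cInf_superset_mono bdd) (auto simp: S_def)
  have s01: "0 \<le> \<sigma> t" "\<sigma> t \<le> 1" if "t \<le> L" for t using \<sigma>S[OF that] by (auto simp: S_def)
  show thesis
  proof (rule that[of "\<lambda>t. g (\<sigma> t)"])
    have "\<sigma> 0 = 0"
    proof (rule antisym)
      show "\<sigma> 0 \<le> 0" unfolding \<sigma>_def by (rule cInf_lower[OF _ bdd]) (simp add: S_def)
      show "0 \<le> \<sigma> 0" by (rule s01) (simp add: L_def)
    qed
    then show "g (\<sigma> 0) = u" using g(2) by simp
    show "dist u (g (\<sigma> t)) = t" if "t \<in> {0..dist u v}" for t using \<sigma>eq that by (auto simp: L_def)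
    show "dist (g (\<sigma> s)) (g (\<sigma> t)) \<le> t - s + e" if st: "0 \<le> s" "s \<le> t" "t \<le> dist u v" for s t
    proof -
      have tL: "t \<le> L" "s \<le> L" using st by (auto simp: L_def)
      have "s + dist (g (\<sigma> s)) (g (\<sigma> t)) + dist (g (\<sigma> t)) v < L + e"
        using three[of "\<sigma> s" "\<sigma> t"] s01 mono st tL \<sigma>eq[of s] by simp
      moreover have "L \<le> t + dist (g (\<sigma> t)) v"
        using dist_triangle[of u v "g (\<sigma> t)"] \<sigma>eq[of t] st tL by (simp add: L_def)
      ultimately show ?thesis by linarith
    qed
    show "dist (g (\<sigma> t)) v \<le> dist u v - t + e" if "t \<in> {0..dist u v}" for t
    proof -
      have tL: "0 \<le> t" "t \<le> L" using that by (auto simp: L_def)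
      then show ?thesis using three[of "\<sigma> t" "\<sigma> t"] s01 \<sigma>eq[of t] by (simp add: L_def)
    qed
  qed
qed

text \<open>As in the Hopf-Rinow theorem, compactness is spread outwards: each point of the larger
  ball is within \<open>2 * \<rho>\<close> of a point of the smaller one. The steps do not shrink
  because small balls are compact with a uniform radius.\<close>

lemma compact_cball: "compact (cball (u::'b) R)"
proof -
  obtain r where r: "r > 0" "\<And>u v. p u = p v \<Longrightarrow> dist u v < r \<Longrightarrow> u = v" using fibre_separated by blast
  \<comment> \<open>A ball of radius \<open>3 * \<rho>\<close> around the limit of the auxiliary
    points has to fit into the compact ball of radius \<open>r / 8\<close>.\<close>
  define \<rho> where "\<rho> = r / 32"
  have \<rho>: "\<rho> > 0" using r(1) by (simp add: \<rho>_def)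
  have main: "compact (cball u (real n * \<rho>))" for n
  proof (induction n)
    case (Suc n)
    show ?case
      unfolding compact_eq_seq_compact_metric seq_compact_def
    proof (intro allI impI)
      fix f :: "nat \<Rightarrow> 'b" assume f: "\<forall>i. f i \<in> cball u (real (Suc n) * \<rho>)"
      have "\<exists>v. v \<in> cball u (real n * \<rho>) \<and> dist v (f i) \<le> 2 * \<rho>" for i
      proof (cases "dist u (f i) \<le> real n * \<rho>")
        case True then show ?thesis using \<rho> by (intro exI[of _ "f i"]) auto
      next
        case False
        obtain h where h: "\<And>t. t \<in> {0..dist u (f i)} \<Longrightarrow> dist u (h t) = t"
            "\<And>t. t \<in> {0..dist u (f i)} \<Longrightarrow> dist (h t) (f i) \<le> dist u (f i) - t + \<rho>"
          using approx_geodesic[OF \<rho>, of u "f i"] by metis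
        have t: "real n * \<rho> \<in> {0..dist u (f i)}" using False \<rho> by auto
        have "dist u (f i) \<le> real (Suc n) * \<rho>" using f by auto
        then have "dist (h (real n * \<rho>)) (f i) \<le> 2 * \<rho>" using h(2)[OF t] by (simp add: algebra_simps)
        then show ?thesis using h(1)[OF t] by (intro exI[of _ "h (real n * \<rho>)"]) auto
      qed
      then obtain w where w: "\<And>i. w i \<in> cball u (real n * \<rho>)" "\<And>i. dist (w i) (f i) \<le> 2 * \<rho>" by metis
      obtain x s where s: "strict_mono s" "(w \<circ> s) \<longlonglongrightarrow> x"
        using Suc.IH w(1) unfolding compact_eq_seq_compact_metric seq_compact_def by metis
      have "\<forall>\<^sub>F i in sequentially. dist (w (s i)) x < \<rho>" using s(2) \<rho> unfolding tendsto_iff by (simp add: o_def)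
      then obtain N where N: "\<And>i. i \<ge> N \<Longrightarrow> dist (w (s i)) x < \<rho>" unfolding eventually_sequentially by blast
      define f' where "f' = (\<lambda>i. f (s (i + N)))"
      have "f' i \<in> cball x (r / 8)" for i
      proof -
        have "dist x (f' i) \<le> dist x (w (s (i + N))) + dist (w (s (i + N))) (f (s (i + N)))"
          unfolding f'_def by (rule dist_triangle)
        then show ?thesis using N[of "i + N"] w(2)[of "s (i + N)"] r(1) by (simp add: \<rho>_def dist_commute)
      qed
      then obtain l s' where l: "strict_mono s'" "(f' \<circ> s') \<longlonglongrightarrow> l"
        using compact_small_cball[OF r, of x] unfolding compact_eq_seq_compact_metric seq_compact_def by metis
      define q where "q = (\<lambda>i. s (s' i + N))"
      have q: "strict_mono q" using s(1) l(1) by (simp add: q_def strict_mono_def)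
      have lim: "(f \<circ> q) \<longlonglongrightarrow> l" using l(2) by (simp add: q_def f'_def o_def)
      have "closed (cball u (real (Suc n) * \<rho>))" by simp
      then have "l \<in> cball u (real (Suc n) * \<rho>)"
        using lim f unfolding closed_sequential_limits by (metis o_apply)
      then show "\<exists>l\<in>cball u (real (Suc n) * \<rho>). \<exists>r. strict_mono r \<and> (f \<circ> r) \<longlonglongrightarrow> l" using q lim by blast
    qed
  qed simp
  obtain n :: nat where "real n > R / \<rho>" using reals_Archimedean2 by blast
  then have "R \<le> real n * \<rho>" using \<rho> by (simp add: field_simps)
  then have "cball u R = cball u (real n * \<rho>) \<inter> cball u R" by auto
  then show ?thesis using main[of n] closed_cball compact_Int_closed by metis
qed

text \<open>The conditions on approximate geodesics are closed under pointwise convergence and the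
  values stay in a compact ball, so Tychonoff compactness yields a curve satisfying all of them.
  This suits approximations that may be discontinuous.\<close>

lemma geodesic_exists:
  obtains c where "c 0 = (u::'b)" "c (dist u v) = v"
    "\<And>s t. \<lbrakk>s \<in> {0..dist u v}; t \<in> {0..dist u v}\<rbrakk> \<Longrightarrow> dist (c s) (c t) = \<bar>s - t\<bar>"
proof -
  define L where "L = dist u (v::'b)"
  have L0: "L \<ge> 0" by (simp add: L_def)
  define K :: "(real \<Rightarrow> 'b) set" where "K = PiE UNIV (\<lambda>_. cball u L)"
  define D :: "nat \<Rightarrow> (real \<Rightarrow> 'b) set" where
    "D = (\<lambda>n. (\<Inter>s\<in>{0..L}. \<Inter>t\<in>{0..L}. {f. dist (f s) (f t) \<le> \<bar>s - t\<bar> + 1 / Suc n}) \<inter>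
       {f. dist (f 0) u \<le> 0} \<inter> {f. dist (f L) v \<le> 1 / Suc n})"
  have "compactin (product_topology (\<lambda>_. euclidean) UNIV) K"
    unfolding K_def compactin_PiE by (simp add: compact_cball)
  then have "compact K" by (simp add: euclidean_product_topology)
  moreover have "closed (D n)" for n unfolding D_def
    by (intro closed_Int closed_INT ballI closed_Collect_le continuous_intros continuous_on_product_coordinates)
  moreover have "K \<inter> (\<Inter>n\<in>I. D n) \<noteq> {}" if I: "finite I" "I \<subseteq> UNIV" for I
  proof -
    obtain N where N: "\<And>n. n \<in> I \<Longrightarrow> n \<le> N" using I(1) finite_nat_set_iff_bounded_le by auto
    have e0: "1 / real (Suc N) > 0" by simp
    obtain f where f: "f 0 = u" "\<And>t. t \<in> {0..L} \<Longrightarrow> dist u (f t) = t"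
        "\<And>s t. \<lbrakk>0 \<le> s; s \<le> t; t \<le> L\<rbrakk> \<Longrightarrow> dist (f s) (f t) \<le> t - s + 1 / real (Suc N)"
        "\<And>t. t \<in> {0..L} \<Longrightarrow> dist (f t) v \<le> L - t + 1 / real (Suc N)"
      using approx_geodesic[OF e0, of u v] unfolding L_def by blast
    \<comment> \<open>The value \<open>u\<close> outside the interval keeps the function in the
      compact product \<open>K\<close>.\<close>
    define F where "F = (\<lambda>t. if t \<in> {0..L} then f t else u)"
    have "F \<in> K" using f(2) L0 by (auto simp: F_def K_def)
    moreover have "F \<in> D n" if "n \<in> I" for n
    proof -
      have le: "1 / real (Suc N) \<le> 1 / real (Suc n)" using N[OF that] by (simp add: frac_le)
      have "dist (F s) (F t) \<le> \<bar>s - t\<bar> + 1 / Suc n" if "s \<in> {0..L}" "t \<in> {0..L}" for s t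
        using f(3)[of s t] f(3)[of t s] that le by (cases "s \<le> t") (auto simp: F_def dist_commute)
      moreover have "dist (F L) v \<le> 1 / Suc n" using f(4)[of L] L0 le by (simp add: F_def)
      ultimately show ?thesis using f(1) L0 by (simp add: D_def F_def)
    qed
    ultimately show ?thesis by blast
  qed
  ultimately have "K \<inter> (\<Inter>n\<in>UNIV. D n) \<noteq> {}" by (rule compact_imp_fip_image)
  then obtain c where c: "\<And>n. c \<in> D n" by blast
  have eps: "x \<le> y" if "\<And>n. x \<le> y + 1 / real (Suc n)" for x y :: real
  proof (rule field_le_epsilon)
    fix e :: real assume "e > 0"
    then obtain n where "1 / real (Suc n) < e" using nat_approx_posE by blast
    then show "x \<le> y + e" using that[of n] by linarith
  qed
  have c0: "c 0 = u" using c[of 0] by (simp add: D_def)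
  have "dist (c L) v \<le> 0"
  proof (rule eps)
    show "dist (c L) v \<le> 0 + 1 / real (Suc n)" for n using c[of n] by (simp add: D_def)
  qed
  then have cL: "c L = v" by simp
  have le: "dist (c s) (c t) \<le> \<bar>s - t\<bar>" if "s \<in> {0..L}" "t \<in> {0..L}" for s t
  proof (rule eps)
    show "dist (c s) (c t) \<le> \<bar>s - t\<bar> + 1 / real (Suc n)" for n using c[of n] that by (simp add: D_def)
  qed
  \<comment> \<open>The three pieces are at most as long as their parameter intervals and together
    at least \<open>L\<close>, so none is shorter.\<close>
  have eq: "dist (c s) (c t) = t - s" if st: "0 \<le> s" "s \<le> t" "t \<le> L" for s t
  proof -
    have "L \<le> dist (c 0) (c s) + dist (c s) (c t) + dist (c t) (c L)"
      using dist_triangle[of u v "c s"] dist_triangle[of "c s" v "c t"] c0 cL by (simp add: L_def)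
    then show ?thesis using le[of 0 s] le[of s t] le[of t L] st by simp
  qed
  show thesis
  proof (rule that[of c])
    show "dist (c s) (c t) = \<bar>s - t\<bar>" if "s \<in> {0..dist u v}" "t \<in> {0..dist u v}" for s t
      using eq[of s t] eq[of t s] that by (cases "s \<le> t") (auto simp: dist_commute L_def)
  qed (use c0 cL in \<open>auto simp: L_def\<close>)
qed

end

section \<open>Deck transformations and the fundamental group\<close>

text \<open>Only continuity and compatibility with \<open>p\<close> are demanded; for the coverings
  below, existence and uniqueness of lifts make such a map invertible, and it is an isometry because
  the metric is determined by projected lengths.\<close>

definition deck :: "('b::topological_space \<Rightarrow> 'a) \<Rightarrow> ('b \<Rightarrow> 'b) set" where
  "deck p = {\<phi>. continuous_on UNIV \<phi> \<and> (\<forall>u. p (\<phi> u) = p u)}"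

context length_covering
begin

lemma deck_proj: "\<phi> \<in> deck p \<Longrightarrow> p (\<phi> u) = p u"
  by (simp add: deck_def)

lemma deck_continuous: "\<phi> \<in> deck p \<Longrightarrow> continuous_on S \<phi>"
  unfolding deck_def using continuous_on_subset by blast

lemma deck_id: "id \<in> deck p"
  by (simp add: deck_def)

lemma deck_comp: "\<phi> \<in> deck p \<Longrightarrow> \<psi> \<in> deck p \<Longrightarrow> \<phi> \<circ> \<psi> \<in> deck p"
proof -
  assume \<phi>: "\<phi> \<in> deck p" and \<psi>: "\<psi> \<in> deck p"
  then have "continuous_on UNIV (\<phi> \<circ> \<psi>)" by (intro continuous_on_compose deck_continuous)
  then show ?thesis using \<phi> \<psi> by (simp add: deck_def)
qed

lemma deck_transitive:
  assumes "p u = p v"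
  obtains \<phi> where "\<phi> \<in> deck p" "\<phi> u = v"
  using metric_covering_lift[OF cov sc locally_path_connected_cover continuous_p assms]
  unfolding deck_def by blast

lemma deck_unique:
  assumes "\<phi> \<in> deck p" "\<psi> \<in> deck p" "\<phi> u = \<psi> u"
  shows "\<phi> = \<psi>"
proof (rule ext)
  show "\<phi> x = \<psi> x" for x
  proof (rule metric_covering_lift_unique[OF cov, of UNIV \<phi> \<psi> u])
    show "connected (UNIV :: 'b set)" using path_connected_cover path_connected_imp_connected by blast
  qed (use assms deck_continuous deck_proj in auto)
qed

lemma deck_inverse:
  assumes "\<phi> \<in> deck p"
  obtains \<psi> where "\<psi> \<in> deck p" "\<psi> \<circ> \<phi> = id" "\<phi> \<circ> \<psi> = id"
proof -
  obtain \<psi> where \<psi>: "\<psi> \<in> deck p" "\<psi> (\<phi> undefined) = undefined"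
    using deck_transitive deck_proj[OF assms] by metis
  have "\<psi> \<circ> \<phi> = id" using deck_unique[of "\<psi> \<circ> \<phi>" id undefined] \<psi> assms deck_comp deck_id by simp
  moreover have "\<phi> \<circ> \<psi> = id" using deck_unique[of "\<phi> \<circ> \<psi>" id "\<phi> undefined"] \<psi> assms deck_comp deck_id by simp
  ultimately show thesis using that \<psi> by blast
qed

lemma deck_isometry:
  assumes "\<phi> \<in> deck p"
  shows "dist (\<phi> u) (\<phi> v) = dist u v"
proof -
  have le: "dist (\<phi> u) (\<phi> v) \<le> dist u v" if \<phi>: "\<phi> \<in> deck p" for \<phi> u v
  proof (rule field_le_epsilon)
    fix e :: real assume "e > 0"
    then have "dist u v < dist u v + e" by simp
    then obtain g where g: "path g" "g 0 = u" "g 1 = v" "curve_length (p \<circ> g) < ereal (dist u v + e)"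
      using dist_less_path by blast
    have "path (\<phi> \<circ> g)" using g(1) deck_continuous[OF \<phi>] by (intro path_continuous_image)
    then have "ereal (dist (\<phi> u) (\<phi> v)) \<le> curve_length (p \<circ> (\<phi> \<circ> g))"
      using dist_le_curve_length[of "\<phi> \<circ> g"] g by simp
    also have "p \<circ> (\<phi> \<circ> g) = p \<circ> g" using deck_proj[OF \<phi>] by (simp add: o_def)
    finally show "dist (\<phi> u) (\<phi> v) \<le> dist u v + e"
      using g(4) by (metis less_eq_real_def less_ereal.simps(1) order_le_less_trans)
  qed
  obtain \<psi> where \<psi>: "\<psi> \<in> deck p" "\<psi> \<circ> \<phi> = id" using deck_inverse[OF assms] by blast
  then have "dist u v = dist (\<psi> (\<phi> u)) (\<psi> (\<phi> v))" by (metis comp_apply id_apply)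
  then show ?thesis using le[OF assms, of u v] le[OF \<psi>(1), of "\<phi> u" "\<phi> v"] by simp
qed

lemma deck_displacement:
  assumes r: "\<And>u v. p u = p v \<Longrightarrow> dist u v < r \<Longrightarrow> u = v" and \<phi>: "\<phi> \<in> deck p" "\<phi> \<noteq> id"
  shows "r \<le> dist u (\<phi> u)"
  using r[of u "\<phi> u"] deck_proj[OF \<phi>(1), of u] deck_unique[OF \<phi>(1) deck_id, of u] \<phi>(2) by force

text \<open>Distinct deck transformations send \<open>v\<close> to points of one fibre at distance
  at least \<open>r\<close>. The ball is covered by finitely many balls of radius
  \<open>r / 2\<close>, each containing at most one of these points.\<close>

lemma finite_deck: "finite {\<phi> \<in> deck p. dist u (\<phi> v) \<le> R}"
proof -
  obtain r where r: "r > 0" "\<And>u v. p u = p v \<Longrightarrow> dist u v < r \<Longrightarrow> u = v" using fibre_separated by blast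
  have "cball u R \<subseteq> (\<Union>x\<in>cball u R. ball x (r / 2))" using r(1) by auto
  then obtain C where C: "C \<subseteq> cball u R" "finite C" "cball u R \<subseteq> (\<Union>x\<in>C. ball x (r / 2))"
    using compactE_image[OF compact_cball, of "cball u R" "\<lambda>x. ball x (r / 2)"] by blast
  have "\<exists>x\<in>C. \<phi> v \<in> ball x (r / 2)" if "\<phi> \<in> {\<phi> \<in> deck p. dist u (\<phi> v) \<le> R}" for \<phi>
  proof -
    have "\<phi> v \<in> cball u R" using that by simp
    then show ?thesis using C(3) by blast
  qed
  then have "\<forall>\<phi>\<in>{\<phi> \<in> deck p. dist u (\<phi> v) \<le> R}. \<exists>x. x \<in> C \<and> \<phi> v \<in> ball x (r / 2)" by blast
  from bchoice[OF this] obtain f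
    where f: "\<And>\<phi>. \<phi> \<in> {\<phi> \<in> deck p. dist u (\<phi> v) \<le> R} \<Longrightarrow> f \<phi> \<in> C \<and> \<phi> v \<in> ball (f \<phi>) (r / 2)"
    by blast
  have "inj_on f {\<phi> \<in> deck p. dist u (\<phi> v) \<le> R}"
  proof (rule inj_onI)
    fix \<phi> \<psi> assume *: "\<phi> \<in> {\<phi> \<in> deck p. dist u (\<phi> v) \<le> R}" "\<psi> \<in> {\<phi> \<in> deck p. dist u (\<phi> v) \<le> R}" "f \<phi> = f \<psi>"
    have "dist (\<phi> v) (\<psi> v) \<le> dist (\<phi> v) (f \<phi>) + dist (f \<phi>) (\<psi> v)" by (rule dist_triangle)
    also have "\<dots> < r" using f[OF *(1)] f[OF *(2)] *(3) by (simp add: dist_commute)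
    finally have "\<phi> v = \<psi> v" using r(2)[of "\<phi> v" "\<psi> v"] * deck_proj by simp
    then show "\<phi> = \<psi>" using deck_unique * by blast
  qed
  moreover have "f ` {\<phi> \<in> deck p. dist u (\<phi> v) \<le> R} \<subseteq> C" using f by blast
  ultimately show ?thesis using C(2) finite_imageD finite_subset by blast
qed

lemma deck_cocompact:
  obtains R where "R \<ge> 0" "\<And>v. \<exists>\<psi>\<in>deck p. dist u (\<psi> v) \<le> R"
proof -
  have "bounded (UNIV :: 'a set)" using comp compact_imp_bounded by blast
  then obtain B where B: "\<And>y. dist (p u) y \<le> B" unfolding bounded_any_center[where a = "p u"] by blast
  have "\<exists>\<psi>\<in>deck p. dist u (\<psi> v) \<le> B + 1" for v
  proof -
    obtain w where w: "p w = p v" "dist u w < dist (p u) (p v) + 1" using lift_near[of 1] by auto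
    obtain \<psi> where "\<psi> \<in> deck p" "\<psi> v = w" using deck_transitive[of v w] w(1) by metis
    then show ?thesis using w(2) B[of "p v"] by force
  qed
  moreover have "B + 1 \<ge> 0" using B[of "p u"] by simp
  ultimately show thesis using that by blast
qed

text \<open>The cover need not be compact, so the minimum is found by conjugation: a deck
  transformation \<open>\<psi>\<close> moving \<open>y\<close> into a fixed ball turns the
  displacement of \<open>\<phi>\<close> at \<open>y\<close> into that of a conjugate at
  \<open>\<psi> y\<close>. Conjugates arising from points displaced by at most \<open>T\<close> move
  the base point by at most \<open>2 * R + T\<close>, so they are finitely many, each with
  continuous displacement on a compact ball.\<close>

lemma min_displacement:
  assumes \<phi>: "\<phi> \<in> deck p"
  obtains x where "\<And>y. dist x (\<phi> x) \<le> dist y (\<phi> y)"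
proof -
  define o0 :: 'b where "o0 = undefined"
  obtain R where R: "R \<ge> 0" "\<And>v. \<exists>\<psi>\<in>deck p. dist o0 (\<psi> v) \<le> R" using deck_cocompact[of o0] by blast
  define T where "T = dist o0 (\<phi> o0)"
  define F where "F = {\<omega> \<in> deck p. dist o0 (\<omega> o0) \<le> 2 * R + T \<and> (\<exists>\<psi>\<in>deck p. \<psi> \<circ> \<phi> = \<omega> \<circ> \<psi>)}"
  define M where "M = (\<Union>\<omega>\<in>F. (\<lambda>y. dist y (\<omega> y)) ` cball o0 R)"
  have "finite F" by (rule finite_subset[OF _ finite_deck[of o0 o0 "2 * R + T"]]) (auto simp: F_def)
  then have "compact M" unfolding M_def
  proof (rule compact_UN)
    show "compact ((\<lambda>y. dist y (\<omega> y)) ` cball o0 R)" if "\<omega> \<in> F" for \<omega>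
      using that by (intro compact_continuous_image compact_cball continuous_intros deck_continuous) (auto simp: F_def)
  qed
  have inM: "dist y (\<phi> y) \<in> M" if y: "dist y (\<phi> y) \<le> T" for y
  proof -
    obtain \<psi> where \<psi>: "\<psi> \<in> deck p" "dist o0 (\<psi> y) \<le> R" using R(2) by blast
    obtain \<psi>' where \<psi>': "\<psi>' \<in> deck p" "\<psi>' \<circ> \<psi> = id" "\<psi> \<circ> \<psi>' = id" using deck_inverse[OF \<psi>(1)] by blast
    define \<omega> where "\<omega> = \<psi> \<circ> \<phi> \<circ> \<psi>'"
    have \<omega>: "\<omega> \<in> deck p" using \<psi> \<psi>' \<phi> by (simp add: \<omega>_def deck_comp)
    have c: "\<psi> \<circ> \<phi> = \<omega> \<circ> \<psi>" using \<psi>'(2) by (simp add: \<omega>_def fun_eq_iff)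
    have d: "dist (\<psi> y) (\<omega> (\<psi> y)) = dist y (\<phi> y)"
      using fun_cong[OF c, of y] deck_isometry[OF \<psi>(1), of y "\<phi> y"] by simp
    have "dist o0 (\<omega> o0) \<le> dist o0 (\<psi> y) + dist (\<psi> y) (\<omega> (\<psi> y)) + dist (\<omega> (\<psi> y)) (\<omega> o0)"
      using dist_triangle[of o0 "\<omega> o0" "\<psi> y"] dist_triangle[of "\<psi> y" "\<omega> o0" "\<omega> (\<psi> y)"] by linarith
    also have "\<dots> \<le> 2 * R + T" using \<psi>(2) y d deck_isometry[OF \<omega>, of "\<psi> y" o0] by (simp add: dist_commute)
    finally have "\<omega> \<in> F" using \<omega> c \<psi>(1) by (auto simp: F_def)
    moreover have "\<psi> y \<in> cball o0 R" using \<psi>(2) by simp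
    ultimately show ?thesis unfolding M_def using d by (metis (mono_tags, lifting) UN_iff image_eqI)
  qed
  have "T \<in> M" using inM[of o0] by (simp add: T_def)
  then obtain \<mu> where \<mu>: "\<mu> \<in> M" "\<And>m. m \<in> M \<Longrightarrow> \<mu> \<le> m"
    using compact_attains_inf[OF \<open>compact M\<close>] by blast
  obtain \<omega> y \<psi> where \<omega>: "\<mu> = dist y (\<omega> y)" "\<psi> \<in> deck p" "\<psi> \<circ> \<phi> = \<omega> \<circ> \<psi>"
    using \<mu>(1) unfolding M_def F_def by blast
  obtain \<psi>' where \<psi>': "\<psi>' \<in> deck p" "\<psi> \<circ> \<psi>' = id" using deck_inverse[OF \<omega>(2)] by blast
  have y: "\<psi> (\<psi>' y) = y" using \<psi>'(2) by (metis comp_apply id_apply)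
  have eq: "dist (\<psi>' y) (\<phi> (\<psi>' y)) = \<mu>"
    using deck_isometry[OF \<omega>(2), of "\<psi>' y" "\<phi> (\<psi>' y)"] fun_cong[OF \<omega>(3), of "\<psi>' y"] y \<omega>(1) by simp
  have "\<mu> \<le> dist z (\<phi> z)" for z
    using \<mu>(2)[OF inM, of z] \<mu>(2)[OF \<open>T \<in> M\<close>] by linarith
  then show thesis using that[of "\<psi>' y"] eq by simp
qed

lemma deck_funpow: "\<phi> \<in> deck p \<Longrightarrow> \<phi> ^^ n \<in> deck p"
  by (induction n) (auto simp: deck_id deck_comp)

end

locale no_conjugate_points = length_covering p for p :: "'b::metric_space \<Rightarrow> 'a::metric_space" +
  assumes ug: "unique_geodesics TYPE('b)"
begin

lemma lipschitz_geodesic: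
  assumes "\<And>s t. \<lbrakk>0 \<le> s; s \<le> t; t \<le> L\<rbrakk> \<Longrightarrow> dist (c s) (c t) \<le> t - s" and L: "L = dist (c 0) (c L)"
    and st: "0 \<le> s" "s \<le> t" "t \<le> L"
  shows "dist (c s) (c t) = t - s"
proof -
  have "L \<le> dist (c 0) (c s) + dist (c s) (c t) + dist (c t) (c L)"
    using L dist_triangle[of "c 0" "c L" "c s"] dist_triangle[of "c s" "c L" "c t"] by linarith
  then show ?thesis using assms(1)[of 0 s] assms(1)[of s t] assms(1)[of t L] st by simp
qed

lemma geodesic_onI:
  assumes "0 \<le> L" "\<And>s t. \<lbrakk>0 \<le> s; s \<le> t; t \<le> L\<rbrakk> \<Longrightarrow> dist (c s) (c t) = t - s"
  shows "geodesic_on c L"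
proof -
  have "dist (c s) (c t) = \<bar>s - t\<bar>" if "s \<in> {0..L}" "t \<in> {0..L}" for s t
    using assms(2)[of s t] assms(2)[of t s] that by (cases "s \<le> t") (auto simp: dist_commute)
  then show ?thesis unfolding geodesic_on_def using assms(1) by (metis zero_less_one)
qed

lemma geodesic_unique:
  fixes c1 c2 :: "real \<Rightarrow> 'b"
  assumes "geodesic_on c1 L1" "geodesic_on c2 L2" "c1 0 = c2 0" "c1 L1 = c2 L2"
  shows "L1 = L2 \<and> (\<forall>t\<in>{0..L1}. c1 t = c2 t)"
  using spec[OF spec[OF ug[unfolded unique_geodesics_def], of "c1 0"], of "c1 L1", THEN conjunct2,
      THEN spec[of _ c1], THEN spec[of _ L1], THEN spec[of _ c2], THEN spec[of _ L2], THEN mp] assms by simp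

text \<open>A curve that preserves distances only locally must coincide with the minimizing geodesic
  between its ends, and hence has the same length.\<close>

lemma geodesic_length:
  fixes c :: "real \<Rightarrow> 'b"
  assumes "geodesic_on c L"
  shows "dist (c 0) (c L) = L"
proof -
  obtain m where m: "m 0 = c 0" "m (dist (c 0) (c L)) = c L"
    "\<And>s t. \<lbrakk>s \<in> {0..dist (c 0) (c L)}; t \<in> {0..dist (c 0) (c L)}\<rbrakk> \<Longrightarrow> dist (m s) (m t) = \<bar>s - t\<bar>"
    using geodesic_exists by blast
  have "geodesic_on m (dist (c 0) (c L))" using m(3) by (intro geodesic_onI) auto
  from geodesic_unique[OF assms this m(1)[symmetric] m(2)[symmetric]] show ?thesis by (rule conjunct1[THEN sym])
qed

text \<open>Shortest paths from \<open>u\<close> to \<open>w\<close> and from \<open>w\<close> to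
  \<open>v\<close> join to a geodesic because \<open>w\<close> is metrically between. Two such
  points at equal distance from \<open>u\<close> lie on the same geodesic at the same
  parameter.\<close>

lemma between_unique:
  fixes u v w w' :: 'b
  assumes w: "dist u w + dist w v = dist u v" and w': "dist u w' + dist w' v = dist u v"
    and eq: "dist u w = dist u w'"
  shows "w = w'"
proof -
  define L where "L = dist u v"
  define a where "a = dist u w"
  have conc: "\<exists>c. geodesic_on c L \<and> c 0 = u \<and> c L = v \<and> c a = z"
    if z: "dist u z + dist z v = L" "dist u z = a" for z
  proof -
    obtain c1 where c1: "c1 0 = u" "c1 a = z" "\<And>s t. \<lbrakk>s \<in> {0..a}; t \<in> {0..a}\<rbrakk> \<Longrightarrow> dist (c1 s) (c1 t) = \<bar>s - t\<bar>"
      using geodesic_exists[of u z] z(2) by metis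
    obtain c2 where c2: "c2 0 = z" "c2 (L - a) = v" "\<And>s t. \<lbrakk>s \<in> {0..L - a}; t \<in> {0..L - a}\<rbrakk> \<Longrightarrow> dist (c2 s) (c2 t) = \<bar>s - t\<bar>"
      using geodesic_exists[of z v] z by (metis add_diff_cancel_left')
    define c where "c = (\<lambda>t. if t \<le> a then c1 t else c2 (t - a))"
    have a: "0 \<le> a" "a \<le> L" using z(1)[symmetric] z(2) by (auto simp: a_def)
    have c0: "c 0 = u" "c a = z" using c1 a by (auto simp: c_def)
    have cL: "c L = v"
    proof (cases "L \<le> a")
      case True
      then have "L = a" using a by simp
      then show ?thesis using c0 c2 by simp
    qed (use c2 in \<open>simp add: c_def\<close>)
    have ca: "c t = c2 (t - a)" if "a \<le> t" for t using that c0 c2 by (cases "t = a") (auto simp: c_def)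
    have lip: "dist (c s) (c t) \<le> t - s" if st: "0 \<le> s" "s \<le> t" "t \<le> L" for s t
    proof -
      consider "t \<le> a" | "a \<le> s" | "s \<le> a" "a \<le> t" by linarith
      then show ?thesis
      proof cases
        case 1 then show ?thesis using st c1(3)[of s t] by (simp add: c_def)
      next
        case 2 then show ?thesis using st c2(3)[of "s - a" "t - a"] by (simp add: ca)
      next
        case 3
        have "dist (c s) (c a) = a - s" using 3 st c1(3)[of s a] by (simp add: c_def)
        moreover have "dist (c a) (c t) = t - a" using 3 st c2(3)[of 0 "t - a"] by (simp add: ca)
        ultimately show ?thesis using dist_triangle[of "c s" "c t" "c a"] by simp
      qed
    qed
    have "geodesic_on c L"
      using a lip c0 cL by (intro geodesic_onI lipschitz_geodesic[of L c]) (auto simp: L_def)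
    then show ?thesis using c0 cL by blast
  qed
  obtain c where c: "geodesic_on c L" "c 0 = u" "c L = v" "c a = w"
    using conc[OF w[folded L_def] a_def[symmetric]] by blast
  obtain c' where c': "geodesic_on c' L" "c' 0 = u" "c' L = v" "c' a = w'"
    using conc[OF w'[folded L_def] eq[symmetric, folded a_def]] by blast
  have "a \<in> {0..L}"
    using w zero_le_dist[of w v] zero_le_dist[of u w] unfolding a_def L_def atLeastAtMost_iff by linarith
  then show ?thesis using geodesic_unique[OF c(1) c'(1)] c(2-4) c'(2-4) by metis
qed

text \<open>At a point of minimal displacement the translates of a geodesic from \<open>x\<close> to \<open>\<phi> x\<close> fit
  together to a local geodesic, which by uniqueness of geodesics is minimizing.\<close>

lemma deck_axis:
  assumes \<phi>: "\<phi> \<in> deck p" and min: "\<And>y. dist x (\<phi> x) \<le> dist y (\<phi> y)"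
  shows "dist x ((\<phi> ^^ n) x) = real n * dist x (\<phi> x)"
proof (cases "\<phi> x = x")
  case True
  then have "(\<phi> ^^ n) x = x" by (induction n) auto
  then show ?thesis using True by simp
next
  case False
  define L where "L = dist x (\<phi> x)"
  have L: "L > 0" using False by (simp add: L_def)
  obtain c where c: "c 0 = x" "c L = \<phi> x" "\<And>s t. \<lbrakk>s \<in> {0..L}; t \<in> {0..L}\<rbrakk> \<Longrightarrow> dist (c s) (c t) = \<bar>s - t\<bar>"
    using geodesic_exists[of x "\<phi> x"] unfolding L_def by blast
  define l where "l = (\<lambda>t. (\<phi> ^^ nat \<lfloor>t / L\<rfloor>) (c (t - real_of_int \<lfloor>t / L\<rfloor> * L)))"
  \<comment> \<open>The \<open>k\<close>-th stretch of the curve is the translate of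
    \<open>c\<close> by the \<open>k\<close>-th power. The formula includes \<open>s = L\<close>
    because \<open>\<phi>\<close> carries the start of \<open>c\<close> to its end, so neighbouring
    translates agree at the corner.\<close>
  have piece: "l (real k * L + s) = (\<phi> ^^ k) (c s)" if s: "0 \<le> s" "s \<le> L" for k s
  proof (cases "s = L")
    case True
    have "(real k * L + s) / L = real (Suc k)" using True L by (simp add: field_simps)
    then have "\<lfloor>(real k * L + s) / L\<rfloor> = int (Suc k)" by (metis floor_of_nat)
    then have "l (real k * L + s) = (\<phi> ^^ nat (int (Suc k))) (c (real k * L + s - real_of_int (int (Suc k)) * L))"
      by (simp only: l_def)
    then have "l (real k * L + s) = (\<phi> ^^ Suc k) (c (real k * L + s - real (Suc k) * L))" by (simp only: nat_int of_int_of_nat_eq)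
    also have "real k * L + s - real (Suc k) * L = 0" using True by (simp add: algebra_simps)
    finally show ?thesis using True c by (simp add: funpow_swap1)
  next
    case False
    have "(real k * L + s) / L = real k + s / L" using L by (simp add: field_simps)
    moreover have "0 \<le> s / L" "s / L < 1" using s False L by (auto simp: field_simps)
    ultimately have "\<lfloor>(real k * L + s) / L\<rfloor> = int k" by (simp add: floor_eq_iff)
    then show ?thesis by (simp add: l_def)
  qed
  have split: "\<exists>k s. t = real k * L + s \<and> 0 \<le> s \<and> s < L" if "t \<ge> 0" for t
  proof -
    define k where "k = nat \<lfloor>t / L\<rfloor>"
    have "real k = of_int \<lfloor>t / L\<rfloor>" using that L by (simp add: k_def)
    then have "real k \<le> t / L" "t / L < real k + 1" by linarith+
    then show ?thesis using L by (intro exI[of _ k] exI[of _ "t - real k * L"]) (simp add: field_simps)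
  qed
  have iso: "dist ((\<phi> ^^ k) y) ((\<phi> ^^ k) z) = dist y z" for k y z using deck_isometry[OF deck_funpow[OF \<phi>]] .
  have lip: "dist (l s) (l t) \<le> t - s" if st: "0 \<le> s" "s \<le> t" "t \<le> s + L" for s t
  proof -
    obtain k a where k: "s = real k * L + a" "0 \<le> a" "a < L" using split[OF st(1)] by blast
    define b where "b = t - real k * L"
    have b: "t = real k * L + b" "a \<le> b" "b \<le> a + L" using k st by (auto simp: b_def)
    show ?thesis
    proof (cases "b \<le> L")
      case True
      then have "dist (l s) (l t) = dist (c a) (c b)" using piece[of a k] piece[of b k] k b iso by simp
      then show ?thesis using c(3)[of a b] k b True by simp
    next
      case False
      have eqt: "t = real (Suc k) * L + (b - L)" using b by (simp add: algebra_simps)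
      have 1: "dist (l s) ((\<phi> ^^ k) (c L)) = L - a" using piece[of a k] k iso c(3)[of a L] by simp
      have 2: "l t = (\<phi> ^^ Suc k) (c (b - L))" unfolding eqt using False b k by (intro piece) auto
      have 3: "(\<phi> ^^ k) (c L) = (\<phi> ^^ Suc k) (c 0)" using c by (simp add: funpow_swap1)
      have "dist ((\<phi> ^^ k) (c L)) (l t) = b - L"
        unfolding 2 3 iso using c(3)[of 0 "b - L"] False b k by simp
      then show ?thesis using 1 dist_triangle[of "l s" "l t" "(\<phi> ^^ k) (c L)"] b k by simp
    qed
  qed
  \<comment> \<open>Up to an isometry, points \<open>L\<close> apart on the curve are a point and
    its image under \<open>\<phi>\<close>, so minimality of the displacement forbids shortcuts
    across corners. A 1-Lipschitz curve with ends that far apart is isometric in between.\<close>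
  have far: "dist (l s) (l (s + L)) \<ge> L" if s0: "s \<ge> 0" for s
  proof -
    obtain k a where k: "s = real k * L + a" "0 \<le> a" "a < L" using split[OF s0] by blast
    have "s + L = real (Suc k) * L + a" using k by (simp add: algebra_simps)
    then have "l (s + L) = (\<phi> ^^ Suc k) (c a)" using piece[of a "Suc k"] k(2,3) by (simp only: less_imp_le)
    moreover have "l s = (\<phi> ^^ k) (c a)" using piece[of a k] k by simp
    ultimately have "dist (l s) (l (s + L)) = dist (c a) (\<phi> (c a))" using iso by (simp add: funpow_swap1)
    then show ?thesis using min[of "c a"] by (simp add: L_def)
  qed
  have eq: "dist (l s) (l t) = t - s" if st: "0 \<le> s" "s \<le> t" "t \<le> s + L" for s t
    using lip[OF st] lip[of t "s + L"] far[OF st(1)] dist_triangle[of "l s" "l (s + L)" "l t"] st by linarith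
  have "geodesic_on l (real n * L)"
    unfolding geodesic_on_def
  proof (intro conjI ballI)
    fix t assume "t \<in> {0..real n * L}"
    have "dist (l s) (l s') = \<bar>s - s'\<bar>" if "s \<in> {0..real n * L}" "s' \<in> {0..real n * L}" "\<bar>s - t\<bar> < L / 2 \<and> \<bar>s' - t\<bar> < L / 2" for s s'
    proof -
      have "s' \<le> s + L" "s \<le> s' + L" using that(3) by linarith+
      then show ?thesis using eq[of s s'] eq[of s' s] that(1,2) by (cases "s \<le> s'") (auto simp: dist_commute)
    qed
    then show "\<exists>e>0. \<forall>s\<in>{0..real n * L}. \<forall>s'\<in>{0..real n * L}. \<bar>s - t\<bar> < e \<and> \<bar>s' - t\<bar> < e \<longrightarrow> dist (l s) (l s') = \<bar>s - s'\<bar>"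
      using L by (intro exI[of _ "L / 2"]) auto
  qed (use L in simp)
  then have "dist (l 0) (l (real n * L)) = real n * L" by (rule geodesic_length)
  moreover have "l 0 = x" using piece[of 0 0] L c by simp
  moreover have "l (real n * L) = (\<phi> ^^ n) x" using piece[of 0 n] L c by simp
  ultimately show ?thesis by (simp add: L_def)
qed

lemma stable_displacement:
  assumes "\<phi> \<in> deck p"
  obtains x where "\<And>n y. \<bar>dist y ((\<phi> ^^ n) y) - real n * dist x (\<phi> x)\<bar> \<le> 2 * dist x y"
proof -
  obtain x where x: "\<And>y. dist x (\<phi> x) \<le> dist y (\<phi> y)" using min_displacement[OF assms] by blast
  have "\<bar>dist y ((\<phi> ^^ n) y) - real n * dist x (\<phi> x)\<bar> \<le> 2 * dist x y" for n y
  proof -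
    have "dist ((\<phi> ^^ n) x) ((\<phi> ^^ n) y) = dist x y" using deck_isometry[OF deck_funpow[OF assms]] .
    moreover have "\<bar>dist y ((\<phi> ^^ n) y) - dist x ((\<phi> ^^ n) x)\<bar> \<le> dist x y + dist ((\<phi> ^^ n) x) ((\<phi> ^^ n) y)"
      using dist_triangle[of x "(\<phi> ^^ n) x" y] dist_triangle[of y "(\<phi> ^^ n) x" "(\<phi> ^^ n) y"]
        dist_triangle[of y "(\<phi> ^^ n) y" x] dist_triangle[of x "(\<phi> ^^ n) y" "(\<phi> ^^ n) x"]
        dist_commute[of x y] dist_commute[of "(\<phi> ^^ n) x" "(\<phi> ^^ n) y"] by linarith
    ultimately show ?thesis using deck_axis[OF assms x, of n] by simp
  qed
  then show thesis using that by blast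
qed

end

section \<open>Deck transformations as elements of the fundamental group\<close>

lemma path_class_eq_iff: "path g \<Longrightarrow> path_class g = path_class h \<longleftrightarrow> homotopic_paths UNIV g h"
proof
  assume g: "path g" and eq: "path_class g = path_class h"
  have "g \<in> path_class g" using g by (simp add: path_class_def)
  then have "g \<in> path_class h" by (simp only: eq)
  then show "homotopic_paths UNIV g h" by (simp add: path_class_def homotopic_paths_sym)
next
  assume "homotopic_paths UNIV g h"
  then show "path_class g = path_class h" unfolding path_class_def
    by (auto intro: homotopic_paths_trans homotopic_paths_sym)
qed

text \<open>The product is defined through representatives picked by choice; joins of homotopic
  loops are homotopic, so any representatives serve.\<close>

lemma fundamental_group_mult:
  assumes "g \<in> loops_at x0" "h \<in> loops_at x0"
  shows "path_class g \<otimes>\<^bsub>fundamental_group x0\<^esub> path_class h = path_class (g +++ h)"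
proof -
  have g: "path g" "pathstart g = x0" "pathfinish g = x0" and h: "path h" "pathstart h = x0" "pathfinish h = x0"
    using assms by (auto simp: loops_at_def)
  have s: "homotopic_paths UNIV f (SOME a. a \<in> path_class f)" if "path f" for f :: "real \<Rightarrow> 'a"
  proof -
    have "f \<in> path_class f" using that by (simp add: path_class_def)
    then have "(SOME a. a \<in> path_class f) \<in> path_class f" by (rule someI[where P = "\<lambda>a. a \<in> path_class f"])
    then show ?thesis by (simp add: path_class_def)
  qed
  have "homotopic_paths UNIV (g +++ h) ((SOME a. a \<in> path_class g) +++ (SOME a. a \<in> path_class h))"
    using g h by (intro homotopic_paths_join s) auto
  moreover have "path (g +++ h)" using g h by (intro path_join_imp) auto
  ultimately have "path_class (g +++ h) = path_class ((SOME a. a \<in> path_class g) +++ (SOME a. a \<in> path_class h))"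
    using path_class_eq_iff by blast
  then show ?thesis by (simp add: fundamental_group_def)
qed

context length_covering
begin

definition deck_class :: "'b \<Rightarrow> ('b \<Rightarrow> 'b) \<Rightarrow> (real \<Rightarrow> 'a) set" where
  "deck_class o0 \<phi> = path_class (p \<circ> (SOME h. path h \<and> pathstart h = o0 \<and> pathfinish h = \<phi> o0))"

lemma ex_path: "\<exists>h. path h \<and> pathstart h = u \<and> pathfinish h = (v::'b)"
  using path_connected_cover by (simp add: path_connected_def)

text \<open>The cover is simply connected, so all paths from \<open>o0\<close> to
  \<open>\<phi> o0\<close> have homotopic projections.\<close>

lemma deck_class_eq:
  assumes "path h" "pathstart h = o0" "pathfinish h = \<phi> o0"
  shows "deck_class o0 \<phi> = path_class (p \<circ> h)"
proof -
  define h' where "h' = (SOME h. path h \<and> pathstart h = o0 \<and> pathfinish h = \<phi> o0)"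
  have h': "path h' \<and> pathstart h' = o0 \<and> pathfinish h' = \<phi> o0"
    unfolding h'_def by (rule someI_ex[OF ex_path])
  have "homotopic_paths UNIV h' h" using h' assms by (intro simply_connected_homotopic_paths[OF sc]) auto
  then have "homotopic_paths UNIV (p \<circ> h') (p \<circ> h)"
    by (rule homotopic_paths_continuous_image) (auto simp: continuous_p)
  then show ?thesis unfolding deck_class_def h'_def[symmetric]
    using homotopic_paths_imp_path path_class_eq_iff by blast
qed

lemma loop_proj:
  assumes "\<phi> \<in> deck p" "path h" "pathstart h = o0" "pathfinish h = \<phi> o0"
  shows "p \<circ> h \<in> loops_at (p o0)"
  using assms by (auto simp: loops_at_def path_continuous_image continuous_p pathstart_compose pathfinish_compose deck_proj)

text \<open>A path to \<open>\<phi> (\<psi> o0)\<close> is a path to \<open>\<phi> o0\<close>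
  followed by the \<open>\<phi>\<close>-translate of a path to \<open>\<psi> o0\<close>. The
  translate has the same projection, so the order of the factors is preserved.\<close>

lemma deck_class_mult:
  assumes \<phi>: "\<phi> \<in> deck p" and \<psi>: "\<psi> \<in> deck p"
  shows "deck_class o0 (\<phi> \<circ> \<psi>) = deck_class o0 \<phi> \<otimes>\<^bsub>fundamental_group (p o0)\<^esub> deck_class o0 \<psi>"
proof -
  obtain h where h: "path h" "pathstart h = o0" "pathfinish h = \<phi> o0" using ex_path by metis
  obtain k where k: "path k" "pathstart k = o0" "pathfinish k = \<psi> o0" using ex_path by metis
  have pk: "path (\<phi> \<circ> k)" using k(1) deck_continuous[OF \<phi>] by (intro path_continuous_image)
  have "deck_class o0 (\<phi> \<circ> \<psi>) = path_class (p \<circ> (h +++ (\<phi> \<circ> k)))"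
    using h k pk by (intro deck_class_eq path_join_imp) (auto simp: pathstart_compose pathfinish_compose)
  also have "p \<circ> (h +++ (\<phi> \<circ> k)) = (p \<circ> h) +++ (p \<circ> k)"
    using deck_proj[OF \<phi>] by (auto simp: joinpaths_def fun_eq_iff)
  also have "path_class \<dots> = path_class (p \<circ> h) \<otimes>\<^bsub>fundamental_group (p o0)\<^esub> path_class (p \<circ> k)"
    using fundamental_group_mult[OF loop_proj[OF \<phi> h] loop_proj[OF \<psi> k]] by simp
  finally show ?thesis using deck_class_eq[of h o0 \<phi>] deck_class_eq[of k o0 \<psi>] h k by (simp only:)
qed

lemma deck_class_id: "deck_class o0 id = \<one>\<^bsub>fundamental_group (p o0)\<^esub>"
proof -
  have "path (\<lambda>_::real. o0)" by (simp add: path_def)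
  then have "deck_class o0 id = path_class (p \<circ> (\<lambda>_. o0))"
    by (intro deck_class_eq) (auto simp: pathstart_def pathfinish_def)
  then show ?thesis by (simp add: fundamental_group_def o_def)
qed

text \<open>Injectivity is monodromy, since a deck transformation is determined by one value;
  surjectivity lifts a loop and uses transitivity on the fibre.\<close>

lemma deck_class_bij: "bij_betw (deck_class o0) (deck p) (carrier (fundamental_group (p o0)))"
  unfolding bij_betw_def
proof
  show "inj_on (deck_class o0) (deck p)"
  proof (rule inj_onI)
    fix \<phi> \<psi> assume \<phi>: "\<phi> \<in> deck p" and \<psi>: "\<psi> \<in> deck p" and eq: "deck_class o0 \<phi> = deck_class o0 \<psi>"
    obtain h where h: "path h" "pathstart h = o0" "pathfinish h = \<phi> o0" using ex_path by metis
    obtain k where k: "path k" "pathstart k = o0" "pathfinish k = \<psi> o0" using ex_path by metis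
    have "path (p \<circ> h)" using h(1) continuous_p by (intro path_continuous_image)
    then have "homotopic_paths UNIV (p \<circ> h) (p \<circ> k)"
      using eq deck_class_eq[of h o0 \<phi>] deck_class_eq[of k o0 \<psi>] h k path_class_eq_iff by metis
    then have "pathfinish h = pathfinish k"
      by (rule metric_covering_monodromy[OF cov _ h(1) _ k(1)]) (use h k in auto)
    then show "\<phi> = \<psi>" using deck_unique[OF \<phi> \<psi>] h k by metis
  qed
  show "deck_class o0 ` deck p = carrier (fundamental_group (p o0))"
  proof
    show "deck_class o0 ` deck p \<subseteq> carrier (fundamental_group (p o0))"
    proof (rule image_subsetI)
      fix \<phi> assume \<phi>: "\<phi> \<in> deck p"
      obtain h where h: "path h" "pathstart h = o0" "pathfinish h = \<phi> o0" using ex_path by metis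
      show "deck_class o0 \<phi> \<in> carrier (fundamental_group (p o0))"
        using deck_class_eq[of h o0 \<phi>] h loop_proj[OF \<phi> h] by (auto simp: fundamental_group_def)
    qed
    show "carrier (fundamental_group (p o0)) \<subseteq> deck_class o0 ` deck p"
    proof
      fix A assume "A \<in> carrier (fundamental_group (p o0))"
      then obtain g where g: "A = path_class g" "path g" "pathstart g = p o0" "pathfinish g = p o0"
        by (auto simp: fundamental_group_def loops_at_def)
      obtain h where h: "path h" "pathstart h = o0" "\<And>t. t \<in> {0..1} \<Longrightarrow> p (h t) = g t"
        using metric_covering_lift_path[OF cov g(2,3)] by blast
      have "p o0 = p (pathfinish h)" using h(3)[of 1] g(4) by (simp add: pathfinish_def)
      then obtain \<phi> where \<phi>: "\<phi> \<in> deck p" "\<phi> o0 = pathfinish h" using deck_transitive by blast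
      have "deck_class o0 \<phi> = path_class (p \<circ> h)" using h \<phi> by (intro deck_class_eq) auto
      also have "\<dots> = path_class g"
      proof -
        have "path (p \<circ> h)" using h(1) continuous_p by (intro path_continuous_image)
        moreover from this have "homotopic_paths UNIV (p \<circ> h) g" using h(3) by (intro homotopic_paths_eq) auto
        ultimately show ?thesis by (simp add: path_class_eq_iff)
      qed
      finally show "A \<in> deck_class o0 ` deck p" using g \<phi> by blast
    qed
  qed
qed

text \<open>The action is the inverse of \<open>deck_class\<close>. The group axioms are carried
  over from composition of deck transformations, so associativity and inverses are obtained without
  manipulating homotopies of loops.\<close>

lemma fundamental_group_action:
  fixes x0 :: 'a
  obtains act where "group (fundamental_group x0)"
    "\<And>g. g \<in> carrier (fundamental_group x0) \<Longrightarrow> act g \<in> deck p"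
    "\<And>g h. \<lbrakk>g \<in> carrier (fundamental_group x0); h \<in> carrier (fundamental_group x0)\<rbrakk> \<Longrightarrow>
       act (g \<otimes>\<^bsub>fundamental_group x0\<^esub> h) = act g \<circ> act h"
    "inj_on act (carrier (fundamental_group x0))" "act \<one>\<^bsub>fundamental_group x0\<^esub> = id"
proof -
  obtain o0 where o0: "p o0 = x0" using cov covering_space_imp_surjective by (metis UNIV_I imageE)
  let ?G = "fundamental_group x0"
  define f where "f = deck_class o0"
  have bij: "bij_betw f (deck p) (carrier ?G)" using deck_class_bij[of o0] by (simp add: f_def o0)
  have mult: "f (\<phi> \<circ> \<psi>) = f \<phi> \<otimes>\<^bsub>?G\<^esub> f \<psi>" if "\<phi> \<in> deck p" "\<psi> \<in> deck p" for \<phi> \<psi>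
    using deck_class_mult[OF that, of o0] by (simp add: f_def o0)
  have one: "f id = \<one>\<^bsub>?G\<^esub>" using deck_class_id[of o0] by (simp add: f_def o0)
  define act where "act = inv_into (deck p) f"
  have act: "act g \<in> deck p" "f (act g) = g" if "g \<in> carrier ?G" for g
    using bij that by (auto simp: act_def bij_betw_def inv_into_into f_inv_into_f)
  have actf: "act (f \<phi>) = \<phi>" if "\<phi> \<in> deck p" for \<phi> using bij that by (simp add: act_def bij_betw_def)
  have fc: "f \<phi> \<in> carrier ?G" if "\<phi> \<in> deck p" for \<phi> using bij that by (auto simp: bij_betw_def)
  have mult': "g \<otimes>\<^bsub>?G\<^esub> h = f (act g \<circ> act h)" if "g \<in> carrier ?G" "h \<in> carrier ?G" for g h
    using mult[OF act(1)[OF that(1)] act(1)[OF that(2)]] act(2)[OF that(1)] act(2)[OF that(2)] by simp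
  have "group ?G"
  proof (rule groupI)
    show "x \<otimes>\<^bsub>?G\<^esub> y \<in> carrier ?G" if "x \<in> carrier ?G" "y \<in> carrier ?G" for x y
      using that by (simp add: mult' act fc deck_comp)
    show "\<one>\<^bsub>?G\<^esub> \<in> carrier ?G" using fc[OF deck_id] one by simp
    show "x \<otimes>\<^bsub>?G\<^esub> y \<otimes>\<^bsub>?G\<^esub> z = x \<otimes>\<^bsub>?G\<^esub> (y \<otimes>\<^bsub>?G\<^esub> z)" if "x \<in> carrier ?G" "y \<in> carrier ?G" "z \<in> carrier ?G" for x y z
      using that by (simp add: mult' act fc deck_comp actf o_assoc)
    show "\<one>\<^bsub>?G\<^esub> \<otimes>\<^bsub>?G\<^esub> x = x" if "x \<in> carrier ?G" for x
      using mult[OF deck_id act(1)[OF that]] act(2)[OF that] one by simp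
    show "\<exists>y\<in>carrier ?G. y \<otimes>\<^bsub>?G\<^esub> x = \<one>\<^bsub>?G\<^esub>" if x: "x \<in> carrier ?G" for x
    proof -
      obtain \<psi> where \<psi>: "\<psi> \<in> deck p" "\<psi> \<circ> act x = id" using deck_inverse[OF act(1)[OF x]] by blast
      have "f \<psi> \<otimes>\<^bsub>?G\<^esub> x = \<one>\<^bsub>?G\<^esub>" using mult[OF \<psi>(1) act(1)[OF x]] act(2)[OF x] \<psi>(2) one by simp
      then show ?thesis using fc[OF \<psi>(1)] by blast
    qed
  qed
  moreover have "act (g \<otimes>\<^bsub>?G\<^esub> h) = act g \<circ> act h" if "g \<in> carrier ?G" "h \<in> carrier ?G" for g h
    using mult'[OF that] actf[OF deck_comp] act that by simp
  moreover have "inj_on act (carrier ?G)" by (rule inj_onI) (metis act(2))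
  moreover have "act \<one>\<^bsub>?G\<^esub> = id" using actf[OF deck_id] one by simp
  ultimately show thesis using that act(1) by blast
qed

end

section \<open>Finite rank\<close>

context no_conjugate_points
begin

text \<open>The point dividing the geodesic from \<open>u\<close> to \<open>v\<close> in the
  proportion \<open>t\<close>, described by two distances so that limits of such points can be
  recognized without limits of curves.\<close>

definition seg :: "'b \<Rightarrow> 'b \<Rightarrow> real \<Rightarrow> 'b" where
  "seg u v t = (THE w. dist u w = t * dist u v \<and> dist w v = (1 - t) * dist u v)"

lemma seg_eqI:
  assumes "dist u w = t * dist u v" "dist w v = (1 - t) * dist u v"
  shows "seg u v t = w"
  unfolding seg_def
proof (rule the_equality)
  fix w' assume w': "dist u w' = t * dist u v \<and> dist w' v = (1 - t) * dist u v"
  show "w' = w"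
  proof (rule between_unique[of u _ v])
    show "dist u w' + dist w' v = dist u v" using w' by (simp add: algebra_simps)
    show "dist u w + dist w v = dist u v" using assms by (simp add: algebra_simps)
    show "dist u w' = dist u w" using assms(1) w' by simp
  qed
qed (use assms in simp)

lemma seg_dist:
  assumes "s \<in> {0..1}" "t \<in> {0..1}"
  shows "dist (seg u v s) (seg u v t) = \<bar>s - t\<bar> * dist u v"
proof -
  obtain c where c: "c 0 = u" "c (dist u v) = v"
    "\<And>s t. \<lbrakk>s \<in> {0..dist u v}; t \<in> {0..dist u v}\<rbrakk> \<Longrightarrow> dist (c s) (c t) = \<bar>s - t\<bar>"
    using geodesic_exists by blast
  have in_d: "t * dist u v \<in> {0..dist u v}" if "t \<in> {0..1}" for t
    using that by (auto simp: mult_left_le_one_le)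
  have eq: "seg u v t = c (t * dist u v)" if t: "t \<in> {0..1}" for t
  proof (rule seg_eqI)
    have z: "0 \<in> {0..dist u v}" "dist u v \<in> {0..dist u v}" by auto
    show "dist u (c (t * dist u v)) = t * dist u v" using c(3)[OF z(1) in_d[OF t]] c(1) t by simp
    show "dist (c (t * dist u v)) v = (1 - t) * dist u v"
      using c(3)[OF in_d[OF t] z(2)] c(2) in_d[OF t] by (simp add: algebra_simps)
  qed
  have "dist (seg u v s) (seg u v t) = \<bar>s * dist u v - t * dist u v\<bar>"
    unfolding eq[OF assms(1)] eq[OF assms(2)] by (intro c(3) in_d assms)
  also have "\<dots> = \<bar>s - t\<bar> * dist u v" by (simp add: abs_mult flip: left_diff_distrib)
  finally show ?thesis .
qed

lemma seg_0 [simp]: "seg u v 0 = u" and seg_1 [simp]: "seg u v 1 = v"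
  by (rule seg_eqI; simp)+

lemma dist_seg_left: "t \<in> {0..1} \<Longrightarrow> dist u (seg u v t) = t * dist u v"
  using seg_dist[of 0 t u v] by simp

lemma dist_seg_right: "t \<in> {0..1} \<Longrightarrow> dist (seg u v t) v = (1 - t) * dist u v"
  using seg_dist[of t 1 u v] by simp

text \<open>A sequence of counterexamples has a limit by compactness of balls. Both sequences of
  segment points converge to points satisfying the two distance equations for the limiting data, and
  these equations determine the point.\<close>

lemma seg_uniformly_continuous:
  fixes o0 :: 'b
  assumes e: "e > 0"
  shows "\<exists>d>0. \<forall>u u' v v' t. u \<in> cball o0 R \<and> u' \<in> cball o0 R \<and> v \<in> cball o0 R \<and> v' \<in> cball o0 R \<and>
    t \<in> {0..1} \<and> dist u u' < d \<and> dist v v' < d \<longrightarrow> dist (seg u v t) (seg u' v' t) < e"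
proof (rule ccontr)
  assume neg: "\<not> ?thesis"
  define P where "P = (\<lambda>(d::real) (u, u', v, v', t). u \<in> cball o0 R \<and> u' \<in> cball o0 R \<and> v \<in> cball o0 R \<and>
     v' \<in> cball o0 R \<and> t \<in> {0..1} \<and> dist u u' < d \<and> dist v v' < d \<and> e \<le> dist (seg u v t) (seg u' v' t))"
  have "\<exists>z. P (1 / real (Suc n)) z" for n
  proof -
    have "(1 / real (Suc n)) > 0" by simp
    then show ?thesis using neg unfolding P_def split_paired_Ex split_conv not_less[symmetric] by blast
  qed
  then obtain z where z: "\<And>n. P (1 / real (Suc n)) (z n)" by metis
  define u where "u = (\<lambda>n. fst (z n))"
  define u' where "u' = (\<lambda>n. fst (snd (z n)))"
  define v where "v = (\<lambda>n. fst (snd (snd (z n))))"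
  define v' where "v' = (\<lambda>n. fst (snd (snd (snd (z n)))))"
  define t where "t = (\<lambda>n. snd (snd (snd (snd (z n)))))"
  have zn: "u n \<in> cball o0 R" "u' n \<in> cball o0 R" "v n \<in> cball o0 R" "v' n \<in> cball o0 R" "t n \<in> {0..1}"
      "dist (u n) (u' n) < 1 / real (Suc n)" "dist (v n) (v' n) < 1 / real (Suc n)"
      "e \<le> dist (seg (u n) (v n) (t n)) (seg (u' n) (v' n) (t n))" for n
    using z[of n] by (auto simp: P_def u_def u'_def v_def v'_def t_def split: prod.splits)
  have segb: "seg x y s \<in> cball o0 (3 * R)" if "x \<in> cball o0 R" "y \<in> cball o0 R" "s \<in> {0..1}" for x y s
  proof -
    have "dist x (seg x y s) \<le> dist x y" using dist_seg_left[OF that(3), of x y] that(3) by (simp add: mult_left_le_one_le)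
    moreover have "dist x y \<le> dist o0 x + dist o0 y" using dist_triangle[of x y o0] by (simp add: dist_commute)
    ultimately show ?thesis using dist_triangle[of o0 "seg x y s" x] that(1,2) by simp
  qed
  \<comment> \<open>Points of a segment are at most \<open>2 * R\<close> from its first end, which
    explains the radius \<open>3 * R\<close>.\<close>
  define K where "K = cball o0 R \<times> cball o0 R \<times> {0..1::real} \<times> cball o0 (3 * R) \<times> cball o0 (3 * R)"
  have "compact K" unfolding K_def by (intro compact_Times compact_cball compact_Icc)
  define q where "q = (\<lambda>n. (u n, v n, t n, seg (u n) (v n) (t n), seg (u' n) (v' n) (t n)))"
  have "q n \<in> K" for n using zn(1-5)[of n] segb by (auto simp: q_def K_def)
  then obtain l s where s: "strict_mono s" "(q \<circ> s) \<longlonglongrightarrow> l"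
    using \<open>compact K\<close> unfolding compact_eq_seq_compact_metric seq_compact_def by metis
  obtain x y \<tau> w w' where l: "l = (x, y, \<tau>, w, w')" by (metis prod.collapse)
  have lim: "(\<lambda>n. u (s n)) \<longlonglongrightarrow> x" "(\<lambda>n. v (s n)) \<longlonglongrightarrow> y" "(\<lambda>n. t (s n)) \<longlonglongrightarrow> \<tau>"
     "(\<lambda>n. seg (u (s n)) (v (s n)) (t (s n))) \<longlonglongrightarrow> w" "(\<lambda>n. seg (u' (s n)) (v' (s n)) (t (s n))) \<longlonglongrightarrow> w'"
    using tendsto_fst[OF s(2)] tendsto_fst[OF tendsto_snd[OF s(2)]] tendsto_fst[OF tendsto_snd[OF tendsto_snd[OF s(2)]]]
      tendsto_fst[OF tendsto_snd[OF tendsto_snd[OF tendsto_snd[OF s(2)]]]]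
      tendsto_snd[OF tendsto_snd[OF tendsto_snd[OF tendsto_snd[OF s(2)]]]] by (simp_all add: q_def l o_def)
  have sn: "(\<lambda>n. 1 / real (Suc (s n))) \<longlonglongrightarrow> 0"
    using LIMSEQ_subseq_LIMSEQ[OF LIMSEQ_inverse_real_of_nat s(1)] by (simp add: o_def inverse_eq_divide)
  have close: "(\<lambda>n. g' (s n)) \<longlonglongrightarrow> a" if "(\<lambda>n. g (s n)) \<longlonglongrightarrow> a" "\<And>n. dist (g n) (g' n) < 1 / real (Suc n)" for g g' :: "nat \<Rightarrow> 'b" and a
  proof -
    have "(\<lambda>n. dist (g (s n)) (g' (s n))) \<longlonglongrightarrow> 0"
      by (rule tendsto_sandwich[OF _ _ tendsto_const sn]) (simp_all add: less_imp_le[OF that(2)] del: of_nat_Suc)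
    then have "(\<lambda>n. dist (g (s n)) (g' (s n)) + dist (g (s n)) a) \<longlonglongrightarrow> 0 + 0"
      using that(1) unfolding tendsto_dist_iff[of "\<lambda>n. g (s n)"] by (rule tendsto_add)
    then have sum: "(\<lambda>n. dist (g (s n)) (g' (s n)) + dist (g (s n)) a) \<longlonglongrightarrow> 0" by simp
    show ?thesis unfolding tendsto_dist_iff[of "\<lambda>n. g' (s n)"]
      by (rule tendsto_sandwich[OF _ _ tendsto_const sum]) (auto intro!: always_eventually dist_triangle3)
  qed
  have lim': "(\<lambda>n. u' (s n)) \<longlonglongrightarrow> x" "(\<lambda>n. v' (s n)) \<longlonglongrightarrow> y"
    using close[OF lim(1) zn(6)] close[OF lim(2) zn(7)] by auto
  have "seg x y \<tau> = w"
  proof (rule seg_eqI)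
    have "(\<lambda>n. dist (u (s n)) (seg (u (s n)) (v (s n)) (t (s n)))) \<longlonglongrightarrow> \<tau> * dist x y"
      unfolding dist_seg_left[OF zn(5)] by (intro tendsto_intros lim)
    then show "dist x w = \<tau> * dist x y" using tendsto_dist[OF lim(1) lim(4)] LIMSEQ_unique by blast
    have "(\<lambda>n. dist (seg (u (s n)) (v (s n)) (t (s n))) (v (s n))) \<longlonglongrightarrow> (1 - \<tau>) * dist x y"
      unfolding dist_seg_right[OF zn(5)] by (intro tendsto_intros lim)
    then show "dist w y = (1 - \<tau>) * dist x y" using tendsto_dist[OF lim(4) lim(2)] LIMSEQ_unique by blast
  qed
  moreover have "seg x y \<tau> = w'"
  proof (rule seg_eqI)
    have "(\<lambda>n. dist (u' (s n)) (seg (u' (s n)) (v' (s n)) (t (s n)))) \<longlonglongrightarrow> \<tau> * dist x y"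
      unfolding dist_seg_left[OF zn(5)] by (intro tendsto_intros lim lim')
    then show "dist x w' = \<tau> * dist x y" using tendsto_dist[OF lim'(1) lim(5)] LIMSEQ_unique by blast
    have "(\<lambda>n. dist (seg (u' (s n)) (v' (s n)) (t (s n))) (v' (s n))) \<longlonglongrightarrow> (1 - \<tau>) * dist x y"
      unfolding dist_seg_right[OF zn(5)] by (intro tendsto_intros lim lim')
    then show "dist w' y = (1 - \<tau>) * dist x y" using tendsto_dist[OF lim(5) lim'(2)] LIMSEQ_unique by blast
  qed
  ultimately have "w = w'" by simp
  moreover have "e \<le> dist w w'"
    using tendsto_lowerbound[OF tendsto_dist[OF lim(4,5)]] zn(8) by (simp add: always_eventually)
  ultimately show False using e by simp
qed

end

section \<open>Groups acting faithfully by deck transformations\<close>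

locale deck_action = no_conjugate_points p + group G
  for p :: "'b::metric_space \<Rightarrow> 'a::metric_space" and G :: "('g, 'm) monoid_scheme" (structure) +
  fixes act :: "'g \<Rightarrow> 'b \<Rightarrow> 'b"
  assumes act_deck: "g \<in> carrier G \<Longrightarrow> act g \<in> deck p"
    and act_mult: "\<lbrakk>g \<in> carrier G; h \<in> carrier G\<rbrakk> \<Longrightarrow> act (g \<otimes> h) = act g \<circ> act h"
    and act_inj: "inj_on act (carrier G)"
begin

definition o0 :: 'b where "o0 = undefined"

definition len :: "'g \<Rightarrow> real" where "len g = dist o0 (act g o0)"

text \<open>The second clause determines the value as the growth rate of displacements along powers,
  so the choice of \<open>x\<close> does not matter. The first presents it as an actual
  displacement, which yields the lower bound \<open>sep\<close>.\<close>

definition tl :: "'g \<Rightarrow> real" where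
  "tl g = (SOME l. \<exists>x. l = dist x (act g x) \<and>
     (\<forall>n y. \<bar>dist y ((act g ^^ n) y) - real n * dist x (act g x)\<bar> \<le> 2 * dist x y))"

definition sep :: real where
  "sep = (SOME r. r > 0 \<and> (\<forall>u v. p u = p v \<longrightarrow> dist u v < r \<longrightarrow> u = v))"

lemma sep_pos: "sep > 0" and sep: "\<And>u v. p u = p v \<Longrightarrow> dist u v < sep \<Longrightarrow> u = v"
proof -
  have "sep > 0 \<and> (\<forall>u v. p u = p v \<longrightarrow> dist u v < sep \<longrightarrow> u = v)"
    unfolding sep_def by (rule someI_ex[OF fibre_separated])
  then show "sep > 0" "\<And>u v. p u = p v \<Longrightarrow> dist u v < sep \<Longrightarrow> u = v" by auto
qed

lemma act_one: "act \<one> = id"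
proof (rule deck_unique[OF act_deck deck_id])
  show "act \<one> (act \<one> o0) = id (act \<one> o0)"
  proof -
    have "act (\<one> \<otimes> \<one>) = act \<one> \<circ> act \<one>" by (rule act_mult) auto
    then have eq: "act \<one> = act \<one> \<circ> act \<one>" by simp
    obtain \<psi> where "\<psi> \<circ> act \<one> = id" using deck_inverse[OF act_deck[OF one_closed]] by blast
    then have "act \<one> (act \<one> o0) = act \<one> o0" using fun_cong[OF eq, of o0] by simp
    then show ?thesis by simp
  qed
qed simp

lemma act_isometry: "g \<in> carrier G \<Longrightarrow> dist (act g u) (act g v) = dist u v"
  using act_deck deck_isometry by blast

lemma act_inv: "g \<in> carrier G \<Longrightarrow> act (inv g) (act g u) = u"
  using act_mult[of "inv g" g] act_one by (metis comp_apply id_apply inv_closed l_inv)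

lemma act_inv': "g \<in> carrier G \<Longrightarrow> act g (act (inv g) u) = u"
  using act_mult[of g "inv g"] act_one by (metis comp_apply id_apply inv_closed r_inv)

lemma act_pow: "g \<in> carrier G \<Longrightarrow> act (g [^] (n::nat)) = act g ^^ n"
proof (induction n)
  case (Suc n)
  then have "act (g [^] Suc n) = act (g [^] n) \<circ> act g" by (simp add: act_mult)
  then show ?case using Suc by (simp add: funpow_Suc_right del: funpow.simps)
qed (simp add: act_one)

lemma tl_attained:
  assumes "g \<in> carrier G"
  shows "\<exists>x. tl g = dist x (act g x) \<and> (\<forall>n y. \<bar>dist y ((act g ^^ n) y) - real n * tl g\<bar> \<le> 2 * dist x y)"
proof -
  define P where "P = (\<lambda>l. \<exists>x. l = dist x (act g x) \<and>
     (\<forall>n y. \<bar>dist y ((act g ^^ n) y) - real n * dist x (act g x)\<bar> \<le> 2 * dist x y))"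
  have "\<exists>l. P l"
  proof (rule stable_displacement[OF act_deck[OF assms]])
    fix x assume "\<And>n y. \<bar>dist y ((act g ^^ n) y) - real n * dist x (act g x)\<bar> \<le> 2 * dist x y"
    then have "P (dist x (act g x))" unfolding P_def by (intro exI[of _ x] conjI allI refl)
    then show ?thesis by (rule exI)
  qed
  then have "P (tl g)" unfolding tl_def P_def by (rule someI_ex)
  then obtain x where x: "tl g = dist x (act g x)"
    "\<forall>n y. \<bar>dist y ((act g ^^ n) y) - real n * dist x (act g x)\<bar> \<le> 2 * dist x y" unfolding P_def by (elim exE conjE)
  show ?thesis using x(2) unfolding x(1)[symmetric] by (intro exI[of _ x] conjI x(1))
qed

lemma translation_length_act: "translation_length G len tl sep"
proof
  fix x y assume xy: "x \<in> carrier G" "y \<in> carrier G"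
  have "dist o0 (act x (act y o0)) \<le> dist o0 (act x o0) + dist (act x o0) (act x (act y o0))" by (rule dist_triangle)
  then show "len (x \<otimes> y) \<le> len x + len y" using xy by (simp add: len_def act_mult act_isometry)
next
  fix x assume x: "x \<in> carrier G"
  have "dist (act x (act (inv x) o0)) (act x o0) = dist (act (inv x) o0) o0" using x by (rule act_isometry)
  then show "len (inv x) = len x" using x by (simp add: len_def act_inv' dist_commute)
  obtain z where z: "tl x = dist z (act x z)" "\<forall>n y. \<bar>dist y ((act x ^^ n) y) - real n * tl x\<bar> \<le> 2 * dist z y"
    using tl_attained[OF x] by (elim exE conjE)
  show "\<exists>c. \<forall>n::nat. \<bar>len (x [^] n) - real n * tl x\<bar> \<le> c"
    using z(2) unfolding len_def act_pow[OF x] by (intro exI[of _ "2 * dist z o0"] allI) (elim allE)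
  assume "x \<noteq> \<one>"
  then have "act x \<noteq> id" using act_inj x act_one by (metis inj_onD one_closed)
  then have disp: "sep \<le> dist u (act x u)" for u using deck_displacement[OF sep act_deck[OF x]] by blast
  show "sep \<le> tl x" unfolding z(1) by (rule disp)
qed (rule sep_pos)

lemmas act_len_mult = translation_length.len_mult[OF translation_length_act]
lemmas act_len_inv = translation_length.len_inv[OF translation_length_act]
lemmas act_len_nat_pow = translation_length.len_nat_pow[OF translation_length_act]
lemmas act_tl_le_len = translation_length.tl_le_len[OF translation_length_act]
lemmas act_tl_mprod_ge = translation_length.tl_mprod_ge[OF translation_length_act]

text \<open>The projected distance is below the scale at which lifts are exact, and the exact lift
  of \<open>p w\<close> near \<open>v\<close> can only be \<open>w\<close> itself.\<close>

lemma local_isometry: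
  assumes "v \<in> ball c (sep / 8)" "w \<in> ball c (sep / 8)"
  shows "dist (p v) (p w) = dist v w"
proof -
  have vw: "dist v w < sep / 4" using assms dist_triangle[of v w c] by (simp add: dist_commute)
  then have "dist (p v) (p w) < sep / 2" using p_lipschitz[of v w] sep_pos by simp
  from lift_exact[OF sep this] obtain w' where w': "p w' = p w" "dist v w' = dist (p v) (p w)" by blast
  have "dist w w' < sep" using vw w'(2) p_lipschitz[of v w] dist_triangle[of w w' v] sep_pos by (simp add: dist_commute)
  then have "w = w'" using sep[of w w'] w'(1) by simp
  then show ?thesis using w'(2) by simp
qed

end

section \<open>Boxes and approximate surjectivity\<close>

lemma emeasure_box:
  fixes l h :: "nat \<Rightarrow> real"
  assumes "\<And>i. i < k \<Longrightarrow> l i \<le> h i"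
  shows "emeasure (\<Pi>\<^sub>M i\<in>{..<k}. lborel) (\<Pi>\<^sub>E i\<in>{..<k}. {l i..h i}) = ennreal (\<Prod>i<k. h i - l i)"
proof -
  interpret product_sigma_finite "\<lambda>_::nat. lborel :: real measure" by unfold_locales
  have "emeasure (\<Pi>\<^sub>M i\<in>{..<k}. lborel) (\<Pi>\<^sub>E i\<in>{..<k}. {l i..h i}) = (\<Prod>i<k. emeasure lborel {l i..h i})"
    by (rule emeasure_PiM) auto
  also have "\<dots> = (\<Prod>i<k. ennreal (h i - l i))" using assms by (intro prod.cong) auto
  also have "\<dots> = ennreal (\<Prod>i<k. h i - l i)" using assms by (intro prod_ennreal) simp
  finally show ?thesis .
qed

text \<open>Poincare--Miranda: Kuhn's labelling lemma is applied to the signs of \<open>F x i - y i\<close> on a fine grid.\<close>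

lemma approximate_surjectivity:
  fixes F :: "(nat \<Rightarrow> real) \<Rightarrow> nat \<Rightarrow> real" and E :: real and N :: nat
  assumes near: "\<And>x i. i < k \<Longrightarrow> \<bar>F x i - x i\<bar> \<le> E" and N: "real N > E + 1"
    and uc: "\<And>e. e > 0 \<Longrightarrow> \<exists>d>0. \<forall>x x'. (\<forall>i<k. \<bar>x i\<bar> \<le> real N) \<and> (\<forall>i<k. \<bar>x' i\<bar> \<le> real N) \<and>
      (\<forall>i<k. \<bar>x i - x' i\<bar> < d) \<longrightarrow> (\<forall>i<k. \<bar>F x i - F x' i\<bar> \<le> e)"
    and y: "\<And>i. i < k \<Longrightarrow> 0 \<le> y i \<and> y i \<le> 1" and e: "e > 0" and k: "0 < k"
  shows "\<exists>x. (\<forall>i<k. \<bar>x i\<bar> \<le> real N) \<and> (\<forall>i<k. \<bar>F x i - y i\<bar> \<le> e)"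
proof -
  have E0: "E \<ge> 0" using near[of 0 "\<lambda>_. 0"] k by simp
  have N0: "N > 0" using N E0 by (cases N) auto
  obtain d where d: "d > 0" "\<And>x x'. \<lbrakk>\<forall>i<k. \<bar>x i\<bar> \<le> real N; \<forall>i<k. \<bar>x' i\<bar> \<le> real N; \<forall>i<k. \<bar>x i - x' i\<bar> < d\<rbrakk> \<Longrightarrow>
      \<forall>i<k. \<bar>F x i - F x' i\<bar> \<le> e" using uc[OF e] by blast
  obtain P :: nat where P: "real P > 2 * real N / d" using reals_Archimedean2 by blast
  have P0: "P > 0" using P d(1) by (cases P) (auto simp: field_simps)
  have step: "2 * real N / real P < d" using P P0 d(1) by (simp add: field_simps)
  define pt where "pt = (\<lambda>(q::nat \<Rightarrow> nat) i. - real N + 2 * real N / real P * real (q i))"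
  define label where "label = (\<lambda>q i. if F (pt q) i \<le> y i then 0 else (1::nat))"
  have ptb: "\<bar>pt q i\<bar> \<le> real N" if "q i \<le> P" for q i
  proof -
    have "0 \<le> 2 * real N / real P * real (q i)" by simp
    moreover have "2 * real N / real P * real (q i) \<le> 2 * real N / real P * real P"
      using that by (intro mult_left_mono) auto
    ultimately show ?thesis using P0 by (simp add: pt_def abs_le_iff)
  qed
  \<comment> \<open>Kuhn's lemma provides a grid cell in which both labels occur at corners for
    every coordinate. The labels on the faces are forced by \<open>N > E + 1\<close>: an error of at
    most \<open>E\<close> cannot carry a coordinate from \<open>-N\<close> or \<open>N\<close> past
    \<open>y i\<close>.\<close>
  obtain q where q: "\<forall>i<k. q i < P"
    and qq: "\<forall>i<k. \<exists>r s. (\<forall>j<k. q j \<le> r j \<and> r j \<le> q j + 1) \<and> (\<forall>j<k. q j \<le> s j \<and> s j \<le> q j + 1) \<and> label r i \<noteq> label s i"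
  proof (rule kuhn_lemma[of P k label])
    show "\<forall>x. (\<forall>i<k. x i \<le> P) \<longrightarrow> (\<forall>i<k. label x i = 0 \<or> label x i = 1)" by (simp add: label_def)
    show "\<forall>x. (\<forall>i<k. x i \<le> P) \<longrightarrow> (\<forall>i<k. x i = 0 \<longrightarrow> label x i = 0)"
    proof (intro allI impI)
      fix x i assume "i < k" "x i = (0::nat)"
      then have "pt x i = - real N" by (simp add: pt_def)
      then have "F (pt x) i \<le> y i" using near[OF \<open>i < k\<close>, of "pt x"] N y[OF \<open>i < k\<close>] by linarith
      then show "label x i = 0" by (simp add: label_def)
    qed
    show "\<forall>x. (\<forall>i<k. x i \<le> P) \<longrightarrow> (\<forall>i<k. x i = P \<longrightarrow> label x i = 1)"
    proof (intro allI impI)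
      fix x i assume "i < k" "x i = P"
      then have "pt x i = real N" using P0 by (simp add: pt_def)
      then have "F (pt x) i > y i" using near[OF \<open>i < k\<close>, of "pt x"] N y[OF \<open>i < k\<close>] by linarith
      then show "label x i = 1" by (simp add: label_def)
    qed
  qed (use P0 in auto)
  have "\<bar>F (pt q) i - y i\<bar> \<le> e" if i: "i < k" for i
  proof -
    obtain r s where rs: "\<forall>j<k. q j \<le> r j \<and> r j \<le> q j + 1" "\<forall>j<k. q j \<le> s j \<and> s j \<le> q j + 1" "label r i \<noteq> label s i"
      using qq i by blast
    have adj: "\<bar>F (pt q) i - F (pt z) i\<bar> \<le> e" if z: "\<forall>j<k. q j \<le> z j \<and> z j \<le> q j + 1" for z
    proof -
      have "\<forall>j<k. \<bar>pt q j\<bar> \<le> real N" using q ptb by (simp add: less_imp_le)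
      moreover have "\<forall>j<k. \<bar>pt z j\<bar> \<le> real N"
      proof (intro allI impI)
        fix j assume "j < k"
        then have "z j \<le> P" using q z by (metis Suc_eq_plus1 Suc_leI le_trans)
        then show "\<bar>pt z j\<bar> \<le> real N" by (rule ptb)
      qed
      moreover have "\<forall>j<k. \<bar>pt q j - pt z j\<bar> < d"
      proof (intro allI impI)
        fix j assume "j < k"
        then have "\<bar>real (q j) - real (z j)\<bar> \<le> 1" using z by force
        moreover have "pt q j - pt z j = 2 * real N / real P * (real (q j) - real (z j))"
          by (simp add: pt_def right_diff_distrib)
        ultimately have "\<bar>pt q j - pt z j\<bar> \<le> 2 * real N / real P * 1"
          by (simp only: abs_mult) (intro mult_mono, auto)
        then show "\<bar>pt q j - pt z j\<bar> < d" using step by simp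
      qed
      ultimately show ?thesis using d(2) i by blast
    qed
    have "(F (pt r) i \<le> y i) \<noteq> (F (pt s) i \<le> y i)" using rs(3) by (auto simp: label_def split: if_splits)
    \<comment> \<open>A value at most \<open>y i\<close> and a value above it are both within
      \<open>e\<close> of the value at \<open>pt q\<close>.\<close>
    then consider "F (pt r) i \<le> y i" "y i < F (pt s) i" | "F (pt s) i \<le> y i" "y i < F (pt r) i" by fastforce
    then show ?thesis using adj[OF rs(1)] adj[OF rs(2)] by cases linarith+
  qed
  moreover have "\<forall>i<k. \<bar>pt q i\<bar> \<le> real N" using q ptb by (simp add: less_imp_le)
  ultimately show ?thesis by blast
qed

context deck_action
begin

lemma len_int_pow: "x \<in> carrier G \<Longrightarrow> len (x [^] (n::int)) \<le> \<bar>of_int n\<bar> * len x + len \<one>"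
proof -
  assume x: "x \<in> carrier G"
  show ?thesis
  proof (cases "0 \<le> n")
    case True
    then obtain m where "n = int m" using nonneg_int_cases by blast
    then show ?thesis using act_len_nat_pow[OF x, of m] by (simp add: int_pow_int)
  next
    case False
    then obtain m where "n = - int m" by (metis int_cases2 of_nat_0_le_iff)
    then show ?thesis using act_len_nat_pow[OF x, of m] x by (simp add: int_pow_neg int_pow_int act_len_inv)
  qed
qed

lemma len_mprod_bounded:
  assumes "commuting_family G a k"
  shows "\<exists>M. \<forall>n. (\<forall>i<k. \<bar>real_of_int (n i)\<bar> \<le> R) \<longrightarrow> len (mprod G a n k) \<le> M"
  using assms
proof (induction k)
  case (Suc k)
  have cf: "commuting_family G a k" using Suc.prems by (rule commuting_family_le) simp
  have ak: "a k \<in> carrier G" using Suc.prems by (auto simp: commuting_family_def)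
  obtain M where M: "\<And>n. (\<forall>i<k. \<bar>real_of_int (n i)\<bar> \<le> R) \<Longrightarrow> len (mprod G a n k) \<le> M" using Suc.IH[OF cf] by blast
  have "len (mprod G a n (Suc k)) \<le> M + (R * len (a k) + len \<one>)" if n: "\<forall>i<Suc k. \<bar>real_of_int (n i)\<bar> \<le> R" for n
  proof -
    have "len (mprod G a n k \<otimes> a k [^] n k) \<le> len (mprod G a n k) + len (a k [^] n k)"
      using mprod_closed[OF cf] ak by (intro act_len_mult) auto
    moreover have "len (mprod G a n k) \<le> M" using n by (intro M) auto
    moreover have "len (a k [^] n k) \<le> \<bar>of_int (n k)\<bar> * len (a k) + len \<one>" using ak by (rule len_int_pow)
    moreover have "\<bar>of_int (n k)\<bar> * len (a k) \<le> R * len (a k)" using n by (intro mult_right_mono) (auto simp: len_def)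
    ultimately show ?thesis by simp
  qed
  then show ?case by blast
qed auto

text \<open>A curve through the points \<open>act (g [^] n) u\<close>, made of translated segments.
  It may be broken at these points; what matters is the controlled dependence on \<open>u\<close>
  and \<open>t\<close>.\<close>

definition line :: "'g \<Rightarrow> 'b \<Rightarrow> real \<Rightarrow> 'b" where
  "line g u t = act (g [^] \<lfloor>t\<rfloor>) (seg u (act g u) (frac t))"

lemma frac_01: "frac (t::real) \<in> {0..1}"
  using frac_ge_0[of t] frac_lt_1[of t] by simp

lemma line_dist:
  assumes g: "g \<in> carrier G" and st: "s \<le> t" "t - s < 1"
  shows "dist (line g u s) (line g u t) \<le> (t - s) * dist u (act g u)"
proof -
  define n where "n = \<lfloor>s\<rfloor>"
  have gn: "g [^] n \<in> carrier G" using g by simp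
  have "\<lfloor>t\<rfloor> = n \<or> \<lfloor>t\<rfloor> = n + 1" using st unfolding n_def by linarith
  then show ?thesis
  proof
    assume t: "\<lfloor>t\<rfloor> = n"
    have "dist (line g u s) (line g u t) = \<bar>frac s - frac t\<bar> * dist u (act g u)"
      unfolding line_def t n_def[symmetric] act_isometry[OF gn] by (rule seg_dist[OF frac_01 frac_01])
    moreover have "\<bar>frac s - frac t\<bar> = t - s" using st t by (simp add: frac_def n_def)
    ultimately show ?thesis by simp
  next
    assume t: "\<lfloor>t\<rfloor> = n + 1"
    have "act (g [^] (n + 1)) = act (g [^] n) \<circ> act g" using g by (simp add: int_pow_mult act_mult int_pow_1)
    then have 1: "line g u t = act (g [^] n) (act g (seg u (act g u) (frac t)))" by (simp add: line_def t)
    have 2: "line g u s = act (g [^] n) (seg u (act g u) (frac s))" by (simp add: line_def n_def)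
    have "dist (line g u s) (line g u t) = dist (seg u (act g u) (frac s)) (act g (seg u (act g u) (frac t)))"
      unfolding 1 2 by (rule act_isometry[OF gn])
    also have "\<dots> \<le> dist (seg u (act g u) (frac s)) (act g u) + dist (act g u) (act g (seg u (act g u) (frac t)))"
      by (rule dist_triangle)
    also have "\<dots> = (1 - frac s) * dist u (act g u) + frac t * dist u (act g u)"
      unfolding act_isometry[OF g] dist_seg_left[OF frac_01] dist_seg_right[OF frac_01] ..
    also have "\<dots> = (t - s) * dist u (act g u)" using t by (simp add: frac_def n_def algebra_simps)
    finally show ?thesis .
  qed
qed

text \<open>A continuous extension, up to bounded error, of the orbit map of the lattice to real exponents.\<close>

primrec cube :: "(nat \<Rightarrow> 'g) \<Rightarrow> nat \<Rightarrow> (nat \<Rightarrow> real) \<Rightarrow> 'b" where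
  "cube a 0 x = o0"
| "cube a (Suc j) x = line (a j) (cube a j x) (x j)"

text \<open>By induction the stage \<open>k\<close> is within \<open>B\<close> of an orbit point
  \<open>w\<close>. The displacement of \<open>a k\<close> at \<open>w\<close> equals that at
  \<open>o0\<close>, because \<open>a k\<close> commutes with the element carrying \<open>o0\<close>
  to \<open>w\<close>; so the next segment has length at most
  \<open>2 * B + dist o0 (act (a k) o0)\<close>.\<close>

lemma cube_near_orbit:
  assumes "commuting_family G a k"
  shows "\<exists>B. \<forall>x. dist (cube a k x) (act (mprod G a (\<lambda>i. \<lfloor>x i\<rfloor>) k) o0) \<le> B"
  using assms
proof (induction k)
  case 0 then show ?case by (auto simp: act_one)
next
  case (Suc k)
  have cf: "commuting_family G a k" using Suc.prems by (rule commuting_family_le) simp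
  have ak: "a k \<in> carrier G" using Suc.prems by (auto simp: commuting_family_def)
  obtain B where B: "\<And>x. dist (cube a k x) (act (mprod G a (\<lambda>i. \<lfloor>x i\<rfloor>) k) o0) \<le> B" using Suc.IH[OF cf] by blast
  have "dist (cube a (Suc k) x) (act (mprod G a (\<lambda>i. \<lfloor>x i\<rfloor>) (Suc k)) o0) \<le> 3 * B + dist o0 (act (a k) o0)" for x
  proof -
    define M where "M = mprod G a (\<lambda>i. \<lfloor>x i\<rfloor>) k"
    define b where "b = a k [^] \<lfloor>x k\<rfloor>"
    define u where "u = cube a k x"
    define w where "w = act M o0"
    have M: "M \<in> carrier G" and b: "b \<in> carrier G" using mprod_closed[OF cf] ak by (auto simp: M_def b_def)
    have com: "a k \<otimes> M = M \<otimes> a k" unfolding M_def using Suc.prems ak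
      by (intro mprod_commute) (auto simp: commuting_family_def)
    have "b \<otimes> M = M \<otimes> b" unfolding b_def using commute_int_pow[of M "a k"] com M ak by simp
    then have target: "act (mprod G a (\<lambda>i. \<lfloor>x i\<rfloor>) (Suc k)) o0 = act b w"
      using act_mult[OF b M] by (simp add: M_def[symmetric] b_def[symmetric] w_def)
    have uw: "dist u w \<le> B" using B[of x] by (simp add: u_def w_def M_def)
    have ww: "dist w (act (a k) w) = dist o0 (act (a k) o0)"
    proof -
      have "act (a k) w = act M (act (a k) o0)" using act_mult[OF ak M] act_mult[OF M ak] com by (simp add: w_def fun_eq_iff)
      then show ?thesis unfolding w_def using act_isometry[OF M] by simp
    qed
    have uu: "dist u (act (a k) u) \<le> 2 * B + dist o0 (act (a k) o0)"
      using dist_triangle[of u "act (a k) u" w] dist_triangle[of w "act (a k) u" "act (a k) w"]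
        act_isometry[OF ak, of w u] uw ww by (simp add: dist_commute)
    have "dist (cube a (Suc k) x) (act b w) = dist (seg u (act (a k) u) (frac (x k))) w"
      using act_isometry[OF b] by (simp add: line_def b_def u_def)
    also have "\<dots> \<le> dist u (seg u (act (a k) u) (frac (x k))) + dist u w"
      using dist_triangle[of "seg u (act (a k) u) (frac (x k))" w u] by (simp add: dist_commute)
    also have "dist u (seg u (act (a k) u) (frac (x k))) \<le> dist u (act (a k) u)"
      using dist_seg_left[OF frac_01, of u "act (a k) u" "x k"] frac_01[of "x k"] by (simp add: mult_left_le_one_le)
    finally show ?thesis using target uw uu by simp
  qed
  then show ?case by blast
qed

lemma cube_bounded:
  assumes cf: "commuting_family G a k"
  shows "\<exists>M. \<forall>x. (\<forall>i<k. \<bar>x i\<bar> \<le> R) \<longrightarrow> cube a k x \<in> cball o0 M"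
proof -
  obtain B where B: "\<And>x. dist (cube a k x) (act (mprod G a (\<lambda>i. \<lfloor>x i\<rfloor>) k) o0) \<le> B"
    using cube_near_orbit[OF cf] by blast
  obtain M where M: "\<And>n. (\<forall>i<k. \<bar>real_of_int (n i)\<bar> \<le> R + 1) \<Longrightarrow> len (mprod G a n k) \<le> M"
    using len_mprod_bounded[OF cf, of "R + 1"] by blast
  have "cube a k x \<in> cball o0 (M + B)" if x: "\<forall>i<k. \<bar>x i\<bar> \<le> R" for x
  proof -
    have "\<forall>i<k. \<bar>real_of_int \<lfloor>x i\<rfloor>\<bar> \<le> R + 1"
    proof (intro allI impI)
      fix i assume "i < k"
      then have "\<bar>x i\<bar> \<le> R" using x by blast
      then show "\<bar>real_of_int \<lfloor>x i\<rfloor>\<bar> \<le> R + 1" by linarith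
    qed
    then have "len (mprod G a (\<lambda>i. \<lfloor>x i\<rfloor>) k) \<le> M" by (rule M)
    then show ?thesis
      using B[of x] dist_triangle[of o0 "cube a k x" "act (mprod G a (\<lambda>i. \<lfloor>x i\<rfloor>) k) o0"]
      by (simp add: len_def dist_commute)
  qed
  then show ?thesis by blast
qed

text \<open>A change of the earlier coordinates moves the ends of a segment at fixed parameter,
  controlled by \<open>seg_uniformly_continuous\<close>; a change of the last coordinate moves along
  one broken curve, controlled by \<open>line_dist\<close>. Each contributes at most
  \<open>e / 2\<close>.\<close>

lemma cube_uniformly_continuous:
  assumes "commuting_family G a k" "e > 0"
  shows "\<exists>d>0. \<forall>x x'. (\<forall>i<k. \<bar>x i\<bar> \<le> R) \<and> (\<forall>i<k. \<bar>x' i\<bar> \<le> R) \<and> (\<forall>i<k. \<bar>x i - x' i\<bar> < d) \<longrightarrow>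
     dist (cube a k x) (cube a k x') < e"
  using assms
proof (induction k arbitrary: e)
  case 0 then show ?case by (auto intro: exI[of _ 1])
next
  case (Suc k)
  have cf: "commuting_family G a k" using Suc.prems(1) by (rule commuting_family_le) simp
  have ak: "a k \<in> carrier G" using Suc.prems by (auto simp: commuting_family_def)
  obtain M0 where M0: "\<And>x. (\<forall>i<k. \<bar>x i\<bar> \<le> R) \<Longrightarrow> cube a k x \<in> cball o0 M0" using cube_bounded[OF cf] by blast
  \<comment> \<open>This radius accommodates both ends of the segment, \<open>cube a k x\<close> and
    its translate by \<open>a k\<close>.\<close>
  define M where "M = \<bar>M0\<bar> + dist o0 (act (a k) o0)"
  define D where "D = 2 * M + 1"
  have D0: "D > 0" by (simp add: D_def M_def add_nonneg_pos)
  have inM: "cube a k x \<in> cball o0 M" "act (a k) (cube a k x) \<in> cball o0 M" if "\<forall>i<k. \<bar>x i\<bar> \<le> R" for x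
  proof -
    have c: "dist o0 (cube a k x) \<le> \<bar>M0\<bar>" using M0[OF that] by simp
    then show "cube a k x \<in> cball o0 M" by (simp add: M_def add_increasing2)
    show "act (a k) (cube a k x) \<in> cball o0 M"
      using c dist_triangle[of o0 "act (a k) (cube a k x)" "act (a k) o0"] act_isometry[OF ak, of o0 "cube a k x"]
      by (simp add: M_def)
  qed
  obtain d1 where d1: "d1 > 0" "\<And>u u' v v' t. \<lbrakk>u \<in> cball o0 M; u' \<in> cball o0 M; v \<in> cball o0 M; v' \<in> cball o0 M;
      t \<in> {0..1}; dist u u' < d1; dist v v' < d1\<rbrakk> \<Longrightarrow> dist (seg u v t) (seg u' v' t) < e / 2"
    using seg_uniformly_continuous[of "e / 2" o0 M] Suc.prems(2) by (metis half_gt_zero)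
  obtain d2 where d2: "d2 > 0" "\<And>x x'. \<lbrakk>\<forall>i<k. \<bar>x i\<bar> \<le> R; \<forall>i<k. \<bar>x' i\<bar> \<le> R; \<forall>i<k. \<bar>x i - x' i\<bar> < d2\<rbrakk> \<Longrightarrow>
      dist (cube a k x) (cube a k x') < d1" using Suc.IH[OF cf d1(1)] by blast
  define d where "d = min d2 (min 1 (e / (2 * D)))"
  have "d > 0" using d2(1) Suc.prems(2) D0 by (simp add: d_def)
  moreover have "dist (cube a (Suc k) x) (cube a (Suc k) x') < e"
    if x: "\<forall>i<Suc k. \<bar>x i\<bar> \<le> R" and x': "\<forall>i<Suc k. \<bar>x' i\<bar> \<le> R" and xx: "\<forall>i<Suc k. \<bar>x i - x' i\<bar> < d" for x x'
  proof -
    define u where "u = cube a k x"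
    define u' where "u' = cube a k x'"
    have xk: "\<forall>i<k. \<bar>x i\<bar> \<le> R" and xk': "\<forall>i<k. \<bar>x' i\<bar> \<le> R" using x x' by auto
    have xd: "\<forall>i<k. \<bar>x i - x' i\<bar> < d2" using xx by (auto simp: d_def)
    have uu: "dist u u' < d1" unfolding u_def u'_def by (rule d2(2)[OF xk xk' xd])
    have "dist (line (a k) u (x' k)) (line (a k) u' (x' k)) = dist (seg u (act (a k) u) (frac (x' k))) (seg u' (act (a k) u') (frac (x' k)))"
      unfolding line_def by (rule act_isometry) (simp add: ak)
    also have "\<dots> < e / 2"
    proof (rule d1(2))
      show "dist (act (a k) u) (act (a k) u') < d1" using uu act_isometry[OF ak] by simp
    qed (use inM[OF xk] inM[OF xk'] frac_01 uu in \<open>auto simp: u_def u'_def\<close>)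
    finally have 1: "dist (line (a k) u (x' k)) (line (a k) u' (x' k)) < e / 2" .
    have Du: "dist u (act (a k) u) < D"
      using inM[OF xk] dist_triangle[of u "act (a k) u" o0] by (simp add: u_def D_def dist_commute)
    have xs: "\<bar>x k - x' k\<bar> < 1" "\<bar>x k - x' k\<bar> < e / (2 * D)" using xx by (auto simp: d_def)
    have "dist (line (a k) u (x k)) (line (a k) u (x' k)) \<le> \<bar>x k - x' k\<bar> * dist u (act (a k) u)"
    proof (cases "x k \<le> x' k")
      case True then show ?thesis using line_dist[OF ak, of "x k" "x' k" u] xs(1) by simp
    next
      case False then show ?thesis using line_dist[OF ak, of "x' k" "x k" u] xs(1) by (simp add: dist_commute)
    qed
    also have "\<dots> \<le> e / (2 * D) * D" using xs(2) Du Suc.prems(2) D0 by (intro mult_mono) auto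
    also have "\<dots> = e / 2" using D0 by simp
    finally have 2: "dist (line (a k) u (x k)) (line (a k) u (x' k)) \<le> e / 2" .
    show ?thesis using 1 2 dist_triangle[of "line (a k) u (x k)" "line (a k) u' (x' k)" "line (a k) u (x' k)"]
      by (simp add: u_def u'_def)
  qed
  ultimately show ?case by blast
qed

end

section \<open>Comparison of Hausdorff and Lebesgue measure\<close>

lemma hausdorff_measure_zero_cover:
  assumes "hausdorff_measure s A = 0" "\<eta> > 0"
  obtains U where "A \<subseteq> (\<Union>n::nat. U n)" "\<And>n. bounded (U n)" "\<And>n. diameter (U n) \<le> 1" "(\<Sum>n. hm_term s (U n)) < \<eta>"
proof -
  have "hausdorff_delta s 1 A \<le> hausdorff_measure s A" unfolding hausdorff_measure_def by (rule SUP_upper) simp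
  then have "hausdorff_delta s 1 A < \<eta>" using assms by simp
  then show thesis using that unfolding hausdorff_delta_def INF_less_iff by blast
qed

text \<open>For diameters at most 1 a larger exponent gives a smaller power. The case
  \<open>s = 0\<close> is separate because \<open>hm_term\<close> is then 1 on every nonempty
  set.\<close>

lemma power_diameter_le_hm_term:
  assumes "0 \<le> s" "s \<le> real k" "0 < k" "U \<noteq> {}" "bounded U" "diameter U \<le> 1"
  shows "ennreal (diameter U ^ k) \<le> hm_term s U"
proof -
  have d0: "0 \<le> diameter U" using assms(5) by (rule diameter_ge_0)
  show ?thesis
  proof (cases "s = 0")
    case True
    have "ennreal (diameter U ^ k) \<le> ennreal 1" using d0 assms(6) by (intro ennreal_leI power_le_one)
    then show ?thesis using True assms(4) by (simp add: hm_term_def)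
  next
    case False
    have "diameter U ^ k \<le> diameter U powr s"
    proof (cases "diameter U = 0")
      case True then show ?thesis using assms(3) by (simp add: zero_power)
    next
      case False
      then have "diameter U ^ k = diameter U powr real k" using d0 by (simp add: powr_realpow)
      also have "\<dots> \<le> diameter U powr s" using assms d0 by (intro powr_mono') auto
      finally show ?thesis .
    qed
    then show ?thesis using False assms(4) by (simp add: hm_term_def ennreal_leI)
  qed
qed

context deck_action
begin

text \<open>If \<open>s\<close> were at most a positive \<open>k\<close>, the base would have covers
  with arbitrarily small sum of \<open>k\<close>-th powers of diameters. Lifted locally to a compact
  ball and mapped by \<open>k\<close> Lipschitz functions, they would cover a unit cube by boxes of
  total volume below 1.\<close>

lemma no_large_independent_family:
  assumes hm: "hausdorff_measure s (UNIV :: 'a set) = 0" and s0: "0 \<le> s"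
    and cf: "commuting_family G a k" and ind: "independent_family G a k"
  shows "real k < s \<or> k = 0"
proof (rule ccontr)
  assume "\<not> (real k < s \<or> k = 0)"
  then have ks: "s \<le> real k" and k0: "0 < k" by auto
  obtain c where c: "c > 0" "\<And>n i. i < k \<Longrightarrow> c * \<bar>of_int (n i)\<bar> \<le> tl (mprod G a n k)"
    using act_tl_mprod_ge[OF cf ind] by blast
  \<comment> \<open>By the norm estimate \<open>n i\<close> is at most \<open>C\<close> times the
    displacement of \<open>o0\<close> under the lattice element, so the coordinate functionals are
    \<open>C\<close>-Lipschitz on the orbit.\<close>
  define C where "C = 1 / c"
  have C0: "C > 0" using c(1) by (simp add: C_def)
  define A where "A = (\<lambda>n. act (mprod G a n k))"
  have mc: "mprod G a n k \<in> carrier G" for n by (rule mprod_closed[OF cf])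
  have A_add: "A (\<lambda>i. n i + m i) = A n \<circ> A m" for n m by (simp add: A_def mprod_add[OF cf] act_mult mc)
  have A_zero: "A (\<lambda>_. 0) = id" by (simp add: A_def mprod_zero[OF cf] act_one)
  have A_iso: "dist (A n u) (A n v) = dist u v" for n u v unfolding A_def by (rule act_isometry[OF mc])
  have lower: "\<bar>of_int (n i)\<bar> \<le> C * dist o0 (A n o0)" if "i < k" for n i
  proof -
    have "c * \<bar>of_int (n i)\<bar> \<le> dist o0 (A n o0)" using c(2)[OF that, of n] act_tl_le_len[OF mc, of n] by (simp add: len_def A_def)
    then show ?thesis using c(1) by (simp add: C_def field_simps)
  qed
  \<comment> \<open>McShane extension of the homomorphism \<open>n \<mapsto> n i\<close> from the orbit of \<open>o0\<close>, hence Lipschitz and equivariant\<close>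
  define f where "f = (\<lambda>i x. INF n. of_int (n i) + C * dist x (A n o0))"
  have bdd: "bdd_below (range (\<lambda>n. of_int (n i) + C * dist x (A n o0)))" if "i < k" for i x
  proof (rule bdd_belowI2)
    fix n
    have "C * dist o0 (A n o0) \<le> C * dist x o0 + C * dist x (A n o0)"
      using mult_left_mono[OF dist_triangle3[of o0 "A n o0" x], of C] C0 by (simp add: distrib_left)
    then show "- C * dist x o0 \<le> of_int (n i) + C * dist x (A n o0)" using lower[OF that, of n] by linarith
  qed
  have f_le: "f i x \<le> of_int (n i) + C * dist x (A n o0)" if "i < k" for i x n
    unfolding f_def by (rule cINF_lower[OF bdd[OF that]]) simp
  have f_ge: "b \<le> f i x" if "\<And>n. b \<le> of_int (n i) + C * dist x (A n o0)" for b i x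
    unfolding f_def by (rule cINF_greatest) (use that in auto)
  have f_lip1: "f i x \<le> f i y + C * dist x y" if i: "i < k" for i x y
  proof -
    have "f i x - C * dist x y \<le> f i y"
    proof (rule f_ge)
      fix n
      have "C * dist x (A n o0) \<le> C * dist x y + C * dist y (A n o0)"
        using mult_left_mono[OF dist_triangle[of x "A n o0" y], of C] C0 by (simp add: distrib_left)
      then show "f i x - C * dist x y \<le> of_int (n i) + C * dist y (A n o0)" using f_le[OF i, of x n] by linarith
    qed
    then show ?thesis by simp
  qed
  have f_lip: "\<bar>f i x - f i y\<bar> \<le> C * dist x y" if "i < k" for i x y
    using f_lip1[OF that, of x y] f_lip1[OF that, of y x] by (simp add: dist_commute abs_le_iff)
  have f_equiv1: "f i (A m x) \<le> of_int (m i) + f i x" if i: "i < k" for i m x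
  proof -
    have "f i (A m x) - of_int (m i) \<le> f i x"
    proof (rule f_ge)
      fix n
      show "f i (A m x) - of_int (m i) \<le> of_int (n i) + C * dist x (A n o0)"
        using f_le[OF i, of "A m x" "\<lambda>i. m i + n i"] by (simp add: A_add A_iso)
    qed
    then show ?thesis by simp
  qed
  \<comment> \<open>The reverse inequality is \<open>f_equiv1\<close> for the negated
    exponents.\<close>
  have f_equiv: "f i (A m x) = of_int (m i) + f i x" if i: "i < k" for i m x
  proof -
    have "A (\<lambda>i. - m i) (A m x) = x"
      using fun_cong[OF A_add[of "\<lambda>i. - m i" m], of x] A_zero by simp
    then have "f i x \<le> - of_int (m i) + f i (A m x)" using f_equiv1[OF i, of "\<lambda>i. - m i" "A m x"] by simp
    then show ?thesis using f_equiv1[OF i, of m x] by simp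
  qed
  obtain B where B: "\<And>x. dist (cube a k x) (A (\<lambda>i. \<lfloor>x i\<rfloor>) o0) \<le> B"
    using cube_near_orbit[OF cf] unfolding A_def by blast
  define F where "F = (\<lambda>x i. f i (cube a k x))"
  \<comment> \<open>The summands account for the distance from the cube map to the orbit, the
    rounding of \<open>x i\<close>, and the additive constant in the equivariance of
    \<open>f i\<close>.\<close>
  define E where "E = C * B + 1 + (\<Sum>i<k. \<bar>f i o0\<bar>)"
  have near: "\<bar>F x i - x i\<bar> \<le> E" if i: "i < k" for x i
  proof -
    have "\<bar>F x i - f i (A (\<lambda>i. \<lfloor>x i\<rfloor>) o0)\<bar> \<le> C * B"
      unfolding F_def using order_trans[OF f_lip[OF i] mult_left_mono[OF B[of x]]] C0 by simp
    moreover have "f i (A (\<lambda>i. \<lfloor>x i\<rfloor>) o0) = of_int \<lfloor>x i\<rfloor> + f i o0" by (rule f_equiv[OF i])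
    moreover have "\<bar>f i o0\<bar> \<le> (\<Sum>i<k. \<bar>f i o0\<bar>)" using i by (intro member_le_sum) auto
    moreover have "\<bar>of_int \<lfloor>x i\<rfloor> - x i\<bar> \<le> 1" by linarith
    ultimately show ?thesis unfolding E_def by linarith
  qed
  obtain N :: nat where N: "real N > E + 1" using reals_Archimedean2 by blast
  have uc: "\<exists>d>0. \<forall>x x'. (\<forall>i<k. \<bar>x i\<bar> \<le> real N) \<and> (\<forall>i<k. \<bar>x' i\<bar> \<le> real N) \<and>
      (\<forall>i<k. \<bar>x i - x' i\<bar> < d) \<longrightarrow> (\<forall>i<k. \<bar>F x i - F x' i\<bar> \<le> e)" if e: "e > 0" for e
  proof -
    have "e / C > 0" using e C0 by simp
    then obtain d where d: "d > 0" "\<And>x x'. \<lbrakk>\<forall>i<k. \<bar>x i\<bar> \<le> real N; \<forall>i<k. \<bar>x' i\<bar> \<le> real N; \<forall>i<k. \<bar>x i - x' i\<bar> < d\<rbrakk> \<Longrightarrow>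
      dist (cube a k x) (cube a k x') < e / C" using cube_uniformly_continuous[OF cf, of "e / C" "real N"] by metis
    have "\<bar>F x i - F x' i\<bar> \<le> e" if "\<forall>i<k. \<bar>x i\<bar> \<le> real N" "\<forall>i<k. \<bar>x' i\<bar> \<le> real N" "\<forall>i<k. \<bar>x i - x' i\<bar> < d" "i < k" for x x' i
    proof -
      have "C * dist (cube a k x) (cube a k x') \<le> e" using d(2)[OF that(1-3)] C0 by (simp add: field_simps)
      then show ?thesis using f_lip[OF that(4)] unfolding F_def by (rule order_trans[rotated])
    qed
    then show ?thesis using d(1) by blast
  qed
  obtain R where R: "\<And>x. (\<forall>i<k. \<bar>x i\<bar> \<le> real N) \<Longrightarrow> cube a k x \<in> cball o0 R" using cube_bounded[OF cf] by blast
  \<comment> \<open>Approximate solutions lie in one compact ball, and a limit of them is an exact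
    solution.\<close>
  have surj: "\<exists>z\<in>cball o0 R. \<forall>i<k. f i z = y i" if y: "\<And>i. i < k \<Longrightarrow> 0 \<le> y i \<and> y i \<le> 1" for y
  proof -
    have "\<exists>x. (\<forall>i<k. \<bar>x i\<bar> \<le> real N) \<and> (\<forall>i<k. \<bar>F x i - y i\<bar> \<le> 1 / real (Suc n))" for n
      by (rule approximate_surjectivity[OF near N uc y _ k0]) auto
    then obtain x where x: "\<And>n. \<forall>i<k. \<bar>x n i\<bar> \<le> real N" "\<And>n. \<forall>i<k. \<bar>F (x n) i - y i\<bar> \<le> 1 / real (Suc n)" by metis
    have "\<forall>n. cube a k (x n) \<in> cball o0 R" using R x(1) by blast
    then obtain z q where z: "z \<in> cball o0 R" "strict_mono q" "((\<lambda>n. cube a k (x n)) \<circ> q) \<longlonglongrightarrow> z"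
      using compact_cball[of o0 R] unfolding compact_eq_seq_compact_metric seq_compact_def by metis
    have "f i z = y i" if i: "i < k" for i
    proof -
      have "\<bar>f i z - y i\<bar> \<le> 0"
      proof (rule tendsto_lowerbound)
        have "(\<lambda>n. 1 / real (Suc (q n))) \<longlonglongrightarrow> 0"
          using LIMSEQ_subseq_LIMSEQ[OF LIMSEQ_inverse_real_of_nat z(2)] by (simp add: o_def inverse_eq_divide)
        moreover have "(\<lambda>n. dist (cube a k (x (q n))) z) \<longlonglongrightarrow> 0" using z(3) unfolding tendsto_dist_iff[of _ z] by (simp add: o_def)
        ultimately have "(\<lambda>n. C * dist (cube a k (x (q n))) z + 1 / real (Suc (q n))) \<longlonglongrightarrow> C * 0 + 0"
          by (intro tendsto_intros)
        then show "(\<lambda>n. C * dist (cube a k (x (q n))) z + 1 / real (Suc (q n))) \<longlonglongrightarrow> 0" by simp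
        have "\<bar>f i z - y i\<bar> \<le> C * dist (cube a k (x (q n))) z + 1 / real (Suc (q n))" for n
        proof -
          have "\<bar>f i (cube a k (x (q n))) - y i\<bar> \<le> 1 / real (Suc (q n))" using x(2)[of "q n"] i by (simp add: F_def)
          then show ?thesis using f_lip[OF i, of "cube a k (x (q n))" z] by linarith
        qed
        then show "\<forall>\<^sub>F n in sequentially. \<bar>f i z - y i\<bar> \<le> C * dist (cube a k (x (q n))) z + 1 / real (Suc (q n))"
          by (intro always_eventually allI)
      qed simp
      then show ?thesis by simp
    qed
    then show ?thesis using z(1) by blast
  qed
  have "cball o0 R \<subseteq> (\<Union>x\<in>cball o0 R. ball x (sep / 8))" using sep_pos by auto
  then obtain Z where Z: "Z \<subseteq> cball o0 R" "finite Z" "cball o0 R \<subseteq> (\<Union>x\<in>Z. ball x (sep / 8))"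
    by (rule compactE_image[OF compact_cball open_ball])
  \<comment> \<open>Each covering set has one local lift for each centre in \<open>Z\<close>, with
    image in a box of side \<open>2 * C\<close> times the diameter; the added 1 makes
    \<open>J\<close> positive whatever \<open>Z\<close> is.\<close>
  define J where "J = (real (card Z) + 1) * (2 * C) ^ k"
  have J0: "J > 0" using C0 by (simp add: J_def add_nonneg_pos)
  obtain U :: "nat \<Rightarrow> 'a set" where U: "UNIV \<subseteq> (\<Union>n. U n)" "\<And>n. bounded (U n)" "\<And>n. diameter (U n) \<le> 1"
      "(\<Sum>n. hm_term s (U n)) < ennreal (1 / J)"
    using hausdorff_measure_zero_cover[OF hm, of "ennreal (1 / J)"] J0 by auto
  define S where "S = (\<lambda>n c. {z \<in> ball c (sep / 8). p z \<in> U n})"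
  define z0 where "z0 = (\<lambda>n c. SOME z. z \<in> S n c)"
  \<comment> \<open>By the Lipschitz bound, a box around the image of one arbitrary point of the
    lifted piece contains the image of the whole piece.\<close>
  define Bx where "Bx = (\<lambda>n c. if S n c = {} then {} else
     (\<Pi>\<^sub>E i\<in>{..<k}. {f i (z0 n c) - C * diameter (U n)..f i (z0 n c) + C * diameter (U n)}))"
  let ?M = "\<Pi>\<^sub>M i\<in>{..<k}. (lborel :: real measure)"
  have Bx_sets: "Bx n c \<in> sets ?M" for n c
    unfolding Bx_def by (auto intro!: sets_PiM_I_finite)
  have Bx_meas: "emeasure ?M (Bx n c) \<le> ennreal ((2 * C) ^ k) * hm_term s (U n)" for n c
  proof (cases "S n c = {}")
    case True then show ?thesis by (simp add: Bx_def)
  next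
    case False
    then have "z0 n c \<in> S n c" unfolding z0_def by (simp add: some_in_eq)
    then have ne: "U n \<noteq> {}" by (auto simp: S_def)
    have d0: "0 \<le> diameter (U n)" using U(2) by (rule diameter_ge_0)
    have "emeasure ?M (Bx n c) = ennreal (\<Prod>i<k. (f i (z0 n c) + C * diameter (U n)) - (f i (z0 n c) - C * diameter (U n)))"
      using False d0 C0 by (simp add: Bx_def emeasure_box)
    also have "(\<Prod>i<k. (f i (z0 n c) + C * diameter (U n)) - (f i (z0 n c) - C * diameter (U n))) = (2 * C) ^ k * diameter (U n) ^ k"
    proof -
      have "(f i (z0 n c) + C * diameter (U n)) - (f i (z0 n c) - C * diameter (U n)) = 2 * C * diameter (U n)" for i by simp
      then show ?thesis by (simp only: prod_constant card_lessThan power_mult_distrib)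
    qed
    also have "ennreal \<dots> = ennreal ((2 * C) ^ k) * ennreal (diameter (U n) ^ k)" using C0 d0 by (simp add: ennreal_mult)
    also have "\<dots> \<le> ennreal ((2 * C) ^ k) * hm_term s (U n)"
      by (intro mult_left_mono power_diameter_le_hm_term s0 ks k0 ne U) simp
    finally show ?thesis .
  qed
  have cover: "(\<Pi>\<^sub>E i\<in>{..<k}. {0..1}) \<subseteq> (\<Union>n. \<Union>c\<in>Z. Bx n c)"
  proof
    fix y :: "nat \<Rightarrow> real" assume y: "y \<in> (\<Pi>\<^sub>E i\<in>{..<k}. {0..1})"
    then have "0 \<le> y i \<and> y i \<le> 1" if "i < k" for i using that by (auto simp: PiE_iff)
    then obtain z where z: "z \<in> cball o0 R" "\<And>i. i < k \<Longrightarrow> f i z = y i" using surj[of y] by blast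
    obtain c where c: "c \<in> Z" "z \<in> ball c (sep / 8)" using Z(3) z(1) by blast
    obtain n where n: "p z \<in> U n" using U(1) by blast
    have zS: "z \<in> S n c" using c n by (simp add: S_def)
    then have z0S: "z0 n c \<in> S n c" unfolding z0_def by (rule someI)
    have "dist z (z0 n c) = dist (p z) (p (z0 n c))" using local_isometry[of z c "z0 n c"] zS z0S by (simp add: S_def)
    also have "\<dots> \<le> diameter (U n)" using U(2) zS z0S by (intro diameter_bounded_bound) (auto simp: S_def)
    finally have "C * dist z (z0 n c) \<le> C * diameter (U n)" using C0 by simp
    then have "\<bar>y i - f i (z0 n c)\<bar> \<le> C * diameter (U n)" if "i < k" for i
      using f_lip[OF that, of z "z0 n c"] z(2)[OF that] by linarith
    then have "y i \<in> {f i (z0 n c) - C * diameter (U n)..f i (z0 n c) + C * diameter (U n)}" if "i < k" for i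
      using that by (simp add: abs_le_iff) (metis add.commute diff_le_eq le_diff_eq minus_diff_eq minus_le_iff)
    then have "y \<in> Bx n c" using y zS by (auto simp: Bx_def PiE_iff)
    then show "y \<in> (\<Union>n. \<Union>c\<in>Z. Bx n c)" using c(1) by blast
  qed
  have BU_sets: "(\<Union>c\<in>Z. Bx n c) \<in> sets ?M" for n using Bx_sets Z(2) by (intro sets.finite_UN)
  have "1 = emeasure ?M (\<Pi>\<^sub>E i\<in>{..<k}. {0..1})" using emeasure_box[of k "\<lambda>_. 0" "\<lambda>_. 1"] by simp
  also have "\<dots> \<le> emeasure ?M (\<Union>n. \<Union>c\<in>Z. Bx n c)" using cover BU_sets by (intro emeasure_mono sets.countable_UN) auto
  also have "\<dots> \<le> (\<Sum>n. emeasure ?M (\<Union>c\<in>Z. Bx n c))"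
    using BU_sets by (intro emeasure_subadditive_countably) blast
  also have "\<dots> \<le> (\<Sum>n. ennreal J * hm_term s (U n))"
  proof (rule suminf_le)
    fix n
    have "emeasure ?M (\<Union>c\<in>Z. Bx n c) \<le> (\<Sum>c\<in>Z. emeasure ?M (Bx n c))"
      using Bx_sets Z(2) by (intro emeasure_subadditive_finite) auto
    also have "\<dots> \<le> (\<Sum>c\<in>Z. ennreal ((2 * C) ^ k) * hm_term s (U n))" by (intro sum_mono Bx_meas)
    also have "\<dots> = ennreal (real (card Z) * (2 * C) ^ k) * hm_term s (U n)"
      using C0 by (simp add: ennreal_mult ennreal_of_nat_eq_real_of_nat mult.assoc)
    also have "\<dots> \<le> ennreal J * hm_term s (U n)" using C0 by (intro mult_right_mono ennreal_leI) (auto simp: J_def)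
    finally show "emeasure ?M (\<Union>c\<in>Z. Bx n c) \<le> ennreal J * hm_term s (U n)" .
  qed auto
  also have "\<dots> = ennreal J * (\<Sum>n. hm_term s (U n))" by (simp add: ennreal_suminf_cmult)
  also have "\<dots> < ennreal J * ennreal (1 / J)" using U(4) J0 by (intro ennreal_mult_strict_left_mono) auto
  also have "\<dots> = 1" using J0 by (simp flip: ennreal_mult)
  finally show False by simp
qed

end

section \<open>Crystallographic representation\<close>

lemma sum_square_reindex: "(\<Sum>i<k. f i * (\<Sum>j<l. g i j)) = (\<Sum>j<l. \<Sum>i<k. f i * (g i j :: real))"
  unfolding sum_distrib_left by (rule sum.swap)

text \<open>Completing the square in the last variable leaves a positive definite form in the
  others, to which induction applies. Surjectivity is carried along so that the resulting map can
  serve as a change of coordinates.\<close>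

lemma cholesky:
  fixes b :: "nat \<Rightarrow> nat \<Rightarrow> real"
  assumes sym: "\<And>i j. b i j = b j i"
    and pos: "\<And>x. \<exists>i<k. x i \<noteq> 0 \<Longrightarrow> (\<Sum>i<k. \<Sum>j<k. b i j * x i * x j) > 0"
  shows "\<exists>t. (\<forall>x y. (\<Sum>i<k. \<Sum>j<k. b i j * x i * y j) = (\<Sum>l<k. (\<Sum>j<k. t l j * x j) * (\<Sum>j<k. t l j * y j))) \<and>
    (\<forall>y. \<exists>x. \<forall>l<k. (\<Sum>j<k. t l j * x j) = y l)"
  using assms
proof (induction k arbitrary: b)
  case 0 then show ?case by auto
next
  case (Suc k)
  define d where "d = b k k"
  have d: "d > 0"
    using Suc.prems(2)[of "\<lambda>i. if i = k then 1 else 0"] by (simp add: d_def if_distrib[of "(*) _"] cong: if_cong)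
  \<comment> \<open>The Schur complement of the last diagonal entry.\<close>
  define b' where "b' = (\<lambda>i j. b i j - b i k * b j k / d)"
  have ident: "(\<Sum>i<Suc k. \<Sum>j<Suc k. b i j * x i * y j) =
      (\<Sum>i<k. \<Sum>j<k. b' i j * x i * y j) + (\<Sum>j<Suc k. b j k * x j) * (\<Sum>j<Suc k. b j k * y j) / d" for x y :: "nat \<Rightarrow> real"
  proof -
    define X where "X = (\<Sum>i<k. b i k * x i)"
    define Y where "Y = (\<Sum>j<k. b j k * y j)"
    define W where "W = (\<Sum>i<k. \<Sum>j<k. b i j * x i * y j)"
    have 1: "(\<Sum>i<k. b i k * x i * y k) = X * y k" by (simp add: X_def sum_distrib_right)
    have 2: "(\<Sum>j<k. b k j * x k * y j) = x k * Y"
      unfolding Y_def sum_distrib_left using Suc.prems(1)[of k] by (intro sum.cong) (auto simp: algebra_simps)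
    have "(\<Sum>i<Suc k. \<Sum>j<Suc k. b i j * x i * y j) = W + X * y k + x k * Y + d * x k * y k"
      by (simp add: sum.distrib 1 2 W_def d_def)
    moreover have "(\<Sum>i<k. \<Sum>j<k. b' i j * x i * y j) = W - X * Y / d"
    proof -
      have "(\<Sum>i<k. \<Sum>j<k. b i k * b j k / d * x i * y j) = X * Y / d"
        unfolding X_def Y_def sum_product sum_divide_distrib by (intro sum.cong) (auto simp: algebra_simps)
      then show ?thesis by (simp add: b'_def W_def left_diff_distrib sum_subtractf)
    qed
    moreover have "(\<Sum>j<Suc k. b j k * x j) * (\<Sum>j<Suc k. b j k * y j) / d = (X + d * x k) * (Y + d * y k) / d"
      by (simp add: X_def Y_def d_def)
    moreover have "(X + d * x k) * (Y + d * y k) / d = X * Y / d + X * y k + x k * Y + d * x k * y k"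
      using d by (simp add: field_simps)
    ultimately show ?thesis by simp
  qed
  have "\<exists>t. (\<forall>x y. (\<Sum>i<k. \<Sum>j<k. b' i j * x i * y j) = (\<Sum>l<k. (\<Sum>j<k. t l j * x j) * (\<Sum>j<k. t l j * y j))) \<and>
    (\<forall>y. \<exists>x. \<forall>l<k. (\<Sum>j<k. t l j * x j) = y l)"
  proof (rule Suc.IH)
    show "b' i j = b' j i" for i j using Suc.prems(1)[of i j] by (simp add: b'_def mult.commute)
    show "(\<Sum>i<k. \<Sum>j<k. b' i j * x i * x j) > 0" if "\<exists>i<k. x i \<noteq> 0" for x
    proof -
      \<comment> \<open>The last coordinate makes the split-off square vanish, so positivity of the
        full form passes to \<open>b'\<close>.\<close>
      define x' where "x' = (\<lambda>i. if i < k then x i else - (\<Sum>j<k. b j k * x j) / d)"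
      have "(\<Sum>j<Suc k. b j k * x' j) = 0" using d by (simp add: x'_def d_def)
      then have "(\<Sum>i<Suc k. \<Sum>j<Suc k. b i j * x' i * x' j) = (\<Sum>i<k. \<Sum>j<k. b' i j * x' i * x' j)"
        unfolding ident[of x' x'] by simp
      moreover have "\<exists>i<Suc k. x' i \<noteq> 0" using that by (auto simp: x'_def)
      ultimately have "(\<Sum>i<k. \<Sum>j<k. b' i j * x' i * x' j) > 0" using Suc.prems(2)[of x'] by simp
      then show ?thesis by (simp add: x'_def)
    qed
  qed
  then obtain t where t: "\<And>x y. (\<Sum>i<k. \<Sum>j<k. b' i j * x i * y j) = (\<Sum>l<k. (\<Sum>j<k. t l j * x j) * (\<Sum>j<k. t l j * y j))"
    and ts: "\<And>y. \<exists>x. \<forall>l<k. (\<Sum>j<k. t l j * x j) = y l" by blast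
  define t' where "t' = (\<lambda>l j. if l < k then (if j < k then t l j else 0) else b j k / sqrt d)"
  have t1: "(\<Sum>j<Suc k. t' l j * x j) = (\<Sum>j<k. t l j * x j)" if "l < k" for l and x :: "nat \<Rightarrow> real"
    using that by (simp add: t'_def)
  have t2: "(\<Sum>j<Suc k. t' k j * x j) = (\<Sum>j<Suc k. b j k * x j) / sqrt d" for x :: "nat \<Rightarrow> real"
    unfolding sum_divide_distrib by (intro sum.cong) (auto simp: t'_def)
  have "(\<Sum>i<Suc k. \<Sum>j<Suc k. b i j * x i * y j) = (\<Sum>l<Suc k. (\<Sum>j<Suc k. t' l j * x j) * (\<Sum>j<Suc k. t' l j * y j))" for x y
  proof -
    have "(\<Sum>l<Suc k. (\<Sum>j<Suc k. t' l j * x j) * (\<Sum>j<Suc k. t' l j * y j)) =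
        (\<Sum>l<k. (\<Sum>j<k. t l j * x j) * (\<Sum>j<k. t l j * y j)) + (\<Sum>j<Suc k. b j k * x j) / sqrt d * ((\<Sum>j<Suc k. b j k * y j) / sqrt d)"
      unfolding sum.lessThan_Suc[of "\<lambda>l. (\<Sum>j<Suc k. t' l j * x j) * (\<Sum>j<Suc k. t' l j * y j)"] t2
      by (intro arg_cong2[of _ _ _ _ "(+)"] refl sum.cong) (simp_all only: t1 lessThan_iff)
    also have "\<dots> = (\<Sum>i<k. \<Sum>j<k. b' i j * x i * y j) + (\<Sum>j<Suc k. b j k * x j) * (\<Sum>j<Suc k. b j k * y j) / d"
      using d unfolding t by (simp del: sum.lessThan_Suc)
    finally show ?thesis using ident[of x y] by simp
  qed
  moreover have "\<exists>x. \<forall>l<Suc k. (\<Sum>j<Suc k. t' l j * x j) = y l" for y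
  proof -
    obtain x where x: "\<forall>l<k. (\<Sum>j<k. t l j * x j) = y l" using ts by blast
    define x' where "x' = (\<lambda>i. if i < k then x i else (y k * sqrt d - (\<Sum>j<k. b j k * x j)) / d)"
    have "(\<Sum>j<Suc k. t' l j * x' j) = y l" if "l < Suc k" for l
    proof (cases "l < k")
      case True then show ?thesis using x by (simp only: t1) (simp add: x'_def)
    next
      case False
      then have l: "l = k" using that by simp
      have "(\<Sum>j<Suc k. b j k * x' j) = y k * sqrt d" using d by (simp add: x'_def d_def)
      then show ?thesis unfolding l t2 using d by simp
    qed
    then show ?thesis by blast
  qed
  ultimately show ?case by (intro exI[of _ t']) blast
qed

section \<open>Euclidean isometries\<close>

lemma euc_dist_self [simp]: "euc_dist n x x = 0"
  by (simp add: euc_dist_def)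

lemma euc_dist_triangle: "euc_dist n x z \<le> euc_dist n x y + euc_dist n y z"
proof -
  have "euc_dist n u v = L2_set (\<lambda>i. u i - v i) {..<n}" for u v by (simp add: euc_dist_def L2_set_def)
  then show ?thesis using L2_set_triangle_ineq[of "\<lambda>i. x i - y i" "\<lambda>i. y i - z i" "{..<n}"] by simp
qed

lemma group_isom_group: "group (isom_group n)"
proof (rule groupI)
  show "x \<otimes>\<^bsub>isom_group n\<^esub> y \<in> carrier (isom_group n)"
    if "x \<in> carrier (isom_group n)" "y \<in> carrier (isom_group n)" for x y
    using that by (auto simp: isom_group_def euc_isometries_def intro: bij_betw_trans dest: bij_betwE)
  show "\<one>\<^bsub>isom_group n\<^esub> \<in> carrier (isom_group n)" by (simp add: isom_group_def euc_isometries_def)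
  show "x \<otimes>\<^bsub>isom_group n\<^esub> y \<otimes>\<^bsub>isom_group n\<^esub> z = x \<otimes>\<^bsub>isom_group n\<^esub> (y \<otimes>\<^bsub>isom_group n\<^esub> z)" for x y z
    by (simp add: isom_group_def o_assoc)
  show "\<one>\<^bsub>isom_group n\<^esub> \<otimes>\<^bsub>isom_group n\<^esub> x = x" for x by (simp add: isom_group_def)
  show "\<exists>y\<in>carrier (isom_group n). y \<otimes>\<^bsub>isom_group n\<^esub> x = \<one>\<^bsub>isom_group n\<^esub>" if "x \<in> carrier (isom_group n)" for x
  proof -
    have x: "bij_betw x (euc n) (euc n)" "\<And>u v. u \<in> euc n \<Longrightarrow> v \<in> euc n \<Longrightarrow> euc_dist n (x u) (x v) = euc_dist n u v"
      "\<And>u. u \<notin> euc n \<Longrightarrow> x u = u" using that by (auto simp: isom_group_def euc_isometries_def)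
    define y where "y = (\<lambda>u. if u \<in> euc n then inv_into (euc n) x u else u)"
    have b: "bij_betw (inv_into (euc n) x) (euc n) (euc n)" using x(1) by (rule bij_betw_inv_into)
    have "bij_betw y (euc n) (euc n)" using b by (rule bij_betw_cong[THEN iffD1, rotated]) (simp add: y_def)
    moreover have "euc_dist n (y u) (y v) = euc_dist n u v" if "u \<in> euc n" "v \<in> euc n" for u v
    proof -
      have "inv_into (euc n) x u \<in> euc n" "inv_into (euc n) x v \<in> euc n" using bij_betwE[OF b] that by auto
      then have "euc_dist n (x (inv_into (euc n) x u)) (x (inv_into (euc n) x v)) = euc_dist n (inv_into (euc n) x u) (inv_into (euc n) x v)"
        by (rule x(2))
      then show ?thesis using that x(1) by (simp add: y_def bij_betw_inv_into_right)
    qed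
    ultimately have "y \<in> carrier (isom_group n)" by (simp add: isom_group_def euc_isometries_def y_def)
    moreover have "y \<circ> x = id"
    proof
      fix u show "(y \<circ> x) u = id u"
        using x(1,3) bij_betwE[OF x(1)] by (cases "u \<in> euc n") (auto simp: y_def bij_betw_inv_into_left)
    qed
    ultimately show ?thesis by (auto simp: isom_group_def)
  qed
qed

section \<open>The affine action on the real coordinates of the abelian subgroup\<close>

locale virtually_abelian_lattice = rational_basis +
  assumes A_normal: "A \<lhd> G" and fin_cosets: "finite ((\<lambda>g. g <# A) ` carrier G)"
begin

definition conj :: "'a \<Rightarrow> 'a \<Rightarrow> 'a" where "conj g x = g \<otimes> x \<otimes> inv g"

lemma conj_in: "g \<in> carrier G \<Longrightarrow> x \<in> A \<Longrightarrow> conj g x \<in> A"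
  using A_normal by (simp add: normal_inv_iff conj_def)

lemma conj_mult: "g \<in> carrier G \<Longrightarrow> x \<in> carrier G \<Longrightarrow> y \<in> carrier G \<Longrightarrow> conj g (x \<otimes> y) = conj g x \<otimes> conj g y"
proof -
  assume c: "g \<in> carrier G" "x \<in> carrier G" "y \<in> carrier G"
  have "conj g x \<otimes> conj g y = g \<otimes> x \<otimes> (inv g \<otimes> g) \<otimes> y \<otimes> inv g"
    unfolding conj_def using c by (simp only: m_assoc m_closed inv_closed)
  then show ?thesis using c by (simp add: conj_def m_assoc)
qed

lemma conj_conj: "g \<in> carrier G \<Longrightarrow> h \<in> carrier G \<Longrightarrow> x \<in> carrier G \<Longrightarrow> conj (g \<otimes> h) x = conj g (conj h x)"
  by (simp add: conj_def inv_mult_group m_assoc)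

lemma conj_abelian: "b \<in> A \<Longrightarrow> x \<in> A \<Longrightarrow> conj b x = x"
  using A_comm[of b x] A_carrier by (simp add: conj_def m_assoc)

lemma coord_nat_pow: "x \<in> A \<Longrightarrow> coord (x [^] (n::nat)) i = of_nat n * coord x i"
proof (induction n)
  case (Suc n)
  have "x [^] n \<in> A" using subgroup_int_pow_closed[OF A_subgroup Suc.prems, of "int n"] by (simp add: int_pow_int)
  then show ?case using Suc by (simp add: coord_mult algebra_simps)
qed (simp add: coord_one)

lemma coord_int_pow: "x \<in> A \<Longrightarrow> coord (x [^] (n::int)) i = of_int n * coord x i"
proof -
  assume x: "x \<in> A"
  show ?thesis
  proof (cases "0 \<le> n")
    case True
    then obtain m where "n = int m" using nonneg_int_cases by blast
    then show ?thesis using coord_nat_pow[OF x] by (simp add: int_pow_int)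
  next
    case False
    then obtain m where m: "n = - int m" by (metis int_cases2 of_nat_0_le_iff)
    have "x [^] m \<in> A" using subgroup_int_pow_closed[OF A_subgroup x, of "int m"] by (simp add: int_pow_int)
    then show ?thesis using coord_nat_pow[OF x, of m] x m by (simp add: int_pow_neg int_pow_int A_carrier coord_inv)
  qed
qed

lemma coord_mprod_general:
  assumes "\<And>j. j < l \<Longrightarrow> b j \<in> A"
  shows "coord (mprod G b n l) i = (\<Sum>j<l. of_int (n j) * coord (b j) i)"
  using assms
proof (induction l)
  case (Suc l)
  have "mprod G b n l \<in> A" using Suc.prems by (intro mprod_in_subgroup[OF A_subgroup]) auto
  moreover have "b l [^] n l \<in> A" using Suc.prems by (intro subgroup_int_pow_closed[OF A_subgroup]) auto
  ultimately show ?case using Suc by (simp add: coord_mult coord_int_pow)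
qed (simp add: coord_one)

lemma conj_mprod:
  assumes g: "g \<in> carrier G" and "\<And>j. j < l \<Longrightarrow> b j \<in> carrier G"
  shows "conj g (mprod G b n l) = mprod G (\<lambda>j. conj g (b j)) n l"
  using assms(2)
proof (induction l)
  case 0 then show ?case using g by (simp add: conj_def)
next
  case (Suc l)
  have bl: "b l \<in> carrier G" using Suc.prems by simp
  have pow: "conj g (b l [^] n l) = conj g (b l) [^] n l"
  proof (cases "0 \<le> n l")
    case True
    then obtain m where "n l = int m" using nonneg_int_cases by blast
    then show ?thesis using nat_pow_conj[OF bl g, of m] by (simp add: int_pow_int conj_def)
  next
    case False
    then obtain m where m: "n l = - int m" by (metis int_cases2 of_nat_0_le_iff)
    have "inv (g \<otimes> b l [^] m \<otimes> inv g) = g \<otimes> inv (b l [^] m) \<otimes> inv g" using g bl by (simp add: inv_mult_group m_assoc)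
    then show ?thesis using nat_pow_conj[OF bl g, of m] m g bl by (simp add: int_pow_int conj_def int_pow_neg)
  qed
  have "mprod G b n l \<in> carrier G" using Suc.prems by (intro mprod_in_subgroup[OF subgroup_self]) auto
  then show ?case using Suc bl g by (simp add: conj_mult pow)
qed

text \<open>The matrix of conjugation by \<open>g\<close> in the coordinates of the basis, extended
  linearly to real vectors.\<close>

definition M :: "'a \<Rightarrow> (nat \<Rightarrow> real) \<Rightarrow> nat \<Rightarrow> real" where
  "M g x = (\<lambda>i. if i < k then \<Sum>j<k. coord (conj g (a j)) i * x j else 0)"

lemma M_euc: "M g x \<in> euc k"
  by (simp add: M_def euc_def)

lemma coord_euc: "b \<in> A \<Longrightarrow> coord b \<in> euc k"
  by (simp add: euc_def coord_outside)

text \<open>Conjugation commutes with powers, so the claim may be checked on a power of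
  \<open>b\<close> in the span of the basis and divided by the exponent.\<close>

lemma M_coord:
  assumes g: "g \<in> carrier G" and b: "b \<in> A"
  shows "M g (coord b) = coord (conj g b)"
proof
  fix i
  obtain m n where m: "(m::nat) > 0" "b [^] m = mprod G a n k" using a_span[OF b] by blast
  have cb: "coord b j = of_int (n j) / real m" if "j < k" for j using coord_eqI[OF b m] that by simp
  have cgb: "conj g b \<in> A" using conj_in g b by blast
  have "conj g b [^] m = conj g (mprod G a n k)" using nat_pow_conj[of b g m] b g A_carrier m(2) by (simp add: conj_def)
  also have "\<dots> = mprod G (\<lambda>j. conj g (a j)) n k" using g a_in A_carrier by (intro conj_mprod) auto
  finally have "real m * coord (conj g b) i = (\<Sum>j<k. of_int (n j) * coord (conj g (a j)) i)"
    using coord_nat_pow[OF cgb, of m i] coord_mprod_general[of k "\<lambda>j. conj g (a j)" n i] conj_in[OF g] a_in by simp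
  also have "\<dots> = real m * (\<Sum>j<k. coord (conj g (a j)) i * coord b j)"
    unfolding sum_distrib_left using m(1) cb by (intro sum.cong) auto
  finally have "coord (conj g b) i = (\<Sum>j<k. coord (conj g (a j)) i * coord b j)" using m(1) by simp
  then show "M g (coord b) i = coord (conj g b) i"
    using coord_outside[OF cgb, of i] by (cases "i < k") (simp_all add: M_def)
qed

lemma M_mult:
  assumes g: "g \<in> carrier G" and h: "h \<in> carrier G"
  shows "M (g \<otimes> h) x = M g (M h x)"
proof
  fix i
  show "M (g \<otimes> h) x i = M g (M h x) i"
  proof (cases "i < k")
    case True
    have e: "coord (conj (g \<otimes> h) (a j)) i = (\<Sum>l<k. coord (conj g (a l)) i * coord (conj h (a j)) l)" if "j < k" for j
    proof -
      have "coord (conj (g \<otimes> h) (a j)) = M g (coord (conj h (a j)))"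
        using M_coord[OF g conj_in[OF h a_in[OF that]]] conj_conj[OF g h] a_in[OF that] A_carrier by simp
      then show ?thesis using True by (simp add: M_def)
    qed
    have "M (g \<otimes> h) x i = (\<Sum>j<k. (\<Sum>l<k. coord (conj g (a l)) i * coord (conj h (a j)) l) * x j)"
      using True e by (simp add: M_def)
    also have "\<dots> = (\<Sum>l<k. coord (conj g (a l)) i * (\<Sum>j<k. coord (conj h (a j)) l * x j))"
      unfolding sum_square_reindex sum_distrib_right by (intro sum.cong) (auto simp: algebra_simps)
    also have "\<dots> = M g (M h x) i" using True by (simp add: M_def)
    finally show ?thesis .
  qed (simp add: M_def)
qed

lemma M_abelian: "b \<in> A \<Longrightarrow> x \<in> euc k \<Longrightarrow> M b x = x"
proof
  fix i assume b: "b \<in> A" and x: "x \<in> euc k"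
  show "M b x i = x i"
  proof (cases "i < k")
    case True
    have "M b x i = (\<Sum>j<k. (if i = j then 1 else 0) * x j)"
      using True b a_in by (simp add: M_def conj_abelian coord_a)
    also have "\<dots> = x i" using True by (simp add: if_distrib[of "\<lambda>z. z * _"] cong: if_cong)
    finally show ?thesis .
  qed (use x in \<open>simp add: M_def euc_def\<close>)
qed

lemma M_add: "M g (\<lambda>i. x i + y i) i = M g x i + M g y i"
  by (simp add: M_def distrib_left sum.distrib)

lemma M_diff: "M g (\<lambda>i. x i - y i) i = M g x i - M g y i"
  by (simp add: M_def right_diff_distrib sum_subtractf)

lemma M_scaled_sum: "M g (\<lambda>i. (\<Sum>C\<in>Q. f C i) / q) i = (\<Sum>C\<in>Q. M g (f C) i) / q"
proof (cases "i < k")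
  case True
  have "(\<Sum>j<k. coord (conj g (a j)) i * ((\<Sum>C\<in>Q. f C j) / q)) = (\<Sum>j<k. \<Sum>C\<in>Q. coord (conj g (a j)) i * f C j / q)"
    by (simp add: sum_distrib_left sum_divide_distrib)
  also have "\<dots> = (\<Sum>C\<in>Q. \<Sum>j<k. coord (conj g (a j)) i * f C j / q)" by (rule sum.swap)
  finally show ?thesis using True by (simp add: M_def sum_divide_distrib)
qed (simp add: M_def)

definition Q :: "'a set set" where "Q = (\<lambda>g. g <# A) ` carrier G"

definition rep :: "'a set \<Rightarrow> 'a" where "rep C = (SOME t. t \<in> C)"

lemma A_one: "\<one> \<in> A" using A_subgroup by (rule subgroup.one_closed)

lemma A_sub: "A \<subseteq> carrier G" using A_subgroup by (rule subgroup.subset)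

lemma Q_nonempty: "Q \<noteq> {}" and Q_finite: "finite Q"
  using fin_cosets by (auto simp: Q_def)

lemma rep:
  assumes "C \<in> Q"
  shows "rep C \<in> carrier G" "rep C <# A = C"
proof -
  obtain g where g: "g \<in> carrier G" "C = g <# A" using assms by (auto simp: Q_def)
  have "g \<in> C" using g A_one by (force simp: l_coset_def)
  then have "rep C \<in> g <# A" using g unfolding rep_def by (metis someI)
  then show "rep C \<in> carrier G" "rep C <# A = C"
    using l_coset_carrier[OF _ g(1) A_subgroup] l_repr_independence[OF _ g(1) A_subgroup] g(2) by auto
qed

lemma Q_act:
  assumes "C \<in> Q" "g \<in> carrier G"
  shows "g <# C = (g \<otimes> rep C) <# A" "g <# C \<in> Q"
proof -
  have "g <# (rep C <# A) = (g \<otimes> rep C) <# A" using lcos_m_assoc[OF A_sub assms(2) rep(1)[OF assms(1)]] .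
  then show "g <# C = (g \<otimes> rep C) <# A" using rep(2)[OF assms(1)] by simp
  then show "g <# C \<in> Q" using assms(2) rep(1)[OF assms(1)] by (auto simp: Q_def)
qed

lemma Q_carrier: "C \<in> Q \<Longrightarrow> C \<subseteq> carrier G"
  using rep[of C] l_coset_subset_G[OF A_sub] by metis

lemma Q_bij: "h \<in> carrier G \<Longrightarrow> bij_betw (\<lambda>C. h <# C) Q Q"
proof (rule bij_betwI[where g = "\<lambda>C. inv h <# C"])
  assume h: "h \<in> carrier G"
  show "(\<lambda>C. h <# C) \<in> Q \<rightarrow> Q" "(\<lambda>C. inv h <# C) \<in> Q \<rightarrow> Q" using Q_act(2) h by auto
  show "inv h <# (h <# C) = C" if "C \<in> Q" for C
    using that h Q_carrier by (simp add: lcos_m_assoc lcos_mult_one)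
  show "h <# (inv h <# C) = C" if "C \<in> Q" for C
    using that h Q_carrier by (simp add: lcos_m_assoc lcos_mult_one)
qed

text \<open>The defect of equivariance of the section \<open>rep\<close>: \<open>g\<close> times the
  representative of \<open>C\<close> is \<open>\<alpha> g C\<close> times the representative of
  \<open>g <# C\<close>.\<close>

definition \<alpha> :: "'a \<Rightarrow> 'a set \<Rightarrow> 'a" where "\<alpha> g C = g \<otimes> rep C \<otimes> inv (rep (g <# C))"

lemma \<alpha>_in: "g \<in> carrier G \<Longrightarrow> C \<in> Q \<Longrightarrow> \<alpha> g C \<in> A"
proof -
  assume g: "g \<in> carrier G" and C: "C \<in> Q"
  define s where "s = g \<otimes> rep C"
  have s: "s \<in> carrier G" using g rep[OF C] by (simp add: s_def)
  have gC: "g <# C = s <# A" "g <# C \<in> Q" using Q_act[OF C g] by (auto simp: s_def)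
  have "rep (g <# C) \<in> s <# A" using rep[OF gC(2)] gC(1) A_one by (force simp: l_coset_def)
  then obtain b where b: "b \<in> A" "rep (g <# C) = s \<otimes> b" by (auto simp: l_coset_def)
  have "\<alpha> g C = s \<otimes> inv b \<otimes> inv s" using s b A_carrier by (simp add: \<alpha>_def s_def[symmetric] inv_mult_group m_assoc)
  also have "\<dots> = conj s (inv b)" by (simp add: conj_def)
  finally show ?thesis using conj_in[OF s] b(1) A_subgroup by (simp add: subgroup.m_inv_closed)
qed

lemma \<alpha>_cocycle:
  assumes g: "g \<in> carrier G" and h: "h \<in> carrier G" and C: "C \<in> Q"
  shows "\<alpha> (g \<otimes> h) C = conj g (\<alpha> h C) \<otimes> \<alpha> g (h <# C)"
proof -
  define s s' s'' where "s = rep C" and "s' = rep (h <# C)" and "s'' = rep (g <# (h <# C))"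
  have hC: "h <# C \<in> Q" "g <# (h <# C) \<in> Q" using Q_act(2) g h C by auto
  have c: "s \<in> carrier G" "s' \<in> carrier G" "s'' \<in> carrier G" using rep C hC by (auto simp: s_def s'_def s''_def)
  have gh: "(g \<otimes> h) <# C = g <# (h <# C)" using lcos_m_assoc[OF Q_carrier[OF C] g h] by simp
  have "conj g (\<alpha> h C) \<otimes> \<alpha> g (h <# C) = (g \<otimes> (h \<otimes> s \<otimes> inv s') \<otimes> inv g) \<otimes> (g \<otimes> s' \<otimes> inv s'')"
    by (simp add: \<alpha>_def conj_def s_def s'_def s''_def)
  also have "\<dots> = g \<otimes> h \<otimes> s \<otimes> inv s' \<otimes> (inv g \<otimes> g) \<otimes> s' \<otimes> inv s''"
    using c g h by (simp only: m_assoc m_closed inv_closed)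
  also have "\<dots> = g \<otimes> h \<otimes> s \<otimes> (inv s' \<otimes> s') \<otimes> inv s''"
    using c g h by (simp add: m_assoc)
  also have "\<dots> = \<alpha> (g \<otimes> h) C" using c g h by (simp add: \<alpha>_def gh s_def s''_def)
  finally show ?thesis by simp
qed

text \<open>By normality elements of \<open>A\<close> fix every left coset, so the two
  representatives agree and cancel up to a conjugation that is trivial: \<open>b\<close>
  remains.\<close>

lemma \<alpha>_abelian: "b \<in> A \<Longrightarrow> C \<in> Q \<Longrightarrow> \<alpha> b C = b"
proof -
  assume b: "b \<in> A" and C: "C \<in> Q"
  have c: "b \<in> carrier G" "rep C \<in> carrier G" using b A_carrier rep[OF C] by auto
  define b' where "b' = inv (rep C) \<otimes> b \<otimes> rep C"
  have b': "b' \<in> A" using conj_in[of "inv (rep C)" b] b c by (simp add: conj_def b'_def)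
  have "b \<otimes> rep C = rep C \<otimes> b'"
  proof -
    have "rep C \<otimes> b' = (rep C \<otimes> inv (rep C)) \<otimes> b \<otimes> rep C" unfolding b'_def using c by (simp only: m_assoc m_closed inv_closed)
    then show ?thesis using c by simp
  qed
  then have "b \<otimes> rep C \<in> rep C <# A" using b' by (auto simp: l_coset_def)
  then have "(b \<otimes> rep C) <# A = rep C <# A" using l_repr_independence[OF _ c(2) A_subgroup] by simp
  then have "b <# C = C" using Q_act(1)[OF C c(1)] rep(2)[OF C] by simp
  then show ?thesis using c by (simp add: \<alpha>_def m_assoc)
qed

text \<open>Averaging over the finite quotient splits the extension after tensoring with the reals.\<close>

definition cocycle :: "'a \<Rightarrow> nat \<Rightarrow> real" where
  "cocycle g = (\<lambda>i. (\<Sum>C\<in>Q. coord (\<alpha> g C) i) / real (card Q))"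

lemma cocycle_euc: "g \<in> carrier G \<Longrightarrow> cocycle g \<in> euc k"
  by (simp add: euc_def cocycle_def coord_outside \<alpha>_in)

text \<open>Left multiplication by \<open>h\<close> permutes the cosets, so the shift in the second
  factor of \<open>\<alpha>_cocycle\<close> disappears on averaging.\<close>

lemma cocycle_mult:
  assumes g: "g \<in> carrier G" and h: "h \<in> carrier G"
  shows "cocycle (g \<otimes> h) i = M g (cocycle h) i + cocycle g i"
proof -
  have "(\<Sum>C\<in>Q. coord (\<alpha> (g \<otimes> h) C) i) = (\<Sum>C\<in>Q. M g (coord (\<alpha> h C)) i + coord (\<alpha> g (h <# C)) i)"
    using g h Q_act(2) by (intro sum.cong) (auto simp: \<alpha>_cocycle coord_mult conj_in \<alpha>_in M_coord)
  also have "\<dots> = (\<Sum>C\<in>Q. M g (coord (\<alpha> h C)) i) + (\<Sum>C\<in>Q. coord (\<alpha> g (h <# C)) i)" by (rule sum.distrib)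
  also have "(\<Sum>C\<in>Q. coord (\<alpha> g (h <# C)) i) = (\<Sum>C\<in>Q. coord (\<alpha> g C) i)"
    by (rule sum.reindex_bij_betw[OF Q_bij[OF h]])
  finally show ?thesis unfolding cocycle_def M_scaled_sum by (simp add: add_divide_distrib)
qed

lemma cocycle_abelian: "b \<in> A \<Longrightarrow> cocycle b = coord b"
  using Q_finite Q_nonempty by (simp add: cocycle_def \<alpha>_abelian fun_eq_iff)

text \<open>The affine map with linear part \<open>M g\<close>; elements of \<open>A\<close> act as
  translations by their coordinates.\<close>

definition E :: "'a \<Rightarrow> (nat \<Rightarrow> real) \<Rightarrow> nat \<Rightarrow> real" where
  "E g x = (\<lambda>i. M g x i + cocycle g i)"

lemma E_euc: "g \<in> carrier G \<Longrightarrow> E g x \<in> euc k"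
  using M_euc[of g x] cocycle_euc[of g] by (simp add: E_def euc_def)

lemma E_mult: "g \<in> carrier G \<Longrightarrow> h \<in> carrier G \<Longrightarrow> E (g \<otimes> h) x = E g (E h x)"
  by (rule ext) (simp add: E_def M_mult M_add cocycle_mult)

lemma E_abelian: "b \<in> A \<Longrightarrow> x \<in> euc k \<Longrightarrow> E b x = (\<lambda>i. x i + coord b i)"
  by (simp add: E_def M_abelian cocycle_abelian)

lemma E_one: "x \<in> euc k \<Longrightarrow> E \<one> x = x"
  using E_abelian[OF A_one] by (simp add: coord_one)

text \<open>\<open>M g\<close> depends only on the conjugates of the basis, and each of these ranges
  over a finite set because conjugation preserves \<open>tl\<close>.\<close>

lemma finite_M: "finite (M ` carrier G)"
proof -
  define F where "F = (\<lambda>g. restrict (\<lambda>i. conj g (a i)) {..<k})"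
  have "F ` carrier G \<subseteq> (\<Pi>\<^sub>E i\<in>{..<k}. {x \<in> A. tl x \<le> tl (a i)})"
    unfolding F_def image_subset_iff restrict_PiE_iff
    using conj_in a_in A_carrier tl_conj by (simp add: conj_def)
  moreover have "finite (\<Pi>\<^sub>E i\<in>{..<k}. {x \<in> A. tl x \<le> tl (a i)})" by (intro finite_PiE finite_tl_le) auto
  ultimately have "finite (F ` carrier G)" by (rule finite_subset)
  moreover have "M g = (\<lambda>x i. if i < k then \<Sum>j<k. coord (F g j) i * x j else 0)" for g
    by (simp add: M_def F_def fun_eq_iff)
  then have "M ` carrier G \<subseteq> (\<lambda>\<phi> x i. if i < k then \<Sum>j<k. coord (\<phi> j) i * x j else 0) ` F ` carrier G" by blast
  ultimately show ?thesis by (rule finite_surj)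
qed

text \<open>The standard inner product summed over the finitely many linear parts, so that all of
  them become orthogonal; each linear map counts once, however many group elements induce
  it.\<close>

definition form :: "(nat \<Rightarrow> real) \<Rightarrow> (nat \<Rightarrow> real) \<Rightarrow> real" where
  "form x y = (\<Sum>m\<in>M ` carrier G. \<Sum>i<k. m x i * m y i)"

lemma form_invariant:
  assumes g: "g \<in> carrier G"
  shows "form (M g x) (M g y) = form x y"
proof -
  have bij: "bij_betw (\<lambda>m. m \<circ> M g) (M ` carrier G) (M ` carrier G)"
  proof (rule bij_betwI[where g = "\<lambda>m. m \<circ> M (inv g)"])
    have *: "M h \<circ> M g' = M (h \<otimes> g')" if "h \<in> carrier G" "g' \<in> carrier G" for h g'
      using that by (simp add: fun_eq_iff M_mult)
    show "(\<lambda>m. m \<circ> M g) \<in> M ` carrier G \<rightarrow> M ` carrier G" using g * by auto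
    show "(\<lambda>m. m \<circ> M (inv g)) \<in> M ` carrier G \<rightarrow> M ` carrier G" using g * by auto
    show "(m \<circ> M g) \<circ> M (inv g) = m" if "m \<in> M ` carrier G" for m using that g * by (auto simp: m_assoc)
    show "(m \<circ> M (inv g)) \<circ> M g = m" if "m \<in> M ` carrier G" for m using that g * by (auto simp: m_assoc)
  qed
  have "form (M g x) (M g y) = (\<Sum>m\<in>M ` carrier G. \<Sum>i<k. (m \<circ> M g) x i * (m \<circ> M g) y i)" by (simp add: form_def)
  also have "\<dots> = form x y" unfolding form_def
    by (rule sum.reindex_bij_betw[OF bij, of "\<lambda>m. \<Sum>i<k. m x i * m y i"])
  finally show ?thesis .
qed

text \<open>The identity is one of the linear parts and the other summands are nonnegative. This
  makes the form definite on \<open>euc k\<close>.\<close>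

lemma form_ge: "x \<in> euc k \<Longrightarrow> (\<Sum>i<k. x i * x i) \<le> form x x"
proof -
  assume x: "x \<in> euc k"
  have "(\<Sum>i<k. M \<one> x i * M \<one> x i) \<le> form x x" unfolding form_def
    using finite_M by (intro member_le_sum[of "M \<one>" "M ` carrier G" "\<lambda>m. \<Sum>i<k. m x i * m x i"]) (auto intro: sum_nonneg)
  then show ?thesis using M_abelian[OF A_one x] by simp
qed

lemma form_matrix:
  obtains b where "\<And>i j. b i j = b j i" "\<And>x y. form x y = (\<Sum>i<k. \<Sum>j<k. b i j * x i * y j)"
proof -
  define e where "e = (\<lambda>(j::nat) i. if i = j then 1 else (0::real))"
  have Me: "m x i = (\<Sum>j<k. m (e j) i * x j)" if m: "m \<in> M ` carrier G" for m x i
  proof -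
    obtain g where g: "m = M g" using m by blast
    have "M g (e j) i = (if i < k then coord (conj g (a j)) i else 0)" if "j < k" for j
      using that by (simp add: M_def e_def if_distrib[of "(*) _"] cong: if_cong)
    then show ?thesis unfolding g by (simp add: M_def)
  qed
  define b where "b = (\<lambda>i j. form (e i) (e j))"
  have "form x y = (\<Sum>i<k. \<Sum>j<k. b i j * x i * y j)" for x y
  proof -
    have "form x y = (\<Sum>m\<in>M ` carrier G. \<Sum>l<k. (\<Sum>i<k. m (e i) l * x i) * (\<Sum>j<k. m (e j) l * y j))"
      unfolding form_def by (intro sum.cong refl arg_cong2[of _ _ _ _ "(*)"] Me)
    also have "\<dots> = (\<Sum>m\<in>M ` carrier G. \<Sum>l<k. \<Sum>i<k. \<Sum>j<k. m (e i) l * m (e j) l * x i * y j)"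
      unfolding sum_product by (intro sum.cong refl) (simp add: algebra_simps)
    also have "\<dots> = (\<Sum>m\<in>M ` carrier G. \<Sum>i<k. \<Sum>l<k. \<Sum>j<k. m (e i) l * m (e j) l * x i * y j)"
      by (intro sum.cong refl sum.swap)
    also have "\<dots> = (\<Sum>i<k. \<Sum>m\<in>M ` carrier G. \<Sum>l<k. \<Sum>j<k. m (e i) l * m (e j) l * x i * y j)" by (rule sum.swap)
    also have "\<dots> = (\<Sum>i<k. \<Sum>m\<in>M ` carrier G. \<Sum>j<k. \<Sum>l<k. m (e i) l * m (e j) l * x i * y j)"
      by (intro sum.cong refl sum.swap)
    also have "\<dots> = (\<Sum>i<k. \<Sum>j<k. \<Sum>m\<in>M ` carrier G. \<Sum>l<k. m (e i) l * m (e j) l * x i * y j)"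
      by (intro sum.cong refl sum.swap)
    also have "\<dots> = (\<Sum>i<k. \<Sum>j<k. b i j * x i * y j)" unfolding b_def form_def by (simp add: sum_distrib_right)
    finally show ?thesis .
  qed
  moreover have "b i j = b j i" for i j by (simp add: b_def form_def mult.commute)
  ultimately show thesis using that by blast
qed

end

context virtually_abelian_lattice
begin

lemma orthonormal_coordinates:
  obtains t where "\<And>x y. form x y = (\<Sum>l<k. (\<Sum>j<k. t l j * x j) * (\<Sum>j<k. t l j * y j))"
    "\<And>y. \<exists>x. \<forall>l<k. (\<Sum>j<k. t l j * x j) = y l"
proof -
  obtain b where b: "\<And>i j. b i j = b j i" "\<And>x y. form x y = (\<Sum>i<k. \<Sum>j<k. b i j * x i * y j)"
    using form_matrix by blast
  have "\<exists>t. (\<forall>x y. (\<Sum>i<k. \<Sum>j<k. b i j * x i * y j) = (\<Sum>l<k. (\<Sum>j<k. t l j * x j) * (\<Sum>j<k. t l j * y j))) \<and>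
    (\<forall>y. \<exists>x. \<forall>l<k. (\<Sum>j<k. t l j * x j) = y l)"
  proof (rule cholesky[OF b(1)])
    fix x :: "nat \<Rightarrow> real" assume "\<exists>i<k. x i \<noteq> 0"
    then obtain i where i: "i < k" "x i \<noteq> 0" by blast
    \<comment> \<open>Clearing the entries beyond \<open>k\<close> puts the vector into
      \<open>euc k\<close>, where \<open>form_ge\<close> applies.\<close>
    define x' where "x' = (\<lambda>i. if i < k then x i else 0)"
    have "0 < x' i * x' i" using i by (simp add: x'_def) (metis not_real_square_gt_zero)
    also have "\<dots> \<le> (\<Sum>i<k. x' i * x' i)" using i by (intro member_le_sum) auto
    also have "\<dots> \<le> form x' x'" by (rule form_ge) (simp add: x'_def euc_def)
    also have "\<dots> = (\<Sum>i<k. \<Sum>j<k. b i j * x i * x j)" unfolding b(2) by (simp add: x'_def)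
    finally show "0 < (\<Sum>i<k. \<Sum>j<k. b i j * x i * x j)" .
  qed
  then obtain t where "\<And>x y. (\<Sum>i<k. \<Sum>j<k. b i j * x i * y j) = (\<Sum>l<k. (\<Sum>j<k. t l j * x j) * (\<Sum>j<k. t l j * y j))"
      "\<And>y. \<exists>x. \<forall>l<k. (\<Sum>j<k. t l j * x j) = y l" by blast
  then show thesis by (intro that[of t]) (simp_all add: b(2))
qed

lemma torsion_free_G: "torsion_free G"
  unfolding torsion_free_def using nat_pow_eq_one by blast

text \<open>Pigeonhole on the cosets of the powers with exponents from 0 to \<open>card Q\<close>;
  the bound on \<open>m\<close> makes the discreteness constant uniform in \<open>g\<close>.\<close>

lemma power_in_A:
  assumes g: "g \<in> carrier G"
  obtains m :: nat where "0 < m" "m \<le> card Q" "g [^] m \<in> A"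
proof -
  define F where "F = (\<lambda>i::nat. (g [^] i) <# A)"
  have "F ` {..card Q} \<subseteq> Q" using g by (auto simp: F_def Q_def)
  then have "card (F ` {..card Q}) \<le> card Q" using Q_finite card_mono by blast
  then have "\<not> inj_on F {..card Q}" using card_image by fastforce
  then obtain i j where ij: "i \<le> card Q" "j \<le> card Q" "F i = F j" "i < j"
    unfolding inj_on_def by (metis atMost_iff linorder_neqE_nat)
  have "g [^] j \<in> (g [^] j) <# A" using A_one g by (force simp: l_coset_def)
  then have "g [^] j \<in> (g [^] i) <# A" using ij(3) by (simp add: F_def)
  then obtain b where b: "b \<in> A" "g [^] j = g [^] i \<otimes> b" by (auto simp: l_coset_def)
  have "g [^] i \<otimes> g [^] (j - i) = g [^] i \<otimes> b" using b(2) ij(4) g by (simp add: nat_pow_mult)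
  then have "g [^] (j - i) = b" using g b(1) A_carrier by simp
  then show thesis using that[of "j - i"] ij b(1) by simp
qed

theorem bieberbach_G: "bieberbach G"
proof -
  obtain t where t: "\<And>x y. form x y = (\<Sum>l<k. (\<Sum>j<k. t l j * x j) * (\<Sum>j<k. t l j * y j))"
    and tsurj: "\<And>y. \<exists>x. \<forall>l<k. (\<Sum>j<k. t l j * x j) = y l" using orthonormal_coordinates by blast
  \<comment> \<open>A linear isomorphism of \<open>euc k\<close> that carries the invariant form to
    the standard inner product.\<close>
  define T where "T = (\<lambda>x l. if l < k then \<Sum>j<k. t l j * x j else 0)"
  have T_euc: "T x \<in> euc k" for x by (simp add: T_def euc_def)
  have T_diff: "T (\<lambda>i. x i - y i) l = T x l - T y l" for x y l
    by (simp add: T_def right_diff_distrib sum_subtractf)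
  have T_norm: "(\<Sum>l<k. (T x l)\<^sup>2) = form x x" for x by (simp add: T_def t power2_eq_square)
  have T_dist: "euc_dist k (T x) (T y) = sqrt (form (\<lambda>i. x i - y i) (\<lambda>i. x i - y i))" for x y
    unfolding euc_dist_def T_norm[symmetric] T_diff ..
  have T_zero: "T (\<lambda>_. 0) = (\<lambda>_. 0)" by (simp add: T_def fun_eq_iff)
  have T_inj: "inj_on T (euc k)"
  proof (rule inj_onI)
    fix x y assume xy: "x \<in> euc k" "y \<in> euc k" "T x = T y"
    have d: "(\<lambda>i. x i - y i) \<in> euc k" using xy by (simp add: euc_def)
    have "form (\<lambda>i. x i - y i) (\<lambda>i. x i - y i) = 0" unfolding T_norm[symmetric] T_diff using xy(3) by simp
    then have "(\<Sum>i<k. (x i - y i) * (x i - y i)) \<le> 0" using form_ge[OF d] by simp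
    then have "(\<Sum>i<k. (x i - y i) * (x i - y i)) = 0" by (intro antisym sum_nonneg) auto
    then have "x i = y i" if "i < k" for i using that by (simp add: sum_nonneg_eq_0_iff)
    moreover have "x i = y i" if "\<not> i < k" for i using that xy by (simp add: euc_def)
    ultimately show "x = y" by blast
  qed
  have T_surj: "T ` euc k = euc k"
  proof
    show "T ` euc k \<subseteq> euc k" using T_euc by blast
    show "euc k \<subseteq> T ` euc k"
    proof
      fix y assume y: "y \<in> euc k"
      obtain x where x: "\<forall>l<k. (\<Sum>j<k. t l j * x j) = y l" using tsurj by blast
      define x' where "x' = (\<lambda>i. if i < k then x i else 0)"
      have "T x' l = y l" for l using x y by (cases "l < k") (simp_all add: T_def x'_def euc_def)
      then have "T x' = y" by blast
      moreover have "x' \<in> euc k" by (simp add: x'_def euc_def)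
      ultimately show "y \<in> T ` euc k" by blast
    qed
  qed
  define S where "S = inv_into (euc k) T"
  have S_euc: "S y \<in> euc k" if "y \<in> euc k" for y using that T_surj by (simp add: S_def inv_into_into)
  have TS: "T (S y) = y" if "y \<in> euc k" for y using that T_surj by (simp add: S_def f_inv_into_f)
  have ST: "S (T x) = x" if "x \<in> euc k" for x using that T_inj by (simp add: S_def)
  \<comment> \<open>The affine action in orthonormal coordinates; outside \<open>euc k\<close> it is
    the identity, as the encoding of \<open>euc_isometries\<close> prescribes.\<close>
  define \<Theta> where "\<Theta> = (\<lambda>g v. if v \<in> euc k then T (E g (S v)) else v)"
  have \<Theta>_euc: "\<Theta> g v \<in> euc k" if "v \<in> euc k" for g v using that T_euc by (simp add: \<Theta>_def)
  have \<Theta>_mult: "\<Theta> (g \<otimes> h) = \<Theta> g \<circ> \<Theta> h" if "g \<in> carrier G" "h \<in> carrier G" for g h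
    using that by (auto simp: fun_eq_iff \<Theta>_def T_euc E_mult ST E_euc)
  have \<Theta>_one: "\<Theta> \<one> = id" by (auto simp: fun_eq_iff \<Theta>_def E_one S_euc TS)
  have \<Theta>_dist: "euc_dist k (\<Theta> g u) (\<Theta> g v) = euc_dist k u v" if g: "g \<in> carrier G" and uv: "u \<in> euc k" "v \<in> euc k" for g u v
  proof -
    have "(\<lambda>i. E g (S u) i - E g (S v) i) = M g (\<lambda>i. S u i - S v i)" by (simp add: fun_eq_iff E_def M_diff)
    then have "euc_dist k (\<Theta> g u) (\<Theta> g v) = sqrt (form (M g (\<lambda>i. S u i - S v i)) (M g (\<lambda>i. S u i - S v i)))"
      using uv by (simp add: \<Theta>_def T_dist)
    also have "\<dots> = euc_dist k (T (S u)) (T (S v))" using form_invariant[OF g] by (simp add: T_dist)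
    finally show ?thesis using uv by (simp add: TS)
  qed
  have \<Theta>_carrier: "\<Theta> g \<in> carrier (isom_group k)" if g: "g \<in> carrier G" for g
  proof -
    have inv: "\<Theta> g (\<Theta> (inv g) v) = v" "\<Theta> (inv g) (\<Theta> g v) = v" for v
      using \<Theta>_mult[of g "inv g"] \<Theta>_mult[of "inv g" g] g \<Theta>_one by (simp_all add: fun_eq_iff)
    have "bij_betw (\<Theta> g) (euc k) (euc k)"
      using \<Theta>_euc inv by (intro bij_betwI[where g = "\<Theta> (inv g)"]) auto
    then show ?thesis using \<Theta>_dist[OF g] by (simp add: isom_group_def euc_isometries_def \<Theta>_def)
  qed
  define o' where "o' = (\<lambda>_::nat. 0::real)"
  have o'_euc: "o' \<in> euc k" by (simp add: o'_def euc_def)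
  have So: "S o' = o'" using ST[OF o'_euc] T_zero by (simp add: o'_def)
  have \<Theta>_pow: "euc_dist k (\<Theta> (g [^] (m::nat)) o') o' \<le> real m * euc_dist k (\<Theta> g o') o'" if g: "g \<in> carrier G" for g m
  proof (induction m)
    case (Suc m)
    have "euc_dist k (\<Theta> (g [^] Suc m) o') o' \<le> euc_dist k (\<Theta> (g [^] m) (\<Theta> g o')) (\<Theta> (g [^] m) o') + euc_dist k (\<Theta> (g [^] m) o') o'"
      using \<Theta>_mult[of "g [^] m" g] g by (simp add: euc_dist_triangle)
    also have "euc_dist k (\<Theta> (g [^] m) (\<Theta> g o')) (\<Theta> (g [^] m) o') = euc_dist k (\<Theta> g o') o'"
      using g o'_euc \<Theta>_euc by (intro \<Theta>_dist) auto
    finally show ?case using Suc by (simp add: algebra_simps)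
  qed (simp add: \<Theta>_one)
  obtain e where e: "e > 0" "\<And>x. x \<in> A \<Longrightarrow> (\<And>i. i < k \<Longrightarrow> \<bar>coord x i\<bar> < e) \<Longrightarrow> x = \<one>" using coord_discrete by blast
  define N where "N = real (card Q)"
  have N0: "N > 0" using Q_finite Q_nonempty by (simp add: N_def card_gt_0_iff)
  \<comment> \<open>Some power of \<open>g\<close> with exponent at most \<open>N\<close> lies in
    \<open>A\<close> and moves the origin by less than \<open>e\<close>, hence is trivial, and so is
    \<open>g\<close> by torsion-freeness. Both discreteness and injectivity rest on this.\<close>
  have small: "g = \<one>" if g: "g \<in> carrier G" and lt: "euc_dist k (\<Theta> g o') o' < e / N" for g
  proof -
    obtain m :: nat where m: "0 < m" "m \<le> card Q" "g [^] m \<in> A" using power_in_A[OF g] by blast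
    have "\<Theta> (g [^] m) o' = T (coord (g [^] m))"
      using o'_euc So E_abelian[OF m(3) o'_euc] by (simp add: \<Theta>_def) (simp add: o'_def)
    then have "sqrt (form (coord (g [^] m)) (coord (g [^] m))) = euc_dist k (\<Theta> (g [^] m) o') o'"
      using T_dist[of "coord (g [^] m)" o'] T_zero by (simp add: o'_def)
    also have "\<dots> \<le> real m * euc_dist k (\<Theta> g o') o'" by (rule \<Theta>_pow[OF g])
    also have "\<dots> < N * (e / N)"
    proof (rule mult_le_less_imp_less)
      show "real m \<le> N" using m(2) by (simp add: N_def)
    qed (use lt m(1) in \<open>auto simp: euc_dist_def intro: sum_nonneg\<close>)
    also have "\<dots> = e" using N0 by simp
    finally have s: "sqrt (form (coord (g [^] m)) (coord (g [^] m))) < e" .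
    have "\<bar>coord (g [^] m) i\<bar> < e" if i: "i < k" for i
    proof -
      have "(coord (g [^] m) i)\<^sup>2 \<le> (\<Sum>i<k. (coord (g [^] m) i)\<^sup>2)" using i by (intro member_le_sum) auto
      also have "\<dots> \<le> form (coord (g [^] m)) (coord (g [^] m))"
        using form_ge[OF coord_euc[OF m(3)]] by (simp add: power2_eq_square)
      finally have "sqrt ((coord (g [^] m) i)\<^sup>2) \<le> sqrt (form (coord (g [^] m)) (coord (g [^] m)))" by (rule real_sqrt_le_mono)
      then show ?thesis using s by simp
    qed
    then have "g [^] m = \<one>" using e(2) m(3) by blast
    then show ?thesis using nat_pow_eq_one[OF g] m(1) by blast
  qed
  have \<Theta>_inj: "inj_on \<Theta> (carrier G)"
  proof (rule inj_onI)
    fix g h assume gh: "g \<in> carrier G" "h \<in> carrier G" "\<Theta> g = \<Theta> h"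
    have "\<Theta> (inv h \<otimes> g) = \<Theta> (inv h \<otimes> h)" using gh \<Theta>_mult[of "inv h" g] \<Theta>_mult[of "inv h" h] by (simp del: l_inv)
    then have "\<Theta> (inv h \<otimes> g) = id" using gh \<Theta>_one by simp
    then have "inv h \<otimes> g = \<one>" using small[of "inv h \<otimes> g"] gh e(1) N0 by simp
    then show "g = h" using gh by (metis inv_closed inv_equality inv_inv)
  qed
  interpret I: group "isom_group k" by (rule group_isom_group)
  interpret h: group_hom G "isom_group k" \<Theta>
    by unfold_locales (use \<Theta>_carrier in \<open>auto simp: hom_def \<Theta>_mult isom_group_def\<close>)
  define \<Gamma> where "\<Gamma> = \<Theta> ` carrier G"
  have "subgroup \<Gamma> (isom_group k)" unfolding \<Gamma>_def by (rule h.img_is_subgroup)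
  moreover have "discrete_isom_subgroup k \<Gamma>"
  proof -
    \<comment> \<open>Radius 0 suffices: the displacement of the origin alone detects every
      nontrivial element.\<close>
    have "\<gamma> = id" if \<gamma>: "\<gamma> \<in> \<Gamma>" "\<forall>x\<in>euc k. euc_dist k x (\<lambda>_. 0) \<le> 0 \<longrightarrow> euc_dist k (\<gamma> x) x < e / N" for \<gamma>
    proof -
      obtain g where g: "g \<in> carrier G" "\<gamma> = \<Theta> g" using \<gamma>(1) by (auto simp: \<Gamma>_def)
      have "euc_dist k (\<Theta> g o') o' < e / N" using \<gamma>(2) o'_euc g(2) by (simp add: o'_def)
      then have "g = \<one>" using small g(1) by blast
      then show "\<gamma> = id" using g(2) \<Theta>_one by simp
    qed
    moreover have "e / N > 0" using e(1) N0 by simp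
    ultimately show ?thesis unfolding discrete_isom_subgroup_def by (meson order_refl)
  qed
  \<comment> \<open>Integer translations from the lattice reduce \<open>S x\<close> to a vector with
    entries of absolute value at most 1, and the radius bounds \<open>T\<close> on such
    vectors.\<close>
  moreover have "cocompact_isom_subgroup k \<Gamma>"
    unfolding cocompact_isom_subgroup_def
  proof (intro exI[of _ "sqrt (\<Sum>l<k. (\<Sum>j<k. \<bar>t l j\<bar>)\<^sup>2)"] ballI)
    fix x assume x: "x \<in> euc k"
    define v where "v = S x"
    have v: "v \<in> euc k" using S_euc[OF x] by (simp add: v_def)
    define b where "b = mprod G a (\<lambda>i. \<lfloor>v i\<rfloor>) k"
    have b: "b \<in> A" unfolding b_def using A_subgroup a_in by (rule mprod_in_subgroup)
    have cb: "coord b i = (if i < k then of_int \<lfloor>v i\<rfloor> else 0)" for i unfolding b_def coord_mprod by simp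
    define y0 where "y0 = (\<lambda>i. v i - coord b i)"
    have y0: "y0 \<in> euc k" using v coord_euc[OF b] by (simp add: y0_def euc_def)
    have y0b: "\<bar>y0 j\<bar> \<le> 1" if "j < k" for j using that unfolding y0_def cb by (simp, linarith)
    have "\<Theta> b (T y0) = T (\<lambda>i. y0 i + coord b i)" using T_euc ST[OF y0] E_abelian[OF b y0] by (simp add: \<Theta>_def)
    also have "(\<lambda>i. y0 i + coord b i) = v" by (simp add: y0_def)
    also have "T v = x" using TS[OF x] by (simp add: v_def)
    finally have "\<Theta> b (T y0) = x" .
    moreover have "\<Theta> b \<in> \<Gamma>" using b A_carrier by (auto simp: \<Gamma>_def)
    moreover have "euc_dist k (T y0) (\<lambda>_. 0) \<le> sqrt (\<Sum>l<k. (\<Sum>j<k. \<bar>t l j\<bar>)\<^sup>2)"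
      unfolding euc_dist_def
    proof (intro real_sqrt_le_mono sum_mono)
      fix l assume "l \<in> {..<k}"
      then have "\<bar>T y0 l\<bar> \<le> (\<Sum>j<k. \<bar>t l j * y0 j\<bar>)" by (simp add: T_def sum_abs)
      also have "\<dots> \<le> (\<Sum>j<k. \<bar>t l j\<bar>)"
        using y0b by (intro sum_mono) (auto simp: abs_mult mult_left_le)
      finally show "(T y0 l - 0)\<^sup>2 \<le> (\<Sum>j<k. \<bar>t l j\<bar>)\<^sup>2" by (simp add: abs_le_square_iff[symmetric] sum_nonneg)
    qed
    ultimately show "\<exists>g\<in>\<Gamma>. \<exists>y\<in>euc k. euc_dist k y (\<lambda>_. 0) \<le> sqrt (\<Sum>l<k. (\<Sum>j<k. \<bar>t l j\<bar>)\<^sup>2) \<and> g y = x"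
      using T_euc by blast
  qed
  moreover have "G \<cong> (isom_group k)\<lparr>carrier := \<Gamma>\<rparr>"
  proof (rule is_isoI)
    show "\<Theta> \<in> iso G ((isom_group k)\<lparr>carrier := \<Gamma>\<rparr>)"
      using \<Theta>_inj by (simp add: iso_def hom_def bij_betw_def \<Gamma>_def isom_group_def \<Theta>_mult)
  qed
  ultimately show ?thesis unfolding bieberbach_def using torsion_free_G is_group by blast
qed

end

section \<open>Solvable groups of bounded rank and solvable subgroups of the fundamental
  group\<close>

context translation_length_finite_rank
begin

theorem solvable_bieberbach:
  assumes "solvable G"
  shows "bieberbach G"
proof -
  obtain A a k where A: "A \<lhd> G" "rational_basis G len tl r A a k" "finite ((\<lambda>g. g <# A) ` carrier G)"
    using solvable_virtually_abelian[OF assms] by blast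
  interpret virtually_abelian_lattice G len tl r A a k
    using A by (intro virtually_abelian_lattice.intro virtually_abelian_lattice_axioms.intro)
  show ?thesis by (rule bieberbach_G)
qed

end

theorem theorem2:
  fixes p :: "'b::metric_space \<Rightarrow> 'a::metric_space"
    and x0 :: 'a
    and H :: "(real \<Rightarrow> 'a) set set"
  assumes "compact (UNIV :: 'a set)"
    and "length_space TYPE('a)"
    and "locally simply_connected (UNIV :: 'a set)"
    and "universal_cover_length p"
    and "unique_geodesics TYPE('b)"
    and "hausdorff_dim (UNIV :: 'a set) < \<infinity>"
    and "subgroup H (fundamental_group x0)"
    and "solvable ((fundamental_group x0)\<lparr>carrier := H\<rparr>)"
  shows "bieberbach ((fundamental_group x0)\<lparr>carrier := H\<rparr>)"
proof -
  have cover: "covering_space UNIV p UNIV" "lifted_length_metric p" "simply_connected (UNIV :: 'b set)"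
    using assms(4) unfolding universal_cover_length_def by blast+
  interpret no_conjugate_points p
    by (intro no_conjugate_points.intro length_covering.intro no_conjugate_points_axioms.intro cover assms(1,2,5))
  let ?G = "(fundamental_group x0)\<lparr>carrier := H\<rparr>"
  obtain act where grp: "group (fundamental_group x0)"
    and act: "\<And>g. g \<in> carrier (fundamental_group x0) \<Longrightarrow> act g \<in> deck p"
      "\<And>g h. \<lbrakk>g \<in> carrier (fundamental_group x0); h \<in> carrier (fundamental_group x0)\<rbrakk> \<Longrightarrow>
         act (g \<otimes>\<^bsub>fundamental_group x0\<^esub> h) = act g \<circ> act h"
      "inj_on act (carrier (fundamental_group x0))" "act \<one>\<^bsub>fundamental_group x0\<^esub> = id"
    by (fact fundamental_group_action[of x0])
  have sub: "H \<subseteq> carrier (fundamental_group x0)" using assms(7) by (rule subgroup.subset)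
  \<comment> \<open>The subgroup inherits the deck action, so the rank bound and the group theory
    apply to it directly rather than to the whole fundamental group.\<close>
  have "group ?G" using assms(7) grp by (rule subgroup.subgroup_is_group)
  then interpret D: deck_action p ?G act
  proof (intro deck_action.intro deck_action_axioms.intro no_conjugate_points_axioms)
    show "act g \<in> deck p" if "g \<in> carrier ?G" for g using act(1) sub that by auto
    show "act (g \<otimes>\<^bsub>?G\<^esub> h) = act g \<circ> act h" if "g \<in> carrier ?G" "h \<in> carrier ?G" for g h
      using act(2)[of g h] sub that by auto
    show "inj_on act (carrier ?G)" using act(3) sub by (simp add: inj_on_subset)
  qed
  obtain s where s: "0 \<le> s" "hausdorff_measure s (UNIV :: 'a set) = 0"
    using assms(6) unfolding hausdorff_dim_def Inf_less_iff by blast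
  \<comment> \<open>The added 1 covers \<open>k = 0\<close> when \<open>s = 0\<close>.\<close>
  have "k < nat \<lceil>s\<rceil> + 1" if "commuting_family ?G a k" "independent_family ?G a k" for a k
  proof -
    have "real k < s \<or> k = 0" using that by (rule D.no_large_independent_family[OF s(2,1)])
    then show ?thesis by linarith
  qed
  then have "translation_length_finite_rank ?G D.len D.tl D.sep (nat \<lceil>s\<rceil> + 1)"
    by (intro translation_length_finite_rank.intro[OF D.translation_length_act]
        translation_length_finite_rank_axioms.intro)
  then show ?thesis using assms(8) by (rule translation_length_finite_rank.solvable_bieberbach)
qed

end
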